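(* Let $a,b,q,t\in\mathbb C^*$ be generic and fix a partition $\lambda\subset m^n$. (1) Let $1\le l<n$ and let $0\le \mu_n\le\mu_{n-1}\le\cdots\le\mu_{l+1}$ be a sequence of integers such that $\mu_{l+1}<\lambda_{l+1}$. Then, for all $x_1,\dots,x_l\in\mathbb C^*$, $$P^{*(m,n)}_\lambda(x_1,\dots,x_l,\,aq^{\mu_{l+1}}t^{n-l-1},\dots,aq^{\mu_n};a,b;q,t;p)=0.$$ (2) Let $1\le l\le n$ and let $m\ge\mu_1\ge\mu_2\ge\cdots\ge\mu_l$ be a sequence of integers such that $\mu_l>\lambda_l$. Then, for all $x_{l+1},\dots,x_n\in\mathbb C^*$, $$P^{*(m,n)}_\lambda(bq^{m-\mu_1},\dots,bq^{m-\mu_l}t^{l-1},\,x_{l+1},\dots,x_n;a,b;q,t;p)=0.$$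
   Context: Fix $p\in\mathbb C$, $0<|p|<1$. $\theta(x;p)=\prod_{k\ge 0}(1-p^kx)(1-p^{k+1}/x)$. Several arguments before the first semicolon mean the product over the arguments. Partitions are identified with diagrams $\{(i,j):1\le j\le\lambda_i\}$; $m^n$ is the partition with $n$ parts equal to $m$; for $\lambda\subset m^n$, $(m^n-\lambda)_i=m-\lambda_{n+1-i}$. $C^0_\lambda(x;q,t;p)=\prod_{(i,j)\in\lambda}\theta(q^{j-1}t^{1-i}x;p)$. Interpolation theta functions: a $BC_n$-symmetric theta function of degree $m$ is a holomorphic $f$ on $(\mathbb C^* )^n$ invariant under permutations of the $x_i$ and under each $x_i\mapsto1/x_i$, with $f(px_1,x_2,\dots,x_n)=(px_1^2)^{-m}f(x_1,\dots,x_n)$. For $\lambda\subset m^n$ and generic $a,b,q,t$, $P^{*(m,n)}_\lambda(x_1,\dots,x_n;a,b;q,t;p)$ is the unique $BC_n$-symmetric theta function of degree $m$ such that: (i) for every partition $\mu\subset m^n$, $\mu\ne\lambda$, it vanishes at the point with $x_i=bq^{m-\mu_i}t^{i-1}$ for $1\le i\le l$ and $x_i=aq^{\mu_i}t^{n-i}$ for $l<i\le n$, where $l_0$ is the largest index with $\mu_{l_0}\ne\lambda_{l_0}$, $l_1$ is the largest index with $\mu_{l_1}=m$ ($0$ if none), and $l=l_1$ if $\mu_{l_0}<\lambda_{l_0}$, $l=l_0$ otherwise; (ii) at $x_i=vt^{n-i}$ its value is $C^0_\lambda(t^{n-1}av,a/v;q,t;p)\,C^0_{m^n-\lambda}(t^{n-1}bv,b/v;q,t;p)$,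 for a generic $v\in\mathbb C^*$ (the function does not depend on $v$). *)

theory Defs
  imports "HOL-Analysis.Analysis"
begin

definition jtheta :: "complex \<Rightarrow> complex \<Rightarrow> complex" where
  "jtheta p x = (\<Prod>k. (1 - p ^ k * x) * (1 - p ^ (k + 1) / x))"

text \<open>A partition contained in the rectangle \<open>m\<^sup>n\<close> is a function on all of
  \<^typ>\<open>nat\<close> with parts at the indices \<open>1, \<dots>, n\<close> and value 0 at every other index
  (including the unused index 0), so equality of partitions is equality of functions.\<close>

definition partitions_in :: "nat \<Rightarrow> nat \<Rightarrow> (nat \<Rightarrow> nat) set" where
  "partitions_in m n =
     {lam. (\<forall>i\<in>{1..n}. lam i \<le> m) \<and>
           (\<forall>i\<in>{1..n}. \<forall>j\<in>{1..n}. i \<le> j \<longrightarrow> lam j \<le> lam i) \<and>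
           (\<forall>i. i \<notin> {1..n} \<longrightarrow> lam i = 0)}"

definition diagram :: "(nat \<Rightarrow> nat) \<Rightarrow> (nat \<times> nat) set" where
  "diagram lam = {(i, j). 1 \<le> i \<and> 1 \<le> j \<and> j \<le> lam i}"

definition rect_compl :: "nat \<Rightarrow> nat \<Rightarrow> (nat \<Rightarrow> nat) \<Rightarrow> (nat \<Rightarrow> nat)" where
  "rect_compl m n lam = (\<lambda>i. if i \<in> {1..n} then m - lam (n + 1 - i) else 0)"

definition C0 :: "(nat \<Rightarrow> nat) \<Rightarrow> complex \<Rightarrow> complex \<Rightarrow> complex \<Rightarrow> complex \<Rightarrow> complex" where
  "C0 lam x q t p =
     (\<Prod>(i, j)\<in>diagram lam. jtheta p (q ^ (j - 1) * t powi (1 - int i) * x))"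

text \<open>The points \<open>(x\<^sub>1, \<dots>, x\<^sub>n)\<close> of the torus are the functions that are nonzero on
  \<open>{1..n}\<close> and \<^const>\<open>undefined\<close> elsewhere. The topology that this set inherits from
  the product topology on functions is that of the n-th power of the punctured plane.\<close>

definition torus :: "nat \<Rightarrow> (nat \<Rightarrow> complex) set" where
  "torus n = {1..n} \<rightarrow>\<^sub>E (- {0})"

definition holomorphic_on_torus :: "nat \<Rightarrow> ((nat \<Rightarrow> complex) \<Rightarrow> complex) \<Rightarrow> bool" where
  "holomorphic_on_torus n f \<longleftrightarrow>
     continuous_on (torus n) f \<and>
     (\<forall>x\<in>torus n. \<forall>i\<in>{1..n}. (\<lambda>z. f (x(i := z))) holomorphic_on (- {0}))"

definition BC_theta :: "complex \<Rightarrow> nat \<Rightarrow> nat \<Rightarrow> ((nat \<Rightarrow> complex) \<Rightarrow> complex) \<Rightarrow> bool" where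
  "BC_theta p m n f \<longleftrightarrow>
     holomorphic_on_torus n f \<and>
     (\<forall>x\<in>torus n. \<forall>\<pi>. \<pi> permutes {1..n} \<longrightarrow> f (x \<circ> \<pi>) = f x) \<and>
     (\<forall>x\<in>torus n. \<forall>i\<in>{1..n}. f (x(i := 1 / x i)) = f x) \<and>
     (n \<ge> 1 \<longrightarrow> (\<forall>x\<in>torus n. f (x(1 := p * x 1)) = (p * (x 1)\<^sup>2) powi (- int m) * f x))"

text \<open>Genericity of a tuple of nonzero parameters: no nontrivial monomial in them is an
  integral power of \<open>p\<close>. This excludes countably many hypersurfaces, the zero sets of
  \<open>\<theta>(M;p)\<close> for the nontrivial Laurent monomials \<open>M\<close>.\<close>

definition generic_params :: "complex \<Rightarrow> complex list \<Rightarrow> bool" where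
  "generic_params p cs \<longleftrightarrow>
     0 \<notin> set cs \<and>
     (\<forall>(e :: nat \<Rightarrow> int) (s :: int).
        (\<Prod>i<length cs. (cs ! i) powi e i) = p powi s \<longrightarrow> (\<forall>i<length cs. e i = 0))"

definition last_diff :: "nat \<Rightarrow> (nat \<Rightarrow> nat) \<Rightarrow> (nat \<Rightarrow> nat) \<Rightarrow> nat" where
  "last_diff n lam mu = Max {i \<in> {1..n}. mu i \<noteq> lam i}"

definition last_full :: "nat \<Rightarrow> nat \<Rightarrow> (nat \<Rightarrow> nat) \<Rightarrow> nat" where
  "last_full m n mu = Max (insert 0 {i \<in> {1..n}. mu i = m})"

definition split_index :: "nat \<Rightarrow> nat \<Rightarrow> (nat \<Rightarrow> nat) \<Rightarrow> (nat \<Rightarrow> nat) \<Rightarrow> nat" where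
  "split_index m n lam mu =
     (let l0 = last_diff n lam mu in if mu l0 < lam l0 then last_full m n mu else l0)"

definition vanishing_point ::
  "nat \<Rightarrow> nat \<Rightarrow> (nat \<Rightarrow> nat) \<Rightarrow> (nat \<Rightarrow> nat) \<Rightarrow> complex \<Rightarrow> complex \<Rightarrow> complex \<Rightarrow> complex
     \<Rightarrow> (nat \<Rightarrow> complex)" where
  "vanishing_point m n lam mu a b q t =
     (\<lambda>i\<in>{1..n}. if i \<le> split_index m n lam mu
                  then b * q ^ (m - mu i) * t ^ (i - 1)
                  else a * q ^ mu i * t ^ (n - i))"

text \<open>\<open>is_interp_theta p m n lam a b q t P\<close> says that \<open>P\<close> (as a function on
  \<^term>\<open>torus n\<close>) is the interpolation theta function attached to \<open>lam\<close>. The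
  normalization is required at one generic \<open>v\<close> only.\<close>

definition is_interp_theta ::
  "complex \<Rightarrow> nat \<Rightarrow> nat \<Rightarrow> (nat \<Rightarrow> nat) \<Rightarrow> complex \<Rightarrow> complex \<Rightarrow> complex \<Rightarrow> complex
     \<Rightarrow> ((nat \<Rightarrow> complex) \<Rightarrow> complex) \<Rightarrow> bool" where
  "is_interp_theta p m n lam a b q t P \<longleftrightarrow>
     BC_theta p m n P \<and>
     (\<forall>mu\<in>partitions_in m n. mu \<noteq> lam \<longrightarrow> P (vanishing_point m n lam mu a b q t) = 0) \<and>
     (\<exists>v. generic_params p [a, b, q, t, v] \<and>
        P (\<lambda>i\<in>{1..n}. v * t ^ (n - i)) =
          C0 lam (t powi (int n - 1) * a * v) q t p * C0 lam (a / v) q t p *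
          (C0 (rect_compl m n lam) (t powi (int n - 1) * b * v) q t p *
           C0 (rect_compl m n lam) (b / v) q t p))"

end

theory Submission
  imports Defs "HOL-Complex_Analysis.Complex_Analysis"
begin

text \<open>Listing partitions in increasing order, the two families of points are read off the grids
  \<open>a q\<^sup>k t\<^sup>j\<close> and \<open>b q\<^sup>k t\<^sup>j\<close>. A symmetric theta function of degree \<open>m\<close> that vanishes whenever one
  variable equals \<open>c\<close> is divisible by \<open>\<Prod>\<^sub>i \<theta>(cx\<^sub>i,c/x\<^sub>i;p)\<close>; together with the restriction to \<open>x\<^sub>n = a\<close>
  this gives inductions on \<open>m\<close> and \<open>n\<close>. They turn the defining conditions into vanishing at the
  \<open>b\<close>-points of all \<open>\<mu>\<close> not contained in \<open>\<lambda>\<close> and at the \<open>a\<close>-points of all \<open>\<mu>\<close> lexicographically below \<open>\<lambda>\<close>,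
  and show that a function with these zeros which also vanishes at the \<open>a\<close>-point of \<open>\<lambda>\<close> is zero.

  Vanishing at the \<open>a\<close>-points of all \<open>\<mu>\<close> not containing \<open>\<lambda>\<close> is not formal: it uses the
  difference operator that shifts every variable by \<open>q\<^sup>\<plusminus>\<^sup>1\<^sup>/\<^sup>2\<close>. Its value at \<open>\<mu>\<close> involves only
  partitions contained in \<open>\<mu>\<close>, it preserves the known zeros (for the parameters \<open>a/q\<^sup>1\<^sup>/\<^sup>2\<close>,
  \<open>b/q\<^sup>1\<^sup>/\<^sup>2\<close>), and it has a free parameter, which can be chosen such that the coefficient at \<open>\<lambda>\<close>
  vanishes while the one at a minimal bad \<open>\<mu>\<close> does not.

  Finally, the vanishing on points extends to slices by counting zeros in the free variables.\<close>

section \<open>The theta function\<close>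

text \<open>The symmetric theta functions of degree m in n variables form a space of dimension
  binomial(m+n, n), the number of partitions in the rectangle. Fixing a variable at c and dividing
  by the theta factors of c are the two terms of Pascal's rule, so each induction follows that
  recursion and no dimension has to be computed. Division in several variables would call for
  removable singularities along hypersurfaces. Instead, functions live on sets of pairwise
  inequivalent points and only one-variable slices are required to be theta functions. Each division
  discards the orbit of c, a countable set; moving a point within its orbit, and finally continuity
  in each variable, puts it back. On the a-side these moves see only the lexicographic order. The
  difference operator sees containment: a term whose shifted point is not that of a partition has
  coefficient 0. Since the operator evaluates at points multiplied by q^(1/2), its image is tested
  at a/q^(1/2) and b/q^(1/2), with \<alpha> unchanged. Two of its four parameters take these values
  to confine the sum, and quasi-periodicity fixes the product of all four; one remains free.\<close>

definition qprod :: "complex \<Rightarrow> complex \<Rightarrow> complex" where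
  "qprod p x = (\<Prod>k. 1 - p ^ k * x)"

lemma
  assumes "norm p < 1"
  shows convergent_qprod: "convergent_prod (\<lambda>k. 1 - p ^ k * x)"
    and qprod_LIMSEQ: "(\<lambda>n. \<Prod>k<n. 1 - p ^ k * x) \<longlonglongrightarrow> qprod p x"
proof -
  have "summable (\<lambda>k. norm (p ^ k * x))"
    using assms by (simp add: norm_mult norm_power summable_mult2)
  then have "abs_convergent_prod (\<lambda>k. 1 - p ^ k * x)"
    by (intro summable_imp_abs_convergent_prod) simp
  then show *: "convergent_prod (\<lambda>k. 1 - p ^ k * x)"
    by (rule abs_convergent_prod_imp_convergent_prod)
  show "(\<lambda>n. \<Prod>k<n. 1 - p ^ k * x) \<longlonglongrightarrow> qprod p x"
    using convergent_prod_LIMSEQ[OF *] unfolding qprod_def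
    by (subst filterlim_sequentially_Suc[symmetric]) (simp add: lessThan_Suc_atMost)
qed

lemma qprod_rec:
  assumes "norm p < 1"
  shows "qprod p x = (1 - x) * qprod p (p * x)"
proof (rule LIMSEQ_unique)
  show "(\<lambda>n. \<Prod>k<Suc n. 1 - p ^ k * x) \<longlonglongrightarrow> qprod p x"
    using LIMSEQ_Suc[OF qprod_LIMSEQ[OF assms]] .
  have "(\<lambda>n. (1 - x) * (\<Prod>k<n. 1 - p ^ k * (p * x))) \<longlonglongrightarrow> (1 - x) * qprod p (p * x)"
    by (intro tendsto_intros qprod_LIMSEQ[OF assms])
  moreover have "(\<Prod>k<Suc n. 1 - p ^ k * x) = (1 - x) * (\<Prod>k<n. 1 - p ^ k * (p * x))" for n
    unfolding prod.lessThan_Suc_shift by (simp add: mult_ac)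
  ultimately show "(\<lambda>n. \<Prod>k<Suc n. 1 - p ^ k * x) \<longlonglongrightarrow> (1 - x) * qprod p (p * x)"
    by simp
qed

lemma qprod_eq_0_iff:
  assumes "norm p < 1"
  shows "qprod p x = 0 \<longleftrightarrow> (\<exists>k. p ^ k * x = 1)"
proof
  assume "qprod p x = 0"
  then show "\<exists>k. p ^ k * x = 1"
    using prodinf_nonzero[OF convergent_qprod[OF assms, of x]] unfolding qprod_def by fastforce
next
  have "p ^ k * x = 1 \<Longrightarrow> qprod p x = 0" for k
  proof (induction k arbitrary: x)
    case 0
    then show ?case using qprod_rec[OF assms, of x] by simp
  next
    case (Suc k)
    then have "qprod p (p * x) = 0" by (simp add: mult_ac)
    then show ?case using qprod_rec[OF assms, of x] by simp
  qed
  then show "\<exists>k. p ^ k * x = 1 \<Longrightarrow> qprod p x = 0" by blast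
qed

text \<open>The partial products converge uniformly on unit discs by the M-test with the geometric
  bound |p|^n (|x| + 1), and locally uniform limits of polynomials are holomorphic.\<close>

lemma holomorphic_qprod_UNIV:
  assumes "norm p < 1"
  shows "qprod p holomorphic_on UNIV"
proof (rule holomorphic_uniform_sequence[of UNIV "\<lambda>n x. \<Prod>k<n. 1 - p ^ k * x"])
  fix x :: complex
  have "uniformly_convergent_on (cball x 1) (\<lambda>N y. \<Prod>n<N. 1 - p ^ n * y)"
  proof (rule uniformly_convergent_on_prod')
    show "uniformly_convergent_on (cball x 1) (\<lambda>N y. \<Sum>n<N. norm (1 - p ^ n * y - 1))"
    proof (rule Weierstrass_m_test'[where M = "\<lambda>n. norm p ^ n * (norm x + 1)"])
      fix n y assume "y \<in> cball x 1"
      then have "norm y \<le> norm x + 1"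
        using norm_triangle_ineq2[of y x] by (simp add: dist_norm norm_minus_commute)
      then show "norm (norm (1 - p ^ n * y - 1)) \<le> norm p ^ n * (norm x + 1)"
        by (simp add: norm_mult norm_power mult_left_mono)
    qed (use assms in \<open>simp add: summable_mult2\<close>)
  qed (auto intro!: continuous_intros)
  then have "uniform_limit (cball x 1) (\<lambda>n y. \<Prod>k<n. 1 - p ^ k * y) (qprod p) sequentially"
    unfolding uniformly_convergent_uniform_limit_iff
    by (simp add: qprod_LIMSEQ[OF assms, THEN limI] flip: fun_eq_iff)
  then show "\<exists>d>0. cball x d \<subseteq> UNIV \<and>
      uniform_limit (cball x d) (\<lambda>n y. \<Prod>k<n. 1 - p ^ k * y) (qprod p) sequentially"
    by (intro exI[of _ 1]) auto
qed (auto intro!: holomorphic_intros)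

lemma jtheta_eq_qprod:
  assumes "norm p < 1"
  shows "jtheta p x = qprod p x * qprod p (p / x)"
  unfolding jtheta_def qprod_def
  by (subst prodinf_mult[OF convergent_qprod[OF assms] convergent_qprod[OF assms]]) (simp add: mult_ac)

section \<open>Simple zeros and holomorphic division\<close>

definition simple_zeros_on :: "complex set \<Rightarrow> (complex \<Rightarrow> complex) \<Rightarrow> bool" where
  "simple_zeros_on S h \<longleftrightarrow> (\<forall>z\<in>S. h z = 0 \<longrightarrow> deriv h z \<noteq> 0)"

lemma simple_zeros_on_mult:
  assumes "open S" "f holomorphic_on S" "g holomorphic_on S"
    and "simple_zeros_on S f" "simple_zeros_on S g" "\<And>z. z \<in> S \<Longrightarrow> f z = 0 \<Longrightarrow> g z \<noteq> 0"
  shows "simple_zeros_on S (\<lambda>z. f z * g z)"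
  unfolding simple_zeros_on_def
proof (intro ballI impI)
  fix z assume z: "z \<in> S" "f z * g z = 0"
  have "deriv (\<lambda>z. f z * g z) z = f z * deriv g z + deriv f z * g z"
    using assms(1-3) z(1) by (intro deriv_mult) (auto simp: holomorphic_on_imp_differentiable_at)
  then show "deriv (\<lambda>z. f z * g z) z \<noteq> 0"
    using assms(4-6) z unfolding simple_zeros_on_def by auto
qed

lemma holomorphic_qprod [holomorphic_intros]:
  assumes "norm p < 1" "f holomorphic_on S"
  shows "(\<lambda>x. qprod p (f x)) holomorphic_on S"
  using holomorphic_on_compose_gen[OF assms(2) holomorphic_qprod_UNIV[OF assms(1)]] by (simp add: o_def)

lemma simple_zeros_on_prod:
  assumes "open S" "finite I" "\<And>i. i \<in> I \<Longrightarrow> f i holomorphic_on S"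
    and "\<And>i. i \<in> I \<Longrightarrow> simple_zeros_on S (f i)"
    and "\<And>i j z. i \<in> I \<Longrightarrow> j \<in> I \<Longrightarrow> z \<in> S \<Longrightarrow> f i z = 0 \<Longrightarrow> f j z = 0 \<Longrightarrow> i = j"
  shows "simple_zeros_on S (\<lambda>z. \<Prod>i\<in>I. f i z)"
  using assms(2,3,4,5)
proof (induction I rule: finite_induct)
  case (insert i I)
  have "f j z \<noteq> 0" if "j \<in> I" "z \<in> S" "f i z = 0" for j z
    using insert.prems(3)[of i j z] insert.hyps(2) that by auto
  moreover have "simple_zeros_on S (\<lambda>z. \<Prod>i\<in>I. f i z)"
    using insert.prems by (intro insert.IH) auto
  ultimately have "simple_zeros_on S (\<lambda>z. f i z * (\<Prod>i\<in>I. f i z))"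
    using insert.prems(1,2) insert.hyps(1)
    by (intro simple_zeros_on_mult assms(1)) (auto intro!: holomorphic_intros)
  then show ?case using insert by simp
qed (simp add: simple_zeros_on_def)

text \<open>At a zero of \<open>h\<close> the value of the quotient is given by l'Hopital's rule,
  and simplicity of the zero makes it finite.\<close>

lemma holomorphic_divide_simple_zeros:
  assumes S: "open S" and f: "f holomorphic_on S" and h: "h holomorphic_on S"
    and simp: "simple_zeros_on S h" and zero: "\<And>z. z \<in> S \<Longrightarrow> h z = 0 \<Longrightarrow> f z = 0"
  obtains g where "g holomorphic_on S" "\<And>z. z \<in> S \<Longrightarrow> f z = h z * g z"
proof
  define g where "g = (\<lambda>z. if h z = 0 then deriv f z / deriv h z else f z / h z)"
  show "f z = h z * g z" if "z \<in> S" for z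
    using zero[OF that] by (simp add: g_def)
  have "g field_differentiable at w" if w: "w \<in> S" for w
  proof -
    \<comment> \<open>Difference quotients of holomorphic functions are holomorphic. Near a zero
      \<open>w\<close> of \<open>h\<close> the quotient is \<open>f1 / h1\<close>, and
      \<open>h1 w = deriv h w\<close> is nonzero.\<close>
    define f1 where "f1 = (\<lambda>z. if z = w then deriv f w else (f z - f w) / (z - w))"
    define h1 where "h1 = (\<lambda>z. if z = w then deriv h w else (h z - h w) / (z - w))"
    have f1: "f1 holomorphic_on S" and h1: "h1 holomorphic_on S"
      unfolding f1_def h1_def using f h S by (auto intro: pole_lemma_open)
    show ?thesis
    proof (cases "h w = 0")
      case False
      have "continuous_on S h" using h holomorphic_on_imp_continuous_on by blast
      then have op: "open {z\<in>S. h z \<noteq> 0}"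
        using continuous_open_preimage[OF _ S, of h "- {0}"] by (auto simp: Int_def vimage_def)
      have "(\<lambda>z. f z / h z) holomorphic_on {z\<in>S. h z \<noteq> 0}"
        by (intro holomorphic_intros holomorphic_on_subset[OF f] holomorphic_on_subset[OF h]) auto
      then have "g holomorphic_on {z\<in>S. h z \<noteq> 0}"
        by (rule holomorphic_transform) (auto simp: g_def)
      with op False w show ?thesis by (auto intro: holomorphic_on_imp_differentiable_at)
    next
      case True
      then have d: "deriv h w \<noteq> 0" and fw: "f w = 0" using simp w zero unfolding simple_zeros_on_def by auto
      have cont: "continuous_on S h1" using h1 holomorphic_on_imp_continuous_on by blast
      have op: "open {z\<in>S. h1 z \<noteq> 0}"
        using continuous_open_preimage[OF cont S, of "- {0}"] by (auto simp: Int_def vimage_def)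
      have "(\<lambda>z. f1 z / h1 z) holomorphic_on {z\<in>S. h1 z \<noteq> 0}"
        by (intro holomorphic_intros holomorphic_on_subset[OF f1] holomorphic_on_subset[OF h1]) auto
      then have "g holomorphic_on {z\<in>S. h1 z \<noteq> 0}"
        by (rule holomorphic_transform) (auto simp: g_def f1_def h1_def True fw)
      moreover have "w \<in> {z\<in>S. h1 z \<noteq> 0}" using w d by (simp add: h1_def)
      ultimately show ?thesis using op by (auto intro: holomorphic_on_imp_differentiable_at)
    qed
  qed
  then show "g holomorphic_on S" by (simp add: holomorphic_on_def field_differentiable_at_within)
qed

section \<open>The theta function, its functional equations and its zeros\<close>

locale nome =
  fixes p :: complex
  assumes p_pos: "0 < norm p" and p_less: "norm p < 1"
begin

lemma p_nz [simp]: "p \<noteq> 0" using p_pos by auto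

abbreviation \<theta> :: "complex \<Rightarrow> complex" where "\<theta> \<equiv> jtheta p"

definition pZ :: "complex set" where "pZ = range (\<lambda>k::int. p powi k)"

lemma pZ_powi [simp, intro]: "p powi k \<in> pZ" by (auto simp: pZ_def)

lemma pZ_power [simp, intro]: "p ^ k \<in> pZ" using pZ_powi[of "int k"] by simp

lemma one_pZ [simp, intro]: "1 \<in> pZ" using pZ_powi[of 0] by simp

lemma p_pZ [simp, intro]: "p \<in> pZ" using pZ_powi[of 1] by simp

lemma zero_pZ [simp]: "0 \<notin> pZ" by (auto simp: pZ_def)

lemma pZ_mult: "x \<in> pZ \<Longrightarrow> y \<in> pZ \<Longrightarrow> x * y \<in> pZ"
  unfolding pZ_def by (auto simp flip: power_int_add)

lemma pZ_inverse: "x \<in> pZ \<Longrightarrow> inverse x \<in> pZ"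
  unfolding pZ_def by (auto simp flip: power_int_minus)

lemma pZ_divide: "x \<in> pZ \<Longrightarrow> y \<in> pZ \<Longrightarrow> x / y \<in> pZ"
  by (simp add: divide_inverse pZ_mult pZ_inverse)

lemma pZ_inverse_iff [simp]: "inverse x \<in> pZ \<longleftrightarrow> x \<in> pZ"
  using pZ_inverse[of x] pZ_inverse[of "inverse x"] by auto

lemma pZ_swap: "x / y \<in> pZ \<longleftrightarrow> y / x \<in> pZ"
  using pZ_inverse_iff[of "x / y"] by simp

lemma countable_pZ: "countable pZ" unfolding pZ_def by simp

text \<open>One step of the product recursion, at \<open>x\<close> and at \<open>1 / x\<close>,
  gives both equations; the factor -1/x is the quotient of 1 - 1/x by 1 - x.\<close>

lemma theta_p_mult: "x \<noteq> 0 \<Longrightarrow> \<theta> (p * x) = - \<theta> x / x"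
  and theta_inverse: "x \<noteq> 0 \<Longrightarrow> \<theta> (1 / x) = - \<theta> x / x"
proof -
  assume x: "x \<noteq> 0"
  have 1: "qprod p x = (1 - x) * qprod p (p * x)" and 2: "qprod p (1 / x) = (1 - 1 / x) * qprod p (p / x)"
    using qprod_rec[OF p_less, of x] qprod_rec[OF p_less, of "1 / x"] by simp_all
  have 3: "\<theta> (p * x) = qprod p (p * x) * qprod p (1 / x)" "\<theta> (1 / x) = qprod p (p * x) * qprod p (1 / x)"
    "\<theta> x = qprod p x * qprod p (p / x)"
    using x by (simp_all add: jtheta_eq_qprod[OF p_less])
  show "\<theta> (p * x) = - \<theta> x / x" "\<theta> (1 / x) = - \<theta> x / x"
    using x unfolding 3 1 2 by (simp_all add: field_simps)
qed

lemma theta_eq_0_iff: "x \<noteq> 0 \<Longrightarrow> \<theta> x = 0 \<longleftrightarrow> x \<in> pZ"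
proof -
  assume x: "x \<noteq> 0"
  have "\<theta> x = 0 \<longleftrightarrow> (\<exists>k. p ^ k * x = 1) \<or> (\<exists>k. p ^ k * (p / x) = 1)"
    by (simp add: jtheta_eq_qprod[OF p_less] qprod_eq_0_iff[OF p_less])
  also have "\<dots> \<longleftrightarrow> x \<in> pZ"
  proof
    assume "(\<exists>k. p ^ k * x = 1) \<or> (\<exists>k. p ^ k * (p / x) = 1)"
    then show "x \<in> pZ"
    proof (elim disjE exE)
      fix k assume "p ^ k * x = 1"
      then have "x = inverse (p ^ k)" by (simp add: field_simps)
      then show "x \<in> pZ" by simp
    next
      fix k assume "p ^ k * (p / x) = 1"
      then have "x = p ^ Suc k" using x by (simp add: field_simps)
      then show "x \<in> pZ" by (metis pZ_power)
    qed
  next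
    assume "x \<in> pZ"
    then obtain k where k: "x = p powi k" by (auto simp: pZ_def)
    show "(\<exists>k. p ^ k * x = 1) \<or> (\<exists>k. p ^ k * (p / x) = 1)"
    proof (cases "k \<le> 0")
      case True
      then have "p ^ nat (-k) * x = 1" using k by (cases "k = 0") (simp_all add: power_int_def flip: power_mult_distrib)
      then show ?thesis by blast
    next
      case False
      then obtain n where "k = int (Suc n)" by (metis nonneg_int_cases linorder_not_le less_imp_le of_nat_0_less_iff gr0_conv_Suc)
      then have "p ^ n * (p / x) = 1" using k x by (simp only: power_int_of_nat) simp
      then show ?thesis by blast
    qed
  qed
  finally show ?thesis .
qed

lemma theta_1 [simp]: "\<theta> 1 = 0" by (simp add: theta_eq_0_iff)

lemma holomorphic_theta: "\<theta> holomorphic_on - {0}"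
proof -
  have "(\<lambda>x. qprod p x * qprod p (p / x)) holomorphic_on - {0}"
    by (intro holomorphic_intros p_less) auto
  then show ?thesis by (simp add: jtheta_eq_qprod[OF p_less, abs_def])
qed

lemma holomorphic_theta_comp [holomorphic_intros]:
  "f holomorphic_on S \<Longrightarrow> (\<And>z. z \<in> S \<Longrightarrow> f z \<noteq> 0) \<Longrightarrow> (\<lambda>z. \<theta> (f z)) holomorphic_on S"
  using holomorphic_on_compose_gen[of f S \<theta> "- {0}"] holomorphic_theta by (force simp: o_def)

lemma theta_differentiable: "x \<noteq> 0 \<Longrightarrow> \<theta> field_differentiable at x"
  using holomorphic_theta holomorphic_on_imp_differentiable_at[of \<theta> "- {0}" x] by auto

lemma deriv_theta_p_mult:
  assumes "x \<noteq> 0" "\<theta> x = 0"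
  shows "deriv \<theta> (p * x) = 0 \<longleftrightarrow> deriv \<theta> x = 0"
proof -
  have d: "(\<theta> has_field_derivative deriv \<theta> x) (at x)"
    "(\<theta> has_field_derivative deriv \<theta> (p * x)) (at (p * x))"
    using theta_differentiable assms(1) by (auto simp: DERIV_deriv_iff_field_differentiable)
  have "((\<lambda>x. \<theta> (p * x)) has_field_derivative deriv \<theta> (p * x) * p) (at x)"
    using DERIV_chain2[of \<theta> _ "\<lambda>x. p * x" x, OF d(2)] by (auto intro!: derivative_eq_intros)
  moreover have "((\<lambda>x. - \<theta> x / x) has_field_derivative - deriv \<theta> x / x) (at x)"
    using assms by (auto intro!: derivative_eq_intros d(1))
  then have "((\<lambda>x. \<theta> (p * x)) has_field_derivative - deriv \<theta> x / x) (at x)"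
    by (rule has_field_derivative_transform_within_open[of _ _ _ "- {0}"])
      (use assms in \<open>auto simp: theta_p_mult\<close>)
  ultimately have "deriv \<theta> (p * x) * p = - deriv \<theta> x / x" by (rule DERIV_unique)
  then show ?thesis using assms(1) by (auto simp: field_simps)
qed

text \<open>At 1 the zero comes from the single factor 1 - x, so the derivative there is minus the
  square of \<open>qprod p p\<close>. The equation for theta(p x) carries simplicity to all powers
  of p, in both directions.\<close>

lemma deriv_theta_nz:
  assumes "x \<in> pZ" shows "deriv \<theta> x \<noteq> 0"
proof -
  have "deriv \<theta> (p powi k) \<noteq> 0" for k
  proof (induction k rule: int_induct[where k = 0])
    case base
    have Q: "(\<lambda>x. qprod p (p * x) * qprod p (p / x)) field_differentiable at 1"
      by (intro holomorphic_on_imp_differentiable_at[of _ "- {0}"] holomorphic_intros p_less) auto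
    then obtain D where D: "((\<lambda>x. qprod p (p * x) * qprod p (p / x)) has_field_derivative D) (at 1)"
      unfolding field_differentiable_def by blast
    have "((\<lambda>x::complex. 1 - x) has_field_derivative - 1) (at 1)"
      by (auto intro!: derivative_eq_intros)
    from DERIV_mult[OF this D] have "((\<lambda>x. (1 - x) * (qprod p (p * x) * qprod p (p / x)))
        has_field_derivative - (qprod p p * qprod p p)) (at 1)"
      by simp
    moreover have "\<theta> = (\<lambda>x. (1 - x) * (qprod p (p * x) * qprod p (p / x)))"
      by (subst jtheta_eq_qprod[OF p_less, abs_def], subst qprod_rec[OF p_less]) (simp add: mult_ac)
    ultimately have "(\<theta> has_field_derivative - (qprod p p * qprod p p)) (at 1)" by simp
    then have "deriv \<theta> 1 = - (qprod p p * qprod p p)" by (rule DERIV_imp_deriv)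
    moreover have "p ^ k * p \<noteq> 1" for k
    proof
      assume "p ^ k * p = 1"
      then have "norm p ^ Suc k = 1" by (metis norm_power norm_one power_Suc2)
      then show False using power_Suc_less_one[of "norm p" k] p_pos p_less by simp
    qed
    then have "qprod p p \<noteq> 0" by (simp add: qprod_eq_0_iff[OF p_less])
    ultimately show ?case by simp
  next
    case (step1 i)
    then show ?case using deriv_theta_p_mult[of "p powi i"]
      by (simp add: theta_eq_0_iff power_int_add mult.commute)
  next
    case (step2 i)
    have "p * p powi (i - 1) = p powi i" by (simp add: power_int_diff)
    then show ?case using step2 deriv_theta_p_mult[of "p powi (i - 1)"]
      by (simp add: theta_eq_0_iff del: power_int_diff)
  qed
  then show ?thesis using assms by (auto simp: pZ_def)
qed

lemma simple_zeros_theta_comp: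
  assumes "open S" "f holomorphic_on S" "\<And>z. z \<in> S \<Longrightarrow> f z \<noteq> 0"
    and "\<And>z. z \<in> S \<Longrightarrow> deriv f z \<noteq> 0"
  shows "simple_zeros_on S (\<lambda>z. \<theta> (f z))"
  unfolding simple_zeros_on_def
proof (intro ballI impI)
  fix z assume z: "z \<in> S" "\<theta> (f z) = 0"
  have "deriv (\<theta> \<circ> f) z = deriv \<theta> (f z) * deriv f z"
    using assms z by (intro deriv_chain holomorphic_on_imp_differentiable_at[of f S] theta_differentiable) auto
  then show "deriv (\<lambda>z. \<theta> (f z)) z \<noteq> 0"
    using z assms deriv_theta_nz[of "f z"] by (auto simp: o_def theta_eq_0_iff)
qed

end

section \<open>Theta functions in one variable\<close>

text \<open>A nonempty open subset of the plane is uncountable, so the open set where two continuous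
  functions differ cannot lie inside a countable set.\<close>

lemma eq_off_countable:
  fixes f g :: "complex \<Rightarrow> complex"
  assumes S: "open S" and "continuous_on S f" "continuous_on S g" and "countable C"
    and eq: "\<And>x. x \<in> S \<Longrightarrow> x \<notin> C \<Longrightarrow> f x = g x" and "x \<in> S"
  shows "f x = g x"
proof (rule ccontr)
  assume "f x \<noteq> g x"
  have "continuous_on S (\<lambda>x. f x - g x)" by (intro continuous_intros assms)
  then have "open (S \<inter> (\<lambda>x. f x - g x) -` (- {0}))"
    by (rule continuous_open_preimage[OF _ S]) (simp add: open_Compl)
  moreover have "x \<in> S \<inter> (\<lambda>x. f x - g x) -` (- {0})" using \<open>x \<in> S\<close> \<open>f x \<noteq> g x\<close> by simp
  ultimately obtain r where "r > 0" "ball x r \<subseteq> S \<inter> (\<lambda>x. f x - g x) -` (- {0})"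
    by (meson open_contains_ball)
  then have "uncountable (S \<inter> (\<lambda>x. f x - g x) -` (- {0}))"
    using uncountable_ball[of r x] countable_subset by blast
  moreover have "S \<inter> (\<lambda>x. f x - g x) -` (- {0}) \<subseteq> C" using eq by auto
  ultimately show False using \<open>countable C\<close> countable_subset by blast
qed

section \<open>Orbits under inversion and multiplication by p\<close>

context nome
begin

text \<open>The orbit relation of the group generated by x -> p x and x -> 1/x, which preserves the
  zeros of theta functions. Both arguments are automatically nonzero, since 0 is not in
  \<open>pZ\<close>.\<close>

definition eqv :: "complex \<Rightarrow> complex \<Rightarrow> bool" where
  "eqv x y \<longleftrightarrow> x / y \<in> pZ \<or> x * y \<in> pZ"

lemma eqv_nz: "eqv x y \<Longrightarrow> x \<noteq> 0 \<and> y \<noteq> 0"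
  unfolding eqv_def by auto

lemma eqv_refl: "x \<noteq> 0 \<Longrightarrow> eqv x x" by (simp add: eqv_def)

lemma eqv_sym: "eqv x y \<Longrightarrow> eqv y x"
  unfolding eqv_def using pZ_swap[of x y] by (auto simp: mult.commute)

lemma eqv_trans:
  assumes "eqv x y" "eqv y z" shows "eqv x z"
proof -
  have nz: "x \<noteq> 0" "y \<noteq> 0" "z \<noteq> 0" using assms eqv_nz by auto
  show ?thesis using assms unfolding eqv_def
  proof (elim disjE)
    assume "x / y \<in> pZ" "y / z \<in> pZ"
    from pZ_mult[OF this] show "x / z \<in> pZ \<or> x * z \<in> pZ" using nz by simp
  next
    assume "x / y \<in> pZ" "y * z \<in> pZ"
    from pZ_mult[OF this] show "x / z \<in> pZ \<or> x * z \<in> pZ" using nz by simp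
  next
    assume "x * y \<in> pZ" "y / z \<in> pZ"
    from pZ_divide[OF this] show "x / z \<in> pZ \<or> x * z \<in> pZ" using nz by simp
  next
    assume "x * y \<in> pZ" "y * z \<in> pZ"
    from pZ_divide[OF this] show "x / z \<in> pZ \<or> x * z \<in> pZ" using nz by simp
  qed
qed

definition orbit :: "complex \<Rightarrow> complex set" where "orbit c = {x. eqv x c}"

lemma countable_orbit: "countable (orbit c)"
proof (cases "c = 0")
  case True
  then have "orbit c = {}" using eqv_nz unfolding orbit_def by blast
  then show ?thesis by simp
next
  case False
  have "orbit c \<subseteq> (\<lambda>z. z * c) ` pZ \<union> (\<lambda>z. z / c) ` pZ"
  proof
    fix x assume "x \<in> orbit c"
    moreover have "x = x / c * c" "x = x * c / c" using False by auto
    ultimately show "x \<in> (\<lambda>z. z * c) ` pZ \<union> (\<lambda>z. z / c) ` pZ" unfolding orbit_def eqv_def by blast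
  qed
  then show ?thesis by (rule countable_subset) (simp add: countable_pZ)
qed

text \<open>The points that are not fixed, up to powers of \<open>p\<close>, by inversion: at these the
  zeros of \<open>\<theta>(cx,c/x;p)\<close> are simple.\<close>

definition good :: "complex set" where "good = {x. x \<noteq> 0 \<and> x\<^sup>2 \<notin> pZ}"

lemma good_nz: "x \<in> good \<Longrightarrow> x \<noteq> 0" by (simp add: good_def)

lemma good_eqv:
  assumes "x \<in> good" "eqv x y" shows "y \<in> good"
proof -
  have nz: "x \<noteq> 0" "y \<noteq> 0" using assms eqv_nz by auto
  have "x\<^sup>2 \<in> pZ" if "y\<^sup>2 \<in> pZ"
    using assms(2) unfolding eqv_def
  proof
    assume "x / y \<in> pZ"
    then have "y\<^sup>2 * (x / y * (x / y)) \<in> pZ" using that by (metis pZ_mult)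
    then show ?thesis using nz by (simp add: power2_eq_square)
  next
    assume "x * y \<in> pZ"
    then have "(x * y) * (x * y) / y\<^sup>2 \<in> pZ" using that by (metis pZ_mult pZ_divide)
    then show ?thesis using nz by (simp add: power2_eq_square)
  qed
  then have "y\<^sup>2 \<notin> pZ" using assms(1) by (auto simp: good_def)
  then show ?thesis using nz by (simp add: good_def)
qed

lemma countable_not_good: "countable (- good)"
proof -
  have "- good \<subseteq> insert 0 (\<Union>k::int. {x. x\<^sup>2 = p powi k})" by (auto simp: good_def pZ_def)
  moreover have "countable {x :: complex. x\<^sup>2 = c}" for c
  proof -
    have "{x. x\<^sup>2 = c} \<subseteq> {csqrt c, - csqrt c}"
      by (auto simp: power2_eq_iff[of _ "csqrt c", simplified])
    then show ?thesis by (meson countable_finite finite.emptyI finite.insertI finite_subset)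
  qed
  then have "countable (insert 0 (\<Union>k::int. {x :: complex. x\<^sup>2 = p powi k}))" by (simp add: countable_UN)
  ultimately show ?thesis using countable_subset by blast
qed

section \<open>Theta functions of type BC_1 and degree m\<close>

definition V :: "nat \<Rightarrow> (complex \<Rightarrow> complex) set" where
  "V m = {f. f holomorphic_on - {0} \<and> (\<forall>x. x \<noteq> 0 \<longrightarrow> f (1 / x) = f x) \<and>
      (\<forall>x. x \<noteq> 0 \<longrightarrow> f (p * x) = (p * x\<^sup>2) powi (- int m) * f x)}"

lemma V_cont: "f \<in> V m \<Longrightarrow> continuous_on (- {0}) f"
  by (simp add: V_def holomorphic_on_imp_continuous_on)

lemma V_inverse: "f \<in> V m \<Longrightarrow> x \<noteq> 0 \<Longrightarrow> f (1 / x) = f x" by (simp add: V_def)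

lemma V_p: "f \<in> V m \<Longrightarrow> x \<noteq> 0 \<Longrightarrow> f (p * x) = (p * x\<^sup>2) powi (- int m) * f x" by (simp add: V_def)

lemma zero_mult_pZ:
  assumes "\<And>x. x \<noteq> 0 \<Longrightarrow> f (p * x) = 0 \<longleftrightarrow> f x = (0::complex)" "x \<noteq> 0" "c \<in> pZ"
  shows "f (c * x) = 0 \<longleftrightarrow> f x = 0"
proof -
  have "f (p powi k * x) = 0 \<longleftrightarrow> f x = 0" for k
  proof (induction k rule: int_induct[where k = 0])
    case (step1 i)
    have eq: "p * (p powi i * x) = p powi (i + 1) * x" by (simp add: power_int_add)
    show ?case using step1 assms(1)[of "p powi i * x", unfolded eq] assms(2) by simp
  next
    case (step2 i)
    have eq: "p * (p powi (i - 1) * x) = p powi i * x" by (simp add: power_int_diff)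
    show ?case using step2 assms(1)[of "p powi (i - 1) * x", unfolded eq] assms(2) by simp
  qed simp
  then show ?thesis using assms(3) by (auto simp: pZ_def)
qed

lemma zero_eqv:
  assumes "\<And>x. x \<noteq> 0 \<Longrightarrow> f (p * x) = 0 \<longleftrightarrow> f x = (0::complex)" "\<And>x. x \<noteq> 0 \<Longrightarrow> f (1 / x) = 0 \<longleftrightarrow> f x = 0"
    and "eqv x y"
  shows "f x = 0 \<longleftrightarrow> f y = 0"
proof -
  have nz: "x \<noteq> 0" "y \<noteq> 0" using assms eqv_nz by auto
  show ?thesis using assms(3) unfolding eqv_def
  proof
    assume "x / y \<in> pZ"
    then show ?thesis using zero_mult_pZ[of f y "x / y"] assms(1) nz by simp
  next
    assume "x * y \<in> pZ"
    then show ?thesis using zero_mult_pZ[of f "1 / y" "x * y"] assms(1,2) nz by simp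
  qed
qed

lemma V_zero_eqv: "f \<in> V m \<Longrightarrow> eqv x y \<Longrightarrow> f x = 0 \<longleftrightarrow> f y = 0"
  by (rule zero_eqv) (auto simp: V_inverse V_p)

text \<open>Degree 0 means invariance under x -> p x, so all values are taken on the compact annulus
  |p| <= |x| <= 1. Composed with exp the function is entire and bounded, and Liouville's theorem
  applies.\<close>

lemma V_0_const:
  assumes f: "f \<in> V 0" and "x \<noteq> 0" "y \<noteq> 0"
  shows "f x = f y"
proof -
  have fp: "f (p * x) = f x" if "x \<noteq> 0" for x using V_p[OF f that] by simp
  have fpi: "f (p powi k * x) = f x" if "x \<noteq> 0" for k x
  proof (induction k rule: int_induct[where k = 0])
    case (step1 i)
    have eq: "p * (p powi i * x) = p powi (i + 1) * x" by (simp add: power_int_add)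
    show ?case using step1 fp[of "p powi i * x", unfolded eq] that by simp
  next
    case (step2 i)
    have eq: "p * (p powi (i - 1) * x) = p powi i * x" by (simp add: power_int_diff)
    show ?case using step2 fp[of "p powi (i - 1) * x", unfolded eq] that by simp
  qed simp
  define A :: "complex set" where "A = cball 0 1 - ball 0 (norm p)"
  have "compact A" unfolding A_def by (intro compact_diff compact_cball open_ball)
  moreover have "A \<subseteq> - {0}" using p_pos by (auto simp: A_def)
  ultimately have "compact (f ` A)"
    using V_cont[OF f] by (meson compact_continuous_image continuous_on_subset)
  then obtain B where B: "\<And>x. x \<in> A \<Longrightarrow> norm (f x) \<le> B"
    by (meson bounded_iff compact_imp_bounded imageI)
  have bd: "norm (f x) \<le> B" if x: "x \<noteq> 0" for x
  proof -
    \<comment> \<open>The floor of the logarithm of |x| to base |p| is the exponent of p that must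
      be divided out to bring \<open>x\<close> into the annulus.\<close>
    define L where "L = log (norm p) (norm x)"
    define k where "k = \<lfloor>L\<rfloor>"
    have L: "0 \<le> L - of_int k" "L - of_int k \<le> 1" unfolding k_def by linarith+
    have "norm (p powi (- k) * x) = norm p powr (- of_int k) * norm p powr L"
      using x p_pos p_less powr_real_of_int'[of "norm p" "- k"]
      by (simp add: norm_mult norm_power_int L_def powr_log_cancel)
    also have "\<dots> = norm p powr (L - of_int k)" by (simp flip: powr_add)
    finally have eq: "norm (p powi (- k) * x) = norm p powr (L - of_int k)" .
    have "norm p powr 1 \<le> norm p powr (L - of_int k)" "norm p powr (L - of_int k) \<le> norm p powr 0"
      using powr_mono'[of "L - of_int k" 1 "norm p"] powr_mono'[of 0 "L - of_int k" "norm p"] L p_pos p_less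
      by linarith+
    then have "p powi (- k) * x \<in> A" using p_pos by (simp add: A_def flip: eq)
    then show ?thesis using B[of "p powi (- k) * x"] fpi[OF x, of "- k"] by simp
  qed
  have "(\<lambda>w. f (exp w)) holomorphic_on UNIV"
    using holomorphic_on_compose_gen[of exp UNIV f "- {0}"] f by (force simp: o_def V_def intro: holomorphic_intros)
  moreover have "bounded (range (\<lambda>w. f (exp w)))" using bd by (auto simp: bounded_iff intro!: exI[of _ B])
  ultimately have "(\<lambda>w. f (exp w)) constant_on UNIV" by (rule Liouville_theorem)
  then obtain c where c: "\<And>w. f (exp w) = c" by (auto simp: constant_on_def)
  have "f z = c" if "z \<noteq> 0" for z using c[of "Ln z"] exp_Ln[OF that] by simp
  then show ?thesis using assms by simp
qed

text \<open>For nonzero \<open>c\<close> this is the standard element of degree 1, with the orbit of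
  \<open>c\<close> as its zero set.\<close>

definition thE :: "complex \<Rightarrow> complex \<Rightarrow> complex" where
  "thE c x = \<theta> (c * x) * \<theta> (c / x)"

lemma thE_eq_0_iff: "c \<noteq> 0 \<Longrightarrow> x \<noteq> 0 \<Longrightarrow> thE c x = 0 \<longleftrightarrow> eqv x c"
  using pZ_swap[of c x] by (auto simp: thE_def theta_eq_0_iff eqv_def mult.commute)

lemma thE_inverse: "x \<noteq> 0 \<Longrightarrow> thE c (1 / x) = thE c x" by (simp add: thE_def mult.commute)

lemma theta_div_p:
  assumes "x \<noteq> 0" shows "\<theta> (x / p) = - (x / p) * \<theta> x"
  using theta_p_mult[of "x / p"] assms by (simp add: field_simps)

lemma thE_p: "c \<noteq> 0 \<Longrightarrow> x \<noteq> 0 \<Longrightarrow> thE c (p * x) = thE c x / (p * x\<^sup>2)"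
  using theta_p_mult[of "c * x"] theta_div_p[of "c / x"]
  by (simp add: thE_def power2_eq_square mult_ac) 

lemma holomorphic_thE: "c \<noteq> 0 \<Longrightarrow> thE c holomorphic_on - {0}"
  unfolding thE_def[abs_def] by (intro holomorphic_intros) auto

lemma simple_zeros_thE:
  assumes "c \<in> good" shows "simple_zeros_on (- {0}) (thE c)"
proof -
  have c: "c \<noteq> 0" "c\<^sup>2 \<notin> pZ" using assms by (auto simp: good_def)
  have "((\<lambda>x. c / x) has_field_derivative - c / x\<^sup>2) (at x)" if "x \<noteq> 0" for x
    using that by (auto intro!: derivative_eq_intros simp: power2_eq_square)
  then have "deriv (\<lambda>x. c / x) x = - c / x\<^sup>2" if "x \<noteq> 0" for x using that DERIV_imp_deriv by blast
  moreover have "\<theta> (c * z) \<noteq> 0 \<or> \<theta> (c / z) \<noteq> 0" if "z \<noteq> 0" for z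
  proof (rule ccontr)
    assume "\<not> ?thesis"
    then have "c * z \<in> pZ" "c / z \<in> pZ" using that c by (auto simp: theta_eq_0_iff)
    then have "(c * z) * (c / z) \<in> pZ" by (rule pZ_mult)
    then show False using that c by (simp add: power2_eq_square)
  qed
  ultimately show ?thesis unfolding thE_def[abs_def] using c
    by (intro simple_zeros_on_mult simple_zeros_theta_comp holomorphic_intros) auto
qed

text \<open>The zero at \<open>c\<close> spreads over the orbit of \<open>c\<close>, where
  \<open>thE c\<close> has simple zeros because \<open>c\<close> is good; hence the quotient is
  holomorphic. Its functional equations are checked off the orbit and extended by
  continuity.\<close>

lemma V_divide:
  assumes f: "f \<in> V (Suc m)" and c: "c \<in> good" "f c = 0"
  obtains g where "g \<in> V m" "\<And>x. x \<noteq> 0 \<Longrightarrow> f x = thE c x * g x"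
proof -
  have c0: "c \<noteq> 0" using c by (simp add: good_def)
  have "f z = 0" if "z \<noteq> 0" "thE c z = 0" for z
    using V_zero_eqv[OF f, of z c] that c c0 by (simp add: thE_eq_0_iff)
  then obtain g where g: "g holomorphic_on - {0}" "\<And>x. x \<noteq> 0 \<Longrightarrow> f x = thE c x * g x"
    using holomorphic_divide_simple_zeros[of "- {0}" f "thE c"] holomorphic_thE[OF c0] simple_zeros_thE[OF c(1)] f
    by (auto simp: V_def)
  have cont: "continuous_on (- {0}) g" using g(1) by (rule holomorphic_on_imp_continuous_on)
  have "g (1 / x) = g x" if "x \<noteq> 0" for x
  proof (rule eq_off_countable[where S = "- {0}" and C = "orbit c" and f = "\<lambda>x. g (1 / x)" and g = g])
    show "continuous_on (- {0}) (\<lambda>x. g (1 / x))"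
      by (rule continuous_on_compose2[OF cont]) (auto intro!: continuous_intros)
    fix x assume "x \<in> - {0}" "x \<notin> orbit c"
    then have x: "x \<noteq> 0" "thE c x \<noteq> 0" using c0 by (auto simp: thE_eq_0_iff orbit_def)
    then show "g (1 / x) = g x"
      using g(2)[of x] g(2)[of "1 / x"] V_inverse[OF f x(1)] thE_inverse[OF x(1), of c] by simp
  qed (use that cont countable_orbit in auto)
  moreover have "g (p * x) = (p * x\<^sup>2) powi (- int m) * g x" if "x \<noteq> 0" for x
  proof (rule eq_off_countable[where S = "- {0}" and C = "orbit c"
      and f = "\<lambda>x. g (p * x)" and g = "\<lambda>x. (p * x\<^sup>2) powi (- int m) * g x"])
    show "continuous_on (- {0}) (\<lambda>x. g (p * x))"
      by (rule continuous_on_compose2[OF cont]) (auto intro!: continuous_intros)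
    show "continuous_on (- {0}) (\<lambda>x. (p * x\<^sup>2) powi (- int m) * g x)"
      by (intro continuous_intros cont) auto
    fix x assume "x \<in> - {0}" "x \<notin> orbit c"
    then have x: "x \<noteq> 0" "thE c x \<noteq> 0" using c0 by (auto simp: thE_eq_0_iff orbit_def)
    have "thE c (p * x) * g (p * x) = (p * x\<^sup>2) powi (- int (Suc m)) * (thE c x * g x)"
      using g(2)[of x] g(2)[of "p * x"] V_p[OF f x(1)] x by simp
    moreover have "(p * x\<^sup>2) powi (- int (Suc m)) = (p * x\<^sup>2) powi (- int m) / (p * x\<^sup>2)"
      unfolding power_int_minus power_int_of_nat by (simp add: divide_inverse mult.commute)
    ultimately show "g (p * x) = (p * x\<^sup>2) powi (- int m) * g x"
      unfolding thE_p[OF c0 x(1)] using x by (simp add: field_simps)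
  qed (use that countable_orbit in auto)
  ultimately have "g \<in> V m" using g(1) by (simp add: V_def)
  then show thesis using g(2) that by blast
qed

end

section \<open>Symmetric theta functions at generic points\<close>

text \<open>Partitions are listed in increasing order from index 0, so that the smallest part comes
  first and can be split off by an induction on \<open>n\<close>. Entries from index
  \<open>n\<close> on are unconstrained.\<close>

definition seq :: "nat \<Rightarrow> nat \<Rightarrow> (nat \<Rightarrow> nat) \<Rightarrow> bool" where
  "seq m n \<kappa> \<longleftrightarrow> (\<forall>i j. i \<le> j \<longrightarrow> j < n \<longrightarrow> \<kappa> i \<le> \<kappa> j) \<and> (\<forall>j<n. \<kappa> j \<le> m)"

lemma seqI: "(\<And>i j. i \<le> j \<Longrightarrow> j < n \<Longrightarrow> \<kappa> i \<le> \<kappa> j) \<Longrightarrow> (\<And>j. j < n \<Longrightarrow> \<kappa> j \<le> m) \<Longrightarrow> seq m n \<kappa>"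
  by (simp add: seq_def)

lemma seq_mono: "seq m n \<kappa> \<Longrightarrow> i \<le> j \<Longrightarrow> j < n \<Longrightarrow> \<kappa> i \<le> \<kappa> j" by (simp add: seq_def)

lemma seq_le: "seq m n \<kappa> \<Longrightarrow> j < n \<Longrightarrow> \<kappa> j \<le> m" by (simp add: seq_def)

lemma seq_case_nat: "seq m n \<kappa> \<Longrightarrow> seq m (Suc n) (case_nat 0 \<kappa>)"
  by (auto simp: seq_def split: nat.split)

lemma seq_Suc: "seq m n \<kappa> \<Longrightarrow> seq (Suc m) n (\<lambda>j. Suc (\<kappa> j))"
  by (auto simp: seq_def)

lemma seq_pred: "seq (Suc m) n \<kappa> \<Longrightarrow> seq m n (\<lambda>j. \<kappa> j - 1)"
proof (rule seqI)
  assume s: "seq (Suc m) n \<kappa>"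
  show "\<kappa> i - 1 \<le> \<kappa> j - 1" if "i \<le> j" "j < n" for i j
    using diff_le_mono[OF seq_mono[OF s that]] .
  show "\<kappa> j - 1 \<le> m" if "j < n" for j using seq_le[OF s that] by linarith
qed

lemma seq_tail: "seq m (Suc n) \<kappa> \<Longrightarrow> seq m n (\<lambda>j. \<kappa> (Suc j))"
  by (auto simp: seq_def)

text \<open>A set suffices for the coordinates, since only symmetric functions at points with
  distinct coordinates are evaluated here.\<close>

definition pt :: "(nat \<Rightarrow> nat \<Rightarrow> complex) \<Rightarrow> (nat \<Rightarrow> nat) \<Rightarrow> nat \<Rightarrow> complex set" where
  "pt A \<kappa> n = (\<lambda>j. A (\<kappa> j) j) ` {..<n}"

lemma pt_0 [simp]: "pt A \<kappa> 0 = {}" by (simp add: pt_def)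

lemma finite_pt [simp]: "finite (pt A \<kappa> n)" by (simp add: pt_def)

lemma pt_cong: "(\<And>j. j < n \<Longrightarrow> \<kappa> j = \<kappa>' j) \<Longrightarrow> pt A \<kappa> n = pt A \<kappa>' n" by (simp add: pt_def)

lemma pt_Suc: "pt A \<kappa> (Suc n) = insert (A (\<kappa> 0) 0) (pt (\<lambda>k j. A k (Suc j)) (\<lambda>j. \<kappa> (Suc j)) n)"
  by (auto simp: pt_def lessThan_Suc_eq_insert_0 image_image)

lemma pt_case_nat: "pt A (case_nat k \<kappa>) (Suc n) = insert (A k 0) (pt (\<lambda>k j. A k (Suc j)) \<kappa> n)"
  by (simp add: pt_Suc)

lemma pt_shift: "pt (\<lambda>k j. A (Suc k) j) \<kappa> n = pt A (\<lambda>j. Suc (\<kappa> j)) n"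
  by (simp add: pt_def)

lemma pt_mono: "l \<le> n \<Longrightarrow> pt A \<kappa> l \<subseteq> pt A \<kappa> n" by (auto simp: pt_def)

lemma pt_memI: "j < n \<Longrightarrow> A (\<kappa> j) j \<in> pt A \<kappa> n" by (auto simp: pt_def)

context nome
begin

section \<open>Generic point sets and slices\<close>

definition gen :: "complex set \<Rightarrow> complex set \<Rightarrow> bool" where
  "gen X S \<longleftrightarrow> finite S \<and> S \<subseteq> X \<and> (\<forall>x\<in>S. \<forall>y\<in>S. eqv x y \<longrightarrow> x = y)"

definition orbits :: "complex set \<Rightarrow> complex set" where "orbits P = (\<Union>c\<in>P. orbit c)"

lemma gen_finite: "gen X S \<Longrightarrow> finite S" by (simp add: gen_def)

lemma gen_mono: "gen X S \<Longrightarrow> X \<subseteq> X' \<Longrightarrow> gen X' S" by (auto simp: gen_def)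

lemma gen_subset: "gen X S \<Longrightarrow> S' \<subseteq> S \<Longrightarrow> gen X S'" by (auto simp: gen_def intro: finite_subset)

lemma gen_union:
  assumes "gen X P" "gen (X - orbits P) M" "X \<subseteq> good"
  shows "gen X (P \<union> M)" "P \<inter> M = {}" "card (P \<union> M) = card P + card M"
proof -
  have *: "\<not> eqv x y \<and> \<not> eqv y x" if "x \<in> P" "y \<in> M" for x y
  proof -
    have "y \<notin> orbits P" using assms(2) that(2) by (auto simp: gen_def)
    then have "\<not> eqv y x" using that(1) by (auto simp: orbits_def orbit_def)
    then show ?thesis using eqv_sym by blast
  qed
  show "gen X (P \<union> M)" using assms(1,2) * unfolding gen_def by blast
  show d: "P \<inter> M = {}"
  proof (rule ccontr)
    assume "P \<inter> M \<noteq> {}"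
    then obtain x where x: "x \<in> P" "x \<in> M" by blast
    then have "x \<noteq> 0" using assms(1,3) good_nz by (auto simp: gen_def)
    then show False using *[OF x] eqv_refl by blast
  qed
  show "card (P \<union> M) = card P + card M"
    using assms(1,2) d by (simp add: card_Un_disjoint gen_finite)
qed

lemma gen_diff: "gen X S \<Longrightarrow> P \<subseteq> S \<Longrightarrow> gen (X - orbits P) (S - P)"
  by (fastforce simp: gen_def orbits_def orbit_def)

lemma orbits_single [simp]: "orbits {c} = orbit c" by (simp add: orbits_def)

lemma gen_single: "c \<in> X \<Longrightarrow> gen X {c}" by (simp add: gen_def)

text \<open>The class of functions, on \<open>n\<close>-element sets of pairwise inequivalent points of \<open>X\<close>,
  that are theta functions of degree \<open>m\<close> in each variable. Working on generic points only
  makes this class closed under division by \<open>\<theta>(cx,c/x;p)\<close>, at the price of removing the orbit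
  of \<open>c\<close> from \<open>X\<close>.\<close>

definition T :: "complex set \<Rightarrow> nat \<Rightarrow> nat \<Rightarrow> (complex set \<Rightarrow> complex) \<Rightarrow> bool" where
  "T X m n f \<longleftrightarrow> (\<forall>M. gen X M \<longrightarrow> Suc (card M) = n \<longrightarrow>
     (\<exists>\<phi>\<in>V m. \<forall>z. z \<notin> M \<longrightarrow> gen X (insert z M) \<longrightarrow> f (insert z M) = \<phi> z))"

text \<open>The set \<open>P\<close> holds the coordinates fixed on a slice; with \<open>P\<close>
  empty the condition is identical vanishing on generic sets.\<close>

definition vanish :: "complex set \<Rightarrow> nat \<Rightarrow> complex set \<Rightarrow> (complex set \<Rightarrow> complex) \<Rightarrow> bool" where
  "vanish X n P f \<longleftrightarrow> (\<forall>S. gen X S \<longrightarrow> card S = n \<longrightarrow> P \<subseteq> S \<longrightarrow> f S = 0)"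

lemma vanishD: "vanish X n P f \<Longrightarrow> gen X S \<Longrightarrow> card S = n \<Longrightarrow> P \<subseteq> S \<Longrightarrow> f S = 0"
  by (simp add: vanish_def)

lemma vanish_mono: "vanish X n P f \<Longrightarrow> X' \<subseteq> X \<Longrightarrow> P \<subseteq> P' \<Longrightarrow> vanish X' n P' f"
  unfolding vanish_def using gen_mono[of X' _ X] by blast

lemma vanish_slice:
  assumes "gen X P" "card P \<le> n" "vanish (X - orbits P) (n - card P) {} (\<lambda>M. f (P \<union> M))"
  shows "vanish X n P f"
  unfolding vanish_def
proof (intro allI impI)
  fix S assume S: "gen X S" "card S = n" "P \<subseteq> S"
  have "card (S - P) = n - card P" using S gen_finite[OF assms(1)] by (simp add: card_Diff_subset)
  then have "f (P \<union> (S - P)) = 0" using vanishD[OF assms(3) gen_diff[OF S(1,3)]] by simp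
  then show "f S = 0" using S(3) by (simp add: Un_absorb1)
qed

text \<open>Removing the orbits of \<open>P\<close> from \<open>X\<close> ensures that a generic set
  of the remaining variables stays generic after \<open>P\<close> is added.\<close>

lemma T_slice:
  assumes T: "T X m n f" and P: "gen X P" "card P \<le> n" and X: "X \<subseteq> good"
  shows "T (X - orbits P) m (n - card P) (\<lambda>M. f (P \<union> M))"
  unfolding T_def
proof (intro allI impI)
  fix M assume M: "gen (X - orbits P) M" "Suc (card M) = n - card P"
  note u = gen_union[OF P(1) M(1) X]
  have "Suc (card (P \<union> M)) = n" using u(3) M(2) P(2) by simp
  then obtain \<phi> where \<phi>: "\<phi> \<in> V m" "\<And>z. z \<notin> P \<union> M \<Longrightarrow> gen X (insert z (P \<union> M)) \<Longrightarrow> f (insert z (P \<union> M)) = \<phi> z"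
    using T u(1) unfolding T_def by blast
  have "f (P \<union> insert z M) = \<phi> z" if "z \<notin> M" "gen (X - orbits P) (insert z M)" for z
    using gen_union[OF P(1) that(2) X] \<phi>(2)[of z] that(1) by auto
  then show "\<exists>\<phi>\<in>V m. \<forall>z. z \<notin> M \<longrightarrow> gen (X - orbits P) (insert z M) \<longrightarrow> f (P \<union> insert z M) = \<phi> z"
    using \<phi>(1) by blast
qed

lemma T_slice1:
  assumes "T X m (Suc n) f" "c \<in> X" "X \<subseteq> good"
  shows "T (X - orbit c) m n (\<lambda>M. f (insert c M))"
  using T_slice[OF assms(1) gen_single[OF assms(2)] _ assms(3)] by simp

lemma vanish_slice1:
  assumes "c \<in> X" "vanish (X - orbit c) n {} (\<lambda>M. f (insert c M))"
  shows "vanish X (Suc n) {c} f"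
  using vanish_slice[OF gen_single[OF assms(1)], of "Suc n"] assms(2) by simp

text \<open>Used to move one coordinate \<open>s\<close> to a new place \<open>c\<close> along a
  one-variable theta function. The alternative \<open>c = 0\<close> is there because 0 is equivalent
  to no point, not even to itself, so avoiding orbits does not keep it out of the set.\<close>

lemma T_remove:
  assumes "T X m n f" "gen X S" "card S = n" "s \<in> S"
  obtains \<phi> where "\<phi> \<in> V m" "f S = \<phi> s"
    "\<And>c. c \<in> X \<Longrightarrow> c \<notin> orbits (S - {s}) \<Longrightarrow> gen X (insert c (S - {s})) \<and> card (insert c (S - {s})) = n
        \<and> f (insert c (S - {s})) = \<phi> c \<or> c = 0"
proof -
  define M where "M = S - {s}"
  have M: "gen X M" "Suc (card M) = n" "s \<notin> M" "insert s M = S"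
    using assms gen_subset[OF assms(2), of M] gen_finite[OF assms(2)]
      card_Suc_Diff1[OF gen_finite[OF assms(2)] assms(4)] by (auto simp: M_def)
  obtain \<phi> where \<phi>: "\<phi> \<in> V m" "\<And>z. z \<notin> M \<Longrightarrow> gen X (insert z M) \<Longrightarrow> f (insert z M) = \<phi> z"
    using assms(1) M(1,2) unfolding T_def by blast
  show thesis
  proof (rule that[OF \<phi>(1)])
    show "f S = \<phi> s" using \<phi>(2)[of s] M assms(2) by simp
    fix c assume c: "c \<in> X" "c \<notin> orbits (S - {s})"
    show "gen X (insert c (S - {s})) \<and> card (insert c (S - {s})) = n
        \<and> f (insert c (S - {s})) = \<phi> c \<or> c = 0"
    proof (cases "c = 0")
      case False
      have ne: "\<not> eqv c x \<and> \<not> eqv x c" if "x \<in> M" for x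
      proof -
        have "\<not> eqv c x" using c(2) that by (auto simp: orbits_def orbit_def M_def)
        then show ?thesis using eqv_sym by blast
      qed
      then have "c \<notin> M" using eqv_refl[OF False] by blast
      moreover have "gen X (insert c M)" using M(1) c(1) ne unfolding gen_def by blast
      ultimately show ?thesis using \<phi>(2)[of c] M(2) gen_finite[OF M(1)] unfolding M_def[symmetric] by simp
    qed simp
  qed
qed

text \<open>Puts back the orbit of \<open>c\<close>: a generic set meets it in at most one point,
  and moving that point to \<open>c\<close> does not change whether the function vanishes.\<close>

lemma T_vanish_eqv:
  assumes T: "T X m n f" and van: "vanish X n {c} f" and c: "c \<in> X"
    and rest: "vanish (X - orbit c) n {} f"
  shows "vanish X n {} f"
  unfolding vanish_def
proof (intro allI impI)
  fix S assume S: "gen X S" "card S = n"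
  show "f S = 0"
  proof (cases "S \<inter> orbit c = {}")
    case True
    then have "gen (X - orbit c) S" using S(1) by (auto simp: gen_def)
    then show ?thesis using rest S(2) by (simp add: vanish_def)
  next
    case False
    then obtain s where s: "s \<in> S" "eqv s c" by (auto simp: orbit_def)
    obtain \<phi> where \<phi>: "\<phi> \<in> V m" "f S = \<phi> s"
      "\<And>c. c \<in> X \<Longrightarrow> c \<notin> orbits (S - {s}) \<Longrightarrow> gen X (insert c (S - {s})) \<and> card (insert c (S - {s})) = n
        \<and> f (insert c (S - {s})) = \<phi> c \<or> c = 0"
      using T_remove[OF T S s(1)] by blast
    have "c \<notin> orbits (S - {s})"
    proof
      assume "c \<in> orbits (S - {s})"
      then obtain x where "x \<in> S" "x \<noteq> s" "eqv c x" by (auto simp: orbits_def orbit_def)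
      then show False using S(1) s(1) eqv_trans[OF s(2), of x] unfolding gen_def by blast
    qed
    then have "\<phi> c = 0" using \<phi>(3)[of c] c van eqv_nz[OF s(2)] by (auto simp: vanish_def)
    then show ?thesis using V_zero_eqv[OF \<phi>(1) s(2)] \<phi>(2) by simp
  qed
qed

lemma T_0_vanish:
  assumes T: "T X 0 (Suc n) f" and van: "vanish X (Suc n) {c} f" and c: "c \<in> X" and X: "X \<subseteq> good"
  shows "vanish X (Suc n) {} f"
proof (rule T_vanish_eqv[OF T van c], unfold vanish_def, intro allI impI)
  fix S assume S: "gen (X - orbit c) S" "card S = Suc n"
  then obtain s where s: "s \<in> S" by fastforce
  have S': "gen X S" using S(1) by (rule gen_mono) auto
  obtain \<phi> where \<phi>: "\<phi> \<in> V 0" "f S = \<phi> s"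
    "\<And>c. c \<in> X \<Longrightarrow> c \<notin> orbits (S - {s}) \<Longrightarrow> gen X (insert c (S - {s})) \<and> card (insert c (S - {s})) = Suc n
        \<and> f (insert c (S - {s})) = \<phi> c \<or> c = 0"
    using T_remove[OF T S' S(2) s] by blast
  have nz: "c \<noteq> 0" "s \<noteq> 0" using c s S' X good_nz by (auto simp: gen_def)
  have "c \<notin> orbits (S - {s})"
  proof
    assume "c \<in> orbits (S - {s})"
    then obtain x where "x \<in> S" "eqv c x" by (auto simp: orbits_def orbit_def)
    then show False using S(1) eqv_sym[of c x] by (auto simp: gen_def orbit_def)
  qed
  then have "\<phi> c = 0" using \<phi>(3)[of c] c van nz by (auto simp: vanish_def)
  then show "f S = 0" using V_0_const[OF \<phi>(1) nz] \<phi>(2) by simp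
qed

section \<open>Dividing out the theta factors of a point\<close>

lemma V_scale: "f \<in> V m \<Longrightarrow> (\<lambda>z. f z / k) \<in> V m"
  by (cases "k = 0") (auto simp: V_def intro!: holomorphic_intros)

definition quot :: "complex \<Rightarrow> (complex set \<Rightarrow> complex) \<Rightarrow> complex set \<Rightarrow> complex" where
  "quot c f S = f S / (\<Prod>x\<in>S. thE c x)"

lemma quot_eq_0_iff:
  assumes "gen (X - orbit c) S" "X \<subseteq> good" "c \<in> X"
  shows "quot c f S = 0 \<longleftrightarrow> f S = 0"
proof -
  have "thE c x \<noteq> 0" if "x \<in> S" for x
  proof -
    have "x \<in> X" "\<not> eqv x c" using assms(1) that by (auto simp: gen_def orbit_def)
    moreover have "x \<noteq> 0" "c \<noteq> 0" using assms(2,3) \<open>x \<in> X\<close> good_nz by blast+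
    ultimately show ?thesis using thE_eq_0_iff[of c x] by blast
  qed
  then show ?thesis using gen_finite[OF assms(1)] by (simp add: quot_def)
qed

text \<open>In the moving variable \<open>V_divide\<close> lowers the degree by one; the factors
  belonging to the other variables are a constant on the slice.\<close>

lemma T_quot:
  assumes T: "T X (Suc m) n f" and van: "vanish X n {c} f" and c: "c \<in> X" and X: "X \<subseteq> good"
  shows "T (X - orbit c) m n (quot c f)"
  unfolding T_def
proof (intro allI impI)
  fix M assume M: "gen (X - orbit c) M" "Suc (card M) = n"
  have u: "gen X (insert c M)" "c \<notin> M" "card (insert c M) = n"
    using gen_union[OF gen_single[OF c], of M] M X by auto
  obtain \<phi> where \<phi>: "\<phi> \<in> V (Suc m)" "\<And>z. z \<notin> M \<Longrightarrow> gen X (insert z M) \<Longrightarrow> f (insert z M) = \<phi> z"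
    using T M(2) gen_mono[OF M(1) Diff_subset] unfolding T_def by blast
  have "\<phi> c = 0" using \<phi>(2)[OF u(2,1)] vanishD[OF van u(1,3)] by simp
  moreover have "c \<in> good" using c X by blast
  ultimately obtain \<psi> where \<psi>: "\<psi> \<in> V m" "\<And>x. x \<noteq> 0 \<Longrightarrow> \<phi> x = thE c x * \<psi> x"
    using V_divide[OF \<phi>(1)] by metis
  have "quot c f (insert z M) = \<psi> z / (\<Prod>x\<in>M. thE c x)" if z: "z \<notin> M" "gen (X - orbit c) (insert z M)" for z
  proof -
    have "z \<in> X" "\<not> eqv z c" using z by (auto simp: gen_def orbit_def)
    then have "z \<noteq> 0" "c \<noteq> 0" using c X good_nz by blast+
    with \<open>\<not> eqv z c\<close> have nz: "z \<noteq> 0" "thE c z \<noteq> 0" using thE_eq_0_iff[of c z] by blast+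
    have "f (insert z M) = thE c z * \<psi> z"
      using \<phi>(2)[OF z(1) gen_mono[OF z(2) Diff_subset]] \<psi>(2)[OF nz(1)] by simp
    then show ?thesis using nz z(1) gen_finite[OF M(1)] by (simp add: quot_def)
  qed
  then show "\<exists>\<phi>\<in>V m. \<forall>z. z \<notin> M \<longrightarrow> gen (X - orbit c) (insert z M) \<longrightarrow> quot c f (insert z M) = \<phi> z"
    by (intro bexI[of _ "\<lambda>z. \<psi> z / (\<Prod>x\<in>M. thE c x)"] V_scale[OF \<psi>(1)]) blast
qed

lemma vanish_quot:
  assumes "vanish X n P f" shows "vanish (X - orbit c) n P (quot c f)"
  using vanish_mono[OF assms, of "X - orbit c" P] by (auto simp: vanish_def quot_def)

lemma vanish_quotD:
  assumes T: "T X m n f" and van: "vanish X n {c} f" and c: "c \<in> X" and X: "X \<subseteq> good"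
    and q: "vanish (X - orbit c) n {} (quot c f)"
  shows "vanish X n {} f"
proof (rule T_vanish_eqv[OF T van c])
  show "vanish (X - orbit c) n {} f"
    using q quot_eq_0_iff[OF _ X c] by (simp add: vanish_def)
qed

text \<open>Injectivity is required modulo equivalence, so that every \<open>pt\<close> of the grid
  is a generic set.\<close>

definition grid :: "complex set \<Rightarrow> (nat \<Rightarrow> nat \<Rightarrow> complex) \<Rightarrow> bool" where
  "grid X A \<longleftrightarrow> (\<forall>k j. A k j \<in> X) \<and> (\<forall>k j k' j'. eqv (A k j) (A k' j') \<longrightarrow> k = k' \<and> j = j')"

definition indep :: "(nat \<Rightarrow> nat \<Rightarrow> complex) \<Rightarrow> (nat \<Rightarrow> nat \<Rightarrow> complex) \<Rightarrow> bool" where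
  "indep A B \<longleftrightarrow> (\<forall>k j k' j'. \<not> eqv (A k j) (B k' j'))"

lemma gridD: "grid X A \<Longrightarrow> A k j \<in> X" "grid X A \<Longrightarrow> eqv (A k j) (A k' j') \<Longrightarrow> k = k' \<and> j = j'"
  by (auto simp: grid_def)

lemma grid_inj:
  assumes "grid X A" "X \<subseteq> good" shows "A k j = A k' j' \<longleftrightarrow> k = k' \<and> j = j'"
proof -
  have "A k j \<noteq> 0" using assms good_nz by (auto simp: grid_def)
  then have "A k j = A k' j' \<Longrightarrow> eqv (A k j) (A k' j')" using eqv_refl by simp
  then show ?thesis using gridD(2)[OF assms(1)] by blast
qed

lemma grid_inj_on: "grid X A \<Longrightarrow> X \<subseteq> good \<Longrightarrow> inj_on (\<lambda>j. A (\<kappa> j) j) {..<n}"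
  by (auto simp: inj_on_def grid_inj)

lemma gen_pt: "grid X A \<Longrightarrow> gen X (pt A \<kappa> n)"
  unfolding gen_def pt_def by (auto intro: gridD(1) dest: gridD(2))

lemma card_pt: "grid X A \<Longrightarrow> X \<subseteq> good \<Longrightarrow> card (pt A \<kappa> n) = n"
  unfolding pt_def by (subst card_image) (auto simp: inj_on_def grid_inj)

lemma grid_indep: "grid X A \<Longrightarrow> (\<And>k j. \<not> eqv (A k j) c) \<Longrightarrow> grid (X - orbit c) A"
  by (auto simp: grid_def orbit_def)

lemma grid_shift_j:
  assumes "grid X A" shows "grid (X - orbit (A 0 0)) (\<lambda>k j. A k (Suc j))"
  unfolding grid_def[of "_ - _"] orbit_def
  by (auto intro: gridD(1)[OF assms] dest: gridD(2)[OF assms])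

lemma grid_shift_k:
  assumes "grid X A" shows "grid (X - orbit (A 0 0)) (\<lambda>k j. A (Suc k) j)"
  unfolding grid_def[of "_ - _"] orbit_def
  by (auto intro: gridD(1)[OF assms] dest: gridD(2)[OF assms])

text \<open>Pascal's rule for the test points: sequences starting with 0 lie on the slice at
  \<open>A 0 0\<close>, which vanishes by induction on \<open>n\<close>. After division by the
  factors of \<open>A 0 0\<close>, the sequences with positive entries form the grid with first
  index shifted, for one degree less.\<close>

lemma vanish_grid0:
  "T X m n f \<Longrightarrow> X \<subseteq> good \<Longrightarrow> grid X A \<Longrightarrow> (\<And>\<kappa>. seq m n \<kappa> \<Longrightarrow> f (pt A \<kappa> n) = 0) \<Longrightarrow> vanish X n {} f"
proof (induction n arbitrary: X m f A)
  case 0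
  then show ?case using "0.prems"(4)[of "\<lambda>_. 0"] by (auto simp: vanish_def seq_def gen_def)
next
  case (Suc n)
  show ?case using Suc.prems
  proof (induction m arbitrary: X f A)
    case m: 0
    have c: "A 0 0 \<in> X" using m.prems(3) by (rule gridD)
    have X': "X - orbit (A 0 0) \<subseteq> good" using m.prems(2) by auto
    have "vanish (X - orbit (A 0 0)) n {} (\<lambda>M. f (insert (A 0 0) M))"
      using T_slice1[OF m.prems(1) c m.prems(2)] X' grid_shift_j[OF m.prems(3)]
    proof (rule Suc.IH)
      fix \<kappa> assume "seq 0 n \<kappa>"
      from m.prems(4)[OF seq_case_nat[OF this]]
      show "f (insert (A 0 0) (pt (\<lambda>k j. A k (Suc j)) \<kappa> n)) = 0" by (simp add: pt_case_nat)
    qed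
    then show ?case using T_0_vanish[OF m.prems(1) vanish_slice1[OF c] c m.prems(2)] by blast
  next
    case m: (Suc m)
    have c: "A 0 0 \<in> X" using m.prems(3) by (rule gridD)
    have X': "X - orbit (A 0 0) \<subseteq> good" using m.prems(2) by auto
    have "vanish (X - orbit (A 0 0)) n {} (\<lambda>M. f (insert (A 0 0) M))"
      using T_slice1[OF m.prems(1) c m.prems(2)] X' grid_shift_j[OF m.prems(3)]
    proof (rule Suc.IH)
      fix \<kappa> assume "seq (Suc m) n \<kappa>"
      from m.prems(4)[OF seq_case_nat[OF this]]
      show "f (insert (A 0 0) (pt (\<lambda>k j. A k (Suc j)) \<kappa> n)) = 0" by (simp add: pt_case_nat)
    qed
    then have van: "vanish X (Suc n) {A 0 0} f" by (rule vanish_slice1[OF c])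
    have "vanish (X - orbit (A 0 0)) (Suc n) {} (quot (A 0 0) f)"
      using T_quot[OF m.prems(1) van c m.prems(2)] X' grid_shift_k[OF m.prems(3)]
    proof (rule m.IH)
      fix \<kappa> assume "seq m (Suc n) \<kappa>"
      then show "quot (A 0 0) f (pt (\<lambda>k j. A (Suc k) j) \<kappa> (Suc n)) = 0"
        unfolding pt_shift quot_def using m.prems(4)[OF seq_Suc] by simp
    qed
    then show ?case by (rule vanish_quotD[OF m.prems(1) van c m.prems(2)])
  qed
qed

text \<open>Each point of \<open>Z\<close> is a zero in every variable and costs one degree, so only
  sequences bounded by the remaining degree have to be tested.\<close>

lemma vanish_grid:
  assumes "finite Z" "T X m n f" "X \<subseteq> good" "grid X A" "gen X Z" "card Z \<le> m"
    and "\<And>c k j. c \<in> Z \<Longrightarrow> \<not> eqv (A k j) c" "\<And>c. c \<in> Z \<Longrightarrow> vanish X n {c} f"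
    and "\<And>\<kappa>. seq (m - card Z) n \<kappa> \<Longrightarrow> f (pt A \<kappa> n) = 0"
  shows "vanish X n {} f"
  using assms
proof (induction Z arbitrary: X m f rule: finite_induct)
  case empty
  then show ?case using vanish_grid0[of X m n f A] by simp
next
  case (insert c Z)
  obtain m' where m: "m = Suc m'" using insert.prems(5) insert.hyps by (cases m) auto
  have c: "c \<in> X" using insert.prems(4) by (simp add: gen_def)
  have van: "vanish X n {c} f" using insert.prems(7) by blast
  have Z: "gen (X - orbit c) Z" using gen_diff[OF insert.prems(4), of "{c}"] insert.hyps by simp
  have "vanish (X - orbit c) n {} (quot c f)"
  proof (rule insert.IH)
    show "T (X - orbit c) m' n (quot c f)" using T_quot insert.prems(1,2) van c m by blast
    show "grid (X - orbit c) A" using grid_indep insert.prems(3,6) by blast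
    show "card Z \<le> m'" using insert.prems(5) insert.hyps m by simp
    show "vanish (X - orbit c) n {d} (quot c f)" if "d \<in> Z" for d
      using vanish_quot insert.prems(7) that by blast
    show "quot c f (pt A \<kappa> n) = 0" if "seq (m' - card Z) n \<kappa>" for \<kappa>
      using insert.prems(8)[of \<kappa>] that insert.hyps m by (simp add: quot_def)
  qed (use insert.prems Z in auto)
  then show ?case by (rule vanish_quotD[OF insert.prems(1) van c insert.prems(2)])
qed

end

section \<open>Vanishing on points and on slices\<close>

text \<open>The complementary partition, again in increasing order: if \<open>\<alpha> j\<close> is
  the part with index n - j, entry \<open>j\<close> is m minus the part with index j + 1.\<close>

definition compl :: "nat \<Rightarrow> nat \<Rightarrow> (nat \<Rightarrow> nat) \<Rightarrow> nat \<Rightarrow> nat" where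
  "compl m n \<alpha> j = m - \<alpha> (n - 1 - j)"

lemma compl_le: "compl m n \<alpha> j \<le> m" by (simp add: compl_def)

context nome
begin

text \<open>The condition on \<open>\<kappa>\<close> is failure of containment: one entry that is
  too small is enough.\<close>

definition vanish_below :: "nat \<Rightarrow> nat \<Rightarrow> (nat \<Rightarrow> nat) \<Rightarrow> (nat \<Rightarrow> nat \<Rightarrow> complex) \<Rightarrow> (complex set \<Rightarrow> complex) \<Rightarrow> bool" where
  "vanish_below m n \<beta> B f \<longleftrightarrow>
     (\<forall>\<kappa>. seq m n \<kappa> \<longrightarrow> (\<exists>j<n. \<kappa> j < \<beta> j) \<longrightarrow> f (pt B \<kappa> n) = 0)"

text \<open>Lowering the part \<open>\<kappa>\<^sub>j\<close> to \<open>k\<close> amounts, by symmetry, to specializing a free variable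
  to \<open>B k j\<close>; this accounts for \<open>\<kappa>\<^sub>l\<close> zeros in the free variables, and the remaining degree
  \<open>m - \<kappa>\<^sub>l\<close> is small enough for the points with parts \<open>\<ge> \<kappa>\<^sub>l\<close> to determine the function.\<close>

lemma vanish_slice_below:
  assumes T: "T X m n f" and X: "X \<subseteq> good" and B: "grid X B" and \<beta>: "\<And>j. j < n \<Longrightarrow> \<beta> j \<le> m"
    and Y: "gen X Y" "card Y \<le> 1" "\<And>c k j. c \<in> Y \<Longrightarrow> \<not> eqv (B k j) c"
    and vanY: "\<And>c \<kappa> l. c \<in> Y \<Longrightarrow> l < n \<Longrightarrow> seq m (Suc l) \<kappa> \<Longrightarrow> \<kappa> l < \<beta> l \<Longrightarrow>
      vanish X n (insert c (pt B \<kappa> (Suc l))) f"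
    and below: "vanish_below (m - card Y) n \<beta> B f"
    and l: "l < n"
  shows "seq m (Suc l) \<kappa> \<Longrightarrow> \<kappa> l < \<beta> l \<Longrightarrow> vanish X n (pt B \<kappa> (Suc l)) f"
proof (induction "\<Sum>i\<le>l. \<kappa> i" arbitrary: \<kappa> rule: less_induct)
  case less
  define P where "P = pt B \<kappa> (Suc l)"
  define X1 where "X1 = X - orbits P"
  \<comment> \<open>\<open>J k\<close> is the first place whose entry exceeds \<open>k\<close>.
    Lowering that entry to \<open>k\<close> keeps the sequence increasing, as all earlier entries
    are at most \<open>k\<close>.\<close>
  define J where "J = (\<lambda>k. LEAST j. k < \<kappa> j)"
  define W where "W = (\<lambda>k. B k (J k)) ` {..<\<kappa> l}"
  \<comment> \<open>\<open>Y\<close> may hold one further zero of the free variables, known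
    beforehand. Each element of \<open>Y\<close> lowers by one the bound on the sequences that
    \<open>below\<close> has to cover.\<close>
  define Z where "Z = Y \<union> W"
  define h where "h = (\<lambda>M. f (P \<union> M))"
  have J: "J k \<le> l" "k < \<kappa> (J k)" "\<And>i. i < J k \<Longrightarrow> \<kappa> i \<le> k" if "k < \<kappa> l" for k
  proof -
    show "J k \<le> l" unfolding J_def using that by (rule Least_le)
    show "k < \<kappa> (J k)" unfolding J_def using that by (rule LeastI)
    show "\<kappa> i \<le> k" if "i < J k" for i
      using not_less_Least[OF that[unfolded J_def]] by simp
  qed
  have P: "gen X P" "card P = Suc l" unfolding P_def using gen_pt[OF B] card_pt[OF B X] by auto
  have cP: "card P \<le> n" "n - card P = n - Suc l" using P l by auto
  have X1: "X1 \<subseteq> good" "X1 \<subseteq> X" using X by (auto simp: X1_def)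
  have inP: "x \<in> X1 \<longleftrightarrow> x \<in> X \<and> (\<forall>i\<le>l. \<not> eqv x (B (\<kappa> i) i))" for x
    by (auto simp: X1_def orbits_def orbit_def P_def pt_def less_Suc_eq_le)
  have "W \<subseteq> X1"
  proof
    fix x assume "x \<in> W"
    then obtain k where k: "k < \<kappa> l" "x = B k (J k)" by (auto simp: W_def)
    have "\<not> eqv x (B (\<kappa> i) i)" for i
    proof
      assume "eqv x (B (\<kappa> i) i)"
      then have "k = \<kappa> i \<and> J k = i" unfolding k(2) by (rule gridD(2)[OF B])
      then show False using J(2)[OF k(1)] by auto
    qed
    then show "x \<in> X1" using gridD(1)[OF B] by (simp add: inP k(2))
  qed
  moreover have "Y \<subseteq> X1"
  proof
    fix c assume c: "c \<in> Y"
    have "\<not> eqv c (B (\<kappa> i) i)" for i using Y(3)[OF c] eqv_sym by blast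
    then show "c \<in> X1" using c Y(1) by (auto simp: inP gen_def)
  qed
  moreover have YW: "\<not> eqv c x \<and> \<not> eqv x c" if "c \<in> Y" "x \<in> W" for c x
  proof -
    have "\<not> eqv x c" using Y(3)[OF that(1)] that(2) by (auto simp: W_def)
    then show ?thesis using eqv_sym by blast
  qed
  moreover have "x = y" if "x \<in> W" "y \<in> W" "eqv x y" for x y
    using that by (auto simp: W_def dest!: gridD(2)[OF B])
  ultimately have Z: "gen X1 Z"
    using Y(1) unfolding gen_def Z_def by (auto simp: W_def)
  have "card W = \<kappa> l"
    unfolding W_def by (subst card_image) (auto simp: inj_on_def grid_inj[OF B X])
  moreover have "Y \<inter> W = {}"
  proof (rule ccontr)
    assume "Y \<inter> W \<noteq> {}"
    then obtain c where c: "c \<in> Y" "c \<in> W" by blast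
    then have "c \<noteq> 0" using \<open>Y \<subseteq> X1\<close> X1 good_nz by blast
    then show False using YW[OF c] eqv_refl by blast
  qed
  ultimately have card_Z: "card Z = card Y + \<kappa> l"
    using Y(1) unfolding Z_def by (subst card_Un_disjoint) (auto simp: gen_def W_def)
  have Zm: "card Z \<le> m" using card_Z Y(2) less.prems(2) \<beta>[OF l] by simp
  have "vanish X1 (n - Suc l) {} h"
  proof (rule vanish_grid[where Z = Z and A = "\<lambda>k j. B (k + \<kappa> l) (j + Suc l)"])
    show "T X1 m (n - Suc l) h"
      using T_slice[OF T P(1) cP(1) X] by (simp only: h_def X1_def cP(2))
    show "grid X1 (\<lambda>k j. B (k + \<kappa> l) (j + Suc l))"
      unfolding grid_def inP by (auto intro: gridD(1)[OF B] dest!: gridD(2)[OF B])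
    show "\<not> eqv (B (k + \<kappa> l) (j + Suc l)) c" if cZ: "c \<in> Z" for c k j
    proof
      assume e: "eqv (B (k + \<kappa> l) (j + Suc l)) c"
      then have "c \<notin> Y" using Y(3) by blast
      then obtain k' where k': "k' < \<kappa> l" "c = B k' (J k')" using cZ by (auto simp: Z_def W_def)
      then show False using gridD(2)[OF B e[unfolded k'(2)]] by simp
    qed
    show "vanish X1 (n - Suc l) {c} h" if cZ: "c \<in> Z" for c
    proof -
      have "vanish X n (insert c P) f"
      proof (cases "c \<in> Y")
        case True
        then show ?thesis using vanY[OF _ l less.prems] by (simp add: P_def)
      next
        case False
        then obtain k where k: "k < \<kappa> l" "c = B k (J k)" using cZ by (auto simp: Z_def W_def)
        \<comment> \<open>\<open>P\<close> together with \<open>c\<close> contains the point of this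
          lowered sequence, whose slice vanishes by induction on the sum of the entries.\<close>
        define \<kappa>' where "\<kappa>' = \<kappa>(J k := k)"
        have "seq m (Suc l) \<kappa>'"
        proof (rule seqI)
          fix i j assume ij: "i \<le> j" "j < Suc l"
          have *: "\<kappa> i \<le> \<kappa> j" by (rule seq_mono[OF less.prems(1) ij])
          show "\<kappa>' i \<le> \<kappa>' j"
            using * J[OF k(1)] ij unfolding \<kappa>'_def by (cases "i = j") (auto simp: le_less)
        next
          fix j assume "j < Suc l"
          then show "\<kappa>' j \<le> m"
            using seq_le[OF less.prems(1), of j] seq_le[OF less.prems(1), of l] k(1) by (auto simp: \<kappa>'_def)
        qed
        moreover have "(\<Sum>i\<le>l. \<kappa>' i) < (\<Sum>i\<le>l. \<kappa> i)"
        proof (rule sum_strict_mono_ex1)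
          show "\<forall>i\<in>{..l}. \<kappa>' i \<le> \<kappa> i" using J(2)[OF k(1)] by (auto simp: \<kappa>'_def)
          show "\<exists>i\<in>{..l}. \<kappa>' i < \<kappa> i" using J(1,2)[OF k(1)] by (auto simp: \<kappa>'_def intro!: bexI[of _ "J k"])
        qed simp
        moreover have "\<kappa>' l < \<beta> l" using less.prems(2) k(1) by (auto simp: \<kappa>'_def)
        ultimately have "vanish X n (pt B \<kappa>' (Suc l)) f" using less.hyps by blast
        moreover have "pt B \<kappa>' (Suc l) \<subseteq> insert c P"
          unfolding P_def pt_def by (auto simp: \<kappa>'_def k(2))
        ultimately show ?thesis using vanish_mono by blast
      qed
      then show ?thesis
        unfolding vanish_def[of X1] h_def
      proof (intro allI impI)
        fix M assume van: "vanish X n (insert c P) f" and M: "gen X1 M" "card M = n - Suc l" "{c} \<subseteq> M"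
        show "f (P \<union> M) = 0"
          using gen_union[OF P(1) M(1)[unfolded X1_def] X] M(2,3) P(2) l by (intro vanishD[OF van]) auto
      qed
    qed
    show "h (pt (\<lambda>k j. B (k + \<kappa> l) (j + Suc l)) \<rho> (n - Suc l)) = 0"
      if \<rho>: "seq (m - card Z) (n - Suc l) \<rho>" for \<rho>
    proof -
      \<comment> \<open>The fixed entries, followed by the tested ones raised by
        \<open>\<kappa> l\<close>, form one increasing sequence. It is bounded by m - card Y because
        the degree left after dividing out \<open>Z\<close> is m - card Y -
        \<open>\<kappa> l\<close>, and its entry at \<open>l\<close> is still too small.\<close>
      define \<sigma> where "\<sigma> = (\<lambda>i. if i \<le> l then \<kappa> i else \<rho> (i - Suc l) + \<kappa> l)"
      have "P \<union> pt (\<lambda>k j. B (k + \<kappa> l) (j + Suc l)) \<rho> (n - Suc l) = pt B \<sigma> n"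
      proof -
        have 1: "{..<n} = {..<Suc l} \<union> (\<lambda>j. j + Suc l) ` {..<n - Suc l}"
        proof (intro equalityI subsetI)
          fix x assume "x \<in> {..<n}"
          then show "x \<in> {..<Suc l} \<union> (\<lambda>j. j + Suc l) ` {..<n - Suc l}"
            by (cases "x < Suc l") (auto intro!: image_eqI[of _ _ "x - Suc l"])
        qed (use l in auto)
        show ?thesis unfolding P_def pt_def 1 image_Un image_image by (auto simp: \<sigma>_def)
      qed
      moreover have "seq (m - card Y) n \<sigma>"
      proof (rule seqI)
        have kl: "\<kappa> l \<le> m - card Y" using Zm card_Z by simp
        have k: "\<kappa> i \<le> \<kappa> l" if "i \<le> l" for i using seq_mono[OF less.prems(1) that] by simp
        have r: "\<rho> i \<le> m - card Z" if "i < n - Suc l" for i using seq_le[OF \<rho> that] .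
        show "\<sigma> j \<le> m - card Y" if "j < n" for j
        proof (cases "j \<le> l")
          case True
          then show ?thesis using k[of j] kl by (simp add: \<sigma>_def)
        next
          case False
          then have "j - Suc l < n - Suc l" using that by linarith
          from r[OF this] show ?thesis using False Zm card_Z by (simp add: \<sigma>_def)
        qed
        show "\<sigma> i \<le> \<sigma> j" if "i \<le> j" "j < n" for i j
          using that seq_mono[OF less.prems(1), of i j] seq_mono[OF \<rho>, of "i - Suc l" "j - Suc l"] k[of i]
          by (cases "j \<le> l"; cases "i \<le> l") (auto simp: \<sigma>_def)
      qed
      moreover have "\<sigma> l < \<beta> l" using less.prems(2) by (simp add: \<sigma>_def)
      ultimately show ?thesis using below l unfolding vanish_below_def h_def by auto
    qed
  qed (use Z X1 Zm gen_finite[OF Z] in auto)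
  then show ?case
    using vanish_slice[OF P(1) cP(1), of f] unfolding h_def X1_def P_def[symmetric] by (simp only: cP(2))
qed

lemma vanish_slice_below0:
  assumes "T X m n f" "X \<subseteq> good" "grid X B" "\<And>j. j < n \<Longrightarrow> \<beta> j \<le> m"
    and "vanish_below m n \<beta> B f" "l < n" "seq m (Suc l) \<kappa>" "\<kappa> l < \<beta> l"
  shows "vanish X n (pt B \<kappa> (Suc l)) f"
  using assms by (intro vanish_slice_below[where Y = "{}" and m = m and \<beta> = \<beta>]) (auto simp: gen_def)

text \<open>Entries equal to m are traded for the initial points \<open>B 0 0\<close>,
  \<open>B 0 1\<close>, ... of the second grid. The points with r < n lie on the slice at
  \<open>B 0 0\<close>; after its factors are divided out, the points with r = n are the full test
  grid for degree m - 1.\<close>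

lemma vanish_mixed:
  assumes "T X m n f" "X \<subseteq> good" "grid X A" "grid X B" "indep A B"
    and "\<And>r \<kappa>. r \<le> n \<Longrightarrow> seq m r \<kappa> \<Longrightarrow> (\<forall>j<r. \<kappa> j < m) \<Longrightarrow> f (pt A \<kappa> r \<union> pt B (\<lambda>_. 0) (n - r)) = 0"
  shows "vanish X n {} f"
  using assms
proof (induction n arbitrary: X f B)
  case 0
  then show ?case using "0.prems"(6)[of 0 "\<lambda>_. 0"] by (auto simp: vanish_def seq_def gen_def)
next
  case (Suc n)
  note B = Suc.prems(4)
  show ?case
  proof (cases m)
    case 0
    show ?thesis
    proof (rule vanish_grid0[OF Suc.prems(1,2) B])
      fix \<kappa> assume "seq m (Suc n) \<kappa>"
      then have "pt B \<kappa> (Suc n) = pt B (\<lambda>_. 0) (Suc n)" by (intro pt_cong) (auto simp: seq_def 0)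
      then show "f (pt B \<kappa> (Suc n)) = 0" using Suc.prems(6)[of 0 \<kappa>] by (simp add: seq_def)
    qed
  next
    case (Suc m')
    have c: "B 0 0 \<in> X" using B by (rule gridD)
    have ind: "\<not> eqv (A k j) (B k' j')" for k j k' j' using Suc.prems(5) by (simp add: indep_def)
    have "vanish (X - orbit (B 0 0)) n {} (\<lambda>M. f (insert (B 0 0) M))"
      using T_slice1[OF Suc.prems(1) c Suc.prems(2)]
    proof (rule Suc.IH[where B = "\<lambda>k j. B k (Suc j)"])
      show "indep A (\<lambda>k j. B k (Suc j))" using ind by (simp add: indep_def)
      fix r \<kappa> assume r: "r \<le> n" "seq m r \<kappa>" "\<forall>j<r. \<kappa> j < m"
      then have "f (pt A \<kappa> r \<union> pt B (\<lambda>_. 0) (Suc n - r)) = 0" by (intro Suc.prems(6)) auto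
      moreover have "pt B (\<lambda>_. 0) (Suc n - r) = insert (B 0 0) (pt (\<lambda>k j. B k (Suc j)) (\<lambda>_. 0) (n - r))"
        using r(1) by (simp add: Suc_diff_le pt_Suc)
      ultimately show "f (insert (B 0 0) (pt A \<kappa> r \<union> pt (\<lambda>k j. B k (Suc j)) (\<lambda>_. 0) (n - r))) = 0"
        by simp
    qed (use Suc.prems(2) grid_shift_j[OF B] grid_indep[OF Suc.prems(3)] ind in auto)
    then have van: "vanish X (Suc n) {B 0 0} f" by (rule vanish_slice1[OF c])
    show ?thesis
    proof (rule vanish_grid[OF _ Suc.prems(1,2,3) gen_single[OF c]])
      fix \<kappa> assume \<kappa>: "seq (m - card {B 0 0}) (Suc n) \<kappa>"
      have "\<kappa> j < m" if "j < Suc n" for j using seq_le[OF \<kappa> that] Suc by simp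
      moreover have "seq m (Suc n) \<kappa>" using \<kappa> by (auto simp: seq_def intro: order_trans)
      ultimately show "f (pt A \<kappa> (Suc n)) = 0" using Suc.prems(6)[of "Suc n" \<kappa>] by simp
    qed (use van ind Suc in auto)
  qed
qed

end

context nome
begin

section \<open>Consequences of the defining conditions, and unisolvence\<close>

definition vanish_lex :: "nat \<Rightarrow> nat \<Rightarrow> (nat \<Rightarrow> nat) \<Rightarrow> (nat \<Rightarrow> nat \<Rightarrow> complex) \<Rightarrow> (complex set \<Rightarrow> complex) \<Rightarrow> bool" where
  "vanish_lex m n \<alpha> A f \<longleftrightarrow>
     (\<forall>\<kappa> i. seq m n \<kappa> \<longrightarrow> i < n \<longrightarrow> (\<forall>j<i. \<kappa> j = \<alpha> j) \<longrightarrow> \<kappa> i < \<alpha> i \<longrightarrow> f (pt A \<kappa> n) = 0)"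

text \<open>The vanishing conditions defining the interpolation function, with the partition listed in
  increasing order: \<open>\<alpha>\<^sub>j = \<lambda>\<^sub>n\<^sub>-\<^sub>j\<close> for \<open>0 \<le> j < n\<close>, and \<open>i\<close> the first place where \<open>\<kappa>\<close> and \<open>\<alpha>\<close> differ.
  In the paper's notation \<open>i = n - l\<^sub>0\<close> and \<open>r = n - l\<^sub>1\<close>.\<close>

definition interp_zeros :: "nat \<Rightarrow> nat \<Rightarrow> (nat \<Rightarrow> nat) \<Rightarrow> (nat \<Rightarrow> nat \<Rightarrow> complex) \<Rightarrow> (nat \<Rightarrow> nat \<Rightarrow> complex)
    \<Rightarrow> (complex set \<Rightarrow> complex) \<Rightarrow> bool" where
  "interp_zeros m n \<alpha> A B f \<longleftrightarrow>
     (\<forall>\<kappa> i. seq m n \<kappa> \<longrightarrow> i < n \<longrightarrow> (\<forall>j<i. \<kappa> j = \<alpha> j) \<longrightarrow>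
        (\<kappa> i < \<alpha> i \<longrightarrow> (\<forall>r\<le>n. (\<forall>j<n. \<kappa> j = m \<longleftrightarrow> r \<le> j) \<longrightarrow>
            f (pt A \<kappa> r \<union> pt B (\<lambda>_. 0) (n - r)) = 0)) \<and>
        (\<alpha> i < \<kappa> i \<longrightarrow> f (pt A \<kappa> i \<union> pt B (compl m n \<kappa>) (n - i)) = 0))"

lemma vanish_lexD:
  "vanish_lex m n \<alpha> A f \<Longrightarrow> seq m n \<kappa> \<Longrightarrow> i < n \<Longrightarrow> (\<And>j. j < i \<Longrightarrow> \<kappa> j = \<alpha> j) \<Longrightarrow> \<kappa> i < \<alpha> i \<Longrightarrow> f (pt A \<kappa> n) = 0"
  by (simp add: vanish_lex_def)

lemma vanish_belowD:
  "vanish_below m n \<beta> B f \<Longrightarrow> seq m n \<kappa> \<Longrightarrow> j < n \<Longrightarrow> \<kappa> j < \<beta> j \<Longrightarrow> f (pt B \<kappa> n) = 0"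
  by (auto simp: vanish_below_def)

lemma interp_zeros_ltD:
  "interp_zeros m n \<alpha> A B f \<Longrightarrow> seq m n \<kappa> \<Longrightarrow> i < n \<Longrightarrow> (\<And>j. j < i \<Longrightarrow> \<kappa> j = \<alpha> j) \<Longrightarrow> \<kappa> i < \<alpha> i \<Longrightarrow>
   r \<le> n \<Longrightarrow> (\<And>j. j < n \<Longrightarrow> \<kappa> j = m \<longleftrightarrow> r \<le> j) \<Longrightarrow> f (pt A \<kappa> r \<union> pt B (\<lambda>_. 0) (n - r)) = 0"
  unfolding interp_zeros_def by blast

lemma interp_zeros_gtD:
  "interp_zeros m n \<alpha> A B f \<Longrightarrow> seq m n \<kappa> \<Longrightarrow> i < n \<Longrightarrow> (\<And>j. j < i \<Longrightarrow> \<kappa> j = \<alpha> j) \<Longrightarrow> \<alpha> i < \<kappa> i \<Longrightarrow>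
   f (pt A \<kappa> i \<union> pt B (compl m n \<kappa>) (n - i)) = 0"
  unfolding interp_zeros_def by blast

lemma seq_compl: "seq m n \<kappa> \<Longrightarrow> seq m n (compl m n \<kappa>)"
  by (rule seqI) (auto simp: compl_def intro!: diff_le_mono2 elim!: seq_mono)

lemma pt_case_nat_mixed:
  "insert (A 0 0) (pt (\<lambda>k j. A k (Suc j)) \<kappa> r \<union> S) = pt A (case_nat 0 \<kappa>) (Suc r) \<union> S"
  by (simp add: pt_case_nat)

lemma vanish_lex_slice:
  assumes "vanish_lex m (Suc n) \<alpha> A f" "\<alpha> 0 = 0"
  shows "vanish_lex m n (\<lambda>j. \<alpha> (Suc j)) (\<lambda>k j. A k (Suc j)) (\<lambda>M. f (insert (A 0 0) M))"
  unfolding vanish_lex_def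
proof (intro allI impI)
  fix \<kappa> i assume \<kappa>: "seq m n \<kappa>" "i < n" "\<forall>j<i. \<kappa> j = \<alpha> (Suc j)" "\<kappa> i < \<alpha> (Suc i)"
  have "f (pt A (case_nat 0 \<kappa>) (Suc n)) = 0"
    by (rule vanish_lexD[OF assms(1) seq_case_nat[OF \<kappa>(1)], of "Suc i"])
      (use \<kappa> assms(2) in \<open>auto split: nat.split\<close>)
  then show "f (insert (A 0 0) (pt (\<lambda>k j. A k (Suc j)) \<kappa> n)) = 0" by (simp add: pt_case_nat)
qed

lemma vanish_lex_first:
  assumes "vanish_lex m (Suc n) \<alpha> A f" "0 < \<alpha> 0" "seq m n \<kappa>"
  shows "f (insert (A 0 0) (pt (\<lambda>k j. A k (Suc j)) \<kappa> n)) = 0"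
  using vanish_lexD[OF assms(1) seq_case_nat[OF assms(3)], of 0] assms(2) by (simp add: pt_case_nat)

lemma vanish_lex_quot:
  assumes "vanish_lex (Suc m) n \<alpha> A f" "seq (Suc m) n \<alpha>" "0 < \<alpha> 0"
  shows "vanish_lex m n (\<lambda>j. \<alpha> j - 1) (\<lambda>k j. A (Suc k) j) (quot c f)"
  unfolding vanish_lex_def
proof (intro allI impI)
  fix \<kappa> i assume \<kappa>: "seq m n \<kappa>" "i < n" "\<forall>j<i. \<kappa> j = \<alpha> j - 1" "\<kappa> i < \<alpha> i - 1"
  have "0 < \<alpha> j" if "j < n" for j using seq_mono[OF assms(2), of 0 j] that assms(3) by simp
  then have "f (pt A (\<lambda>j. Suc (\<kappa> j)) n) = 0"
    by (intro vanish_lexD[OF assms(1) seq_Suc[OF \<kappa>(1)], of i]) (use \<kappa> in \<open>auto simp: Suc_pred'[symmetric]\<close>)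
  then show "quot c f (pt (\<lambda>k j. A (Suc k) j) \<kappa> n) = 0" by (simp add: pt_shift quot_def)
qed

lemma compl_tail: "j < n \<Longrightarrow> compl m n (\<lambda>j. \<alpha> (Suc j)) j = compl m (Suc n) \<alpha> j"
  by (simp add: compl_def Suc_diff_Suc)

lemma compl_pred: "(\<And>j. j < n \<Longrightarrow> 0 < \<alpha> j) \<Longrightarrow> j < n \<Longrightarrow> compl m n (\<lambda>j. \<alpha> j - 1) j = compl (Suc m) n \<alpha> j"
proof -
  assume pos: "\<And>j. j < n \<Longrightarrow> 0 < \<alpha> j" and j: "j < n"
  have "0 < \<alpha> (n - 1 - j)" using j by (intro pos) simp
  then show ?thesis by (simp add: compl_def)
qed

text \<open>The smallest part of \<alpha> decides the move. If it is 0, the function is restricted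
  to the slice at \<open>A 0 0\<close>. Otherwise the conditions with first entry 0 make that slice
  vanish, and one column of the rectangle is divided out. Both moves preserve the relevant entries
  of the complement, so the b-grid stays fixed throughout.\<close>

theorem interp_zeros_imp:
  assumes "T X m n f" "X \<subseteq> good" "grid X A" "grid X B" "indep A B" "seq m n \<alpha>"
    and "interp_zeros m n \<alpha> A B f"
  shows "vanish_below m n (compl m n \<alpha>) B f \<and> vanish_lex m n \<alpha> A f"
  using assms
proof (induction n arbitrary: X m f A \<alpha>)
  case 0
  then show ?case by (simp add: vanish_below_def vanish_lex_def)
next
  case (Suc n)
  show ?case using Suc.prems
  proof (induction m arbitrary: X f A \<alpha>)
    case m: 0
    then show ?case by (auto simp: vanish_below_def vanish_lex_def compl_def seq_def)
  next
    case m: (Suc m)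
    note T = m.prems(1) and X = m.prems(2) and A = m.prems(3) and B = m.prems(4)
      and \<alpha> = m.prems(6) and H = m.prems(7)
    define c where "c = A 0 0"
    have c: "c \<in> X" using A unfolding c_def by (rule gridD)
    have X': "X - orbit c \<subseteq> good" using X by auto
    have ind: "\<not> eqv (A k j) (B k' j')" for k j k' j' using m.prems(5) by (simp add: indep_def)
    have ind': "\<not> eqv (B k j) c" for k j using ind[of 0 0 k j] eqv_sym unfolding c_def by blast
    have B': "grid (X - orbit c) B" using grid_indep[OF B ind'] .
    show ?case
    proof (cases "\<alpha> 0 = 0")
      case False
      have \<alpha>0: "0 < \<alpha> j" if "j < Suc n" for j using seq_mono[OF \<alpha>, of 0 j] that False by simp
      have "vanish (X - orbit c) n {} (\<lambda>M. f (insert c M))"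
        using T_slice1[OF T c X] X'
      proof (rule vanish_mixed[where A = "\<lambda>k j. A k (Suc j)" and B = B])
        show "grid (X - orbit c) (\<lambda>k j. A k (Suc j))" unfolding c_def by (rule grid_shift_j[OF A])
        show "indep (\<lambda>k j. A k (Suc j)) B" using ind by (simp add: indep_def)
        fix r \<kappa> assume r: "r \<le> n" "seq (Suc m) r \<kappa>" "\<forall>j<r. \<kappa> j < Suc m"
        \<comment> \<open>From place r + 1 on the entries are full, so the defining condition puts
          exactly the last n - r coordinates on the b-grid.\<close>
        define \<sigma> where "\<sigma> = case_nat 0 (\<lambda>j. if j < r then \<kappa> j else Suc m)"
        have "f (pt A \<sigma> (Suc r) \<union> pt B (\<lambda>_. 0) (Suc n - Suc r)) = 0"
        proof (rule interp_zeros_ltD[OF H, of _ 0])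
          have "seq (Suc m) n (\<lambda>j. if j < r then \<kappa> j else Suc m)"
            using r by (auto simp: seq_def less_imp_le)
          then show "seq (Suc m) (Suc n) \<sigma>" unfolding \<sigma>_def by (rule seq_case_nat)
        qed (use False r in \<open>auto simp: \<sigma>_def split: nat.split\<close>)
        moreover have "pt A \<sigma> (Suc r) = insert c (pt (\<lambda>k j. A k (Suc j)) \<kappa> r)"
          unfolding \<sigma>_def pt_case_nat c_def by (simp add: pt_def)
        ultimately show "f (insert c (pt (\<lambda>k j. A k (Suc j)) \<kappa> r \<union> pt B (\<lambda>_. 0) (n - r))) = 0"
          by simp
      qed (use B' in auto)
      then have van: "vanish X (Suc n) {c} f" by (rule vanish_slice1[OF c])
      let ?A = "\<lambda>k j. A (Suc k) j" and ?g = "quot c f" and ?\<alpha> = "\<lambda>j. \<alpha> j - 1"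
      have A': "grid (X - orbit c) ?A" unfolding c_def by (rule grid_shift_k[OF A])
      have Tg: "T (X - orbit c) m (Suc n) ?g" by (rule T_quot[OF T van c X])
      have "interp_zeros m (Suc n) ?\<alpha> ?A B ?g"
        unfolding interp_zeros_def
      proof (intro allI impI conjI)
        fix \<kappa> i r assume \<kappa>: "seq m (Suc n) \<kappa>" "i < Suc n" "\<forall>j<i. \<kappa> j = \<alpha> j - 1"
          and lt: "\<kappa> i < \<alpha> i - 1" and r: "r \<le> Suc n" "\<forall>j<Suc n. \<kappa> j = m \<longleftrightarrow> r \<le> j"
        have "f (pt A (\<lambda>j. Suc (\<kappa> j)) r \<union> pt B (\<lambda>_. 0) (Suc n - r)) = 0"
          by (rule interp_zeros_ltD[OF H seq_Suc[OF \<kappa>(1)], of i]) (use \<kappa> lt r \<alpha>0 in auto)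
        then show "?g (pt ?A \<kappa> r \<union> pt B (\<lambda>_. 0) (Suc n - r)) = 0" by (simp add: pt_shift quot_def)
      next
        fix \<kappa> i assume \<kappa>: "seq m (Suc n) \<kappa>" "i < Suc n" "\<forall>j<i. \<kappa> j = \<alpha> j - 1" and gt: "\<alpha> i - 1 < \<kappa> i"
        have "f (pt A (\<lambda>j. Suc (\<kappa> j)) i \<union> pt B (compl (Suc m) (Suc n) (\<lambda>j. Suc (\<kappa> j))) (Suc n - i)) = 0"
          by (rule interp_zeros_gtD[OF H seq_Suc[OF \<kappa>(1)], of i]) (use \<kappa> gt \<alpha>0 in auto)
        then show "?g (pt ?A \<kappa> i \<union> pt B (compl m (Suc n) \<kappa>) (Suc n - i)) = 0"
          by (simp add: pt_shift quot_def compl_def[abs_def])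
      qed
      then have IH: "vanish_below m (Suc n) (compl m (Suc n) ?\<alpha>) B ?g \<and> vanish_lex m (Suc n) ?\<alpha> ?A ?g"
        using ind by (intro m.IH[OF Tg X' A' B' _ seq_pred[OF \<alpha>]]) (auto simp: indep_def)
      have "vanish_below (Suc m) (Suc n) (compl (Suc m) (Suc n) \<alpha>) B f"
        unfolding vanish_below_def
      proof (intro allI impI, elim exE conjE)
        fix \<kappa> j assume \<kappa>: "seq (Suc m) (Suc n) \<kappa>" "j < Suc n" "\<kappa> j < compl (Suc m) (Suc n) \<alpha> j"
        have eq: "compl m (Suc n) ?\<alpha> j = compl (Suc m) (Suc n) \<alpha> j" using \<alpha>0 \<kappa>(2) by (rule compl_pred)
        have le: "\<kappa> j \<le> m" using \<kappa>(3) compl_le[of m "Suc n" ?\<alpha> j] eq by simp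
        \<comment> \<open>After place \<open>j\<close> the sequence may reach Suc m, out of range
          for the quotient. Its first j + 1 entries are at most m, so the slice through these is
          used.\<close>
        have "vanish (X - orbit c) (Suc n) (pt B \<kappa> (Suc j)) ?g"
        proof (rule vanish_slice_below0[OF Tg X' B' compl_le conjunct1[OF IH] \<kappa>(2)])
          show "seq m (Suc j) \<kappa>"
            using le \<kappa>(1,2) by (auto simp: seq_def less_Suc_eq_le) (meson le_trans order_refl)
          show "\<kappa> j < compl m (Suc n) ?\<alpha> j" using eq \<kappa>(3) by simp
        qed
        then have "?g (pt B \<kappa> (Suc n)) = 0"
          by (rule vanishD[OF _ gen_pt[OF B'] card_pt[OF B' X'] pt_mono]) (use \<kappa>(2) in simp)
        then show "f (pt B \<kappa> (Suc n)) = 0" using quot_eq_0_iff[OF gen_pt[OF B'] X c] by simp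
      qed
      moreover have "vanish_lex (Suc m) (Suc n) \<alpha> A f"
        unfolding vanish_lex_def
      proof (intro allI impI)
        fix \<kappa> i assume \<kappa>: "seq (Suc m) (Suc n) \<kappa>" "i < Suc n" "\<forall>j<i. \<kappa> j = \<alpha> j" "\<kappa> i < \<alpha> i"
        show "f (pt A \<kappa> (Suc n)) = 0"
        proof (cases "\<kappa> 0 = 0")
          case True
          then have "{c} \<subseteq> pt A \<kappa> (Suc n)" by (simp add: pt_Suc c_def)
          then show ?thesis by (rule vanishD[OF van gen_pt[OF A] card_pt[OF A X]])
        next
          case False
          then have \<kappa>0: "0 < \<kappa> j" if "j < Suc n" for j using seq_mono[OF \<kappa>(1), of 0 j] that by simp
          have "?g (pt ?A (\<lambda>j. \<kappa> j - 1) (Suc n)) = 0"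
            by (rule vanish_lexD[OF conjunct2[OF IH] seq_pred[OF \<kappa>(1)], of i])
              (use \<kappa> \<kappa>0[OF \<kappa>(2)] in auto)
          moreover have "pt ?A (\<lambda>j. \<kappa> j - 1) (Suc n) = pt A \<kappa> (Suc n)"
            unfolding pt_shift by (rule pt_cong) (use \<kappa>0 in auto)
          ultimately show ?thesis using quot_eq_0_iff[OF gen_pt[OF A'] X c] by metis
        qed
      qed
      ultimately show ?thesis by simp
    next
      case True
      let ?A = "\<lambda>k j. A k (Suc j)" and ?f = "\<lambda>M. f (insert c M)" and ?\<alpha> = "\<lambda>j. \<alpha> (Suc j)"
      have A': "grid (X - orbit c) ?A" unfolding c_def by (rule grid_shift_j[OF A])
      have Tf: "T (X - orbit c) (Suc m) n ?f" by (rule T_slice1[OF T c X])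
      have "interp_zeros (Suc m) n ?\<alpha> ?A B ?f"
        unfolding interp_zeros_def c_def pt_case_nat_mixed
      proof (intro allI impI conjI)
        fix \<kappa> i r assume \<kappa>: "seq (Suc m) n \<kappa>" "i < n" "\<forall>j<i. \<kappa> j = \<alpha> (Suc j)"
          and lt: "\<kappa> i < \<alpha> (Suc i)" and r: "r \<le> n" "\<forall>j<n. \<kappa> j = Suc m \<longleftrightarrow> r \<le> j"
        have "f (pt A (case_nat 0 \<kappa>) (Suc r) \<union> pt B (\<lambda>_. 0) (Suc n - Suc r)) = 0"
          by (rule interp_zeros_ltD[OF H seq_case_nat[OF \<kappa>(1)], of "Suc i"])
            (use \<kappa> lt r True in \<open>auto split: nat.split\<close>)
        then show "f (pt A (case_nat 0 \<kappa>) (Suc r) \<union> pt B (\<lambda>_. 0) (n - r)) = 0" by simp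
      next
        fix \<kappa> i assume \<kappa>: "seq (Suc m) n \<kappa>" "i < n" "\<forall>j<i. \<kappa> j = \<alpha> (Suc j)" and gt: "\<alpha> (Suc i) < \<kappa> i"
        have "f (pt A (case_nat 0 \<kappa>) (Suc i) \<union> pt B (compl (Suc m) (Suc n) (case_nat 0 \<kappa>)) (Suc n - Suc i)) = 0"
          by (rule interp_zeros_gtD[OF H seq_case_nat[OF \<kappa>(1)], of "Suc i"])
            (use \<kappa> gt True in \<open>auto split: nat.split\<close>)
        moreover have "pt B (compl (Suc m) (Suc n) (case_nat 0 \<kappa>)) (n - i) = pt B (compl (Suc m) n \<kappa>) (n - i)"
          by (rule pt_cong) (simp add: compl_tail[of _ n _ "case_nat 0 \<kappa>", symmetric])
        ultimately show "f (pt A (case_nat 0 \<kappa>) (Suc i) \<union> pt B (compl (Suc m) n \<kappa>) (n - i)) = 0" by simp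
      qed
      then have IH: "vanish_below (Suc m) n (compl (Suc m) n ?\<alpha>) B ?f" "vanish_lex (Suc m) n ?\<alpha> ?A ?f"
        using Suc.IH[OF Tf X' A' B' _ seq_tail[OF \<alpha>]] ind by (auto simp: indep_def)
      have "vanish_lex (Suc m) (Suc n) \<alpha> A f"
        unfolding vanish_lex_def
      proof (intro allI impI)
        fix \<kappa> i assume \<kappa>: "seq (Suc m) (Suc n) \<kappa>" "i < Suc n" "\<forall>j<i. \<kappa> j = \<alpha> j" "\<kappa> i < \<alpha> i"
        obtain i' where i': "i = Suc i'" using \<kappa>(4) True by (cases i) auto
        have "?f (pt ?A (\<lambda>j. \<kappa> (Suc j)) n) = 0"
          by (rule vanish_lexD[OF IH(2) seq_tail[OF \<kappa>(1)], of i']) (use \<kappa> i' in auto)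
        moreover have "\<kappa> 0 = 0" using \<kappa>(3) i' True by auto
        ultimately show "f (pt A \<kappa> (Suc n)) = 0" by (simp add: pt_Suc c_def)
      qed
      moreover have "vanish_below (Suc m) (Suc n) (compl (Suc m) (Suc n) \<alpha>) B f"
        unfolding vanish_below_def
      proof (intro allI impI, elim exE conjE)
        fix \<kappa> j assume \<kappa>: "seq (Suc m) (Suc n) \<kappa>" "j < Suc n" "\<kappa> j < compl (Suc m) (Suc n) \<alpha> j"
        \<comment> \<open>Here \<open>Y = {c}\<close>: sets through \<open>c\<close> are covered by
          the induction on \<open>n\<close>, and the zero at \<open>c\<close> reduces the remaining
          test to sequences bounded by m.\<close>
        have "vanish X (Suc n) (pt B \<kappa> (Suc j)) f"
        proof (rule vanish_slice_below[where l = j and \<kappa> = \<kappa> and \<beta> = "compl (Suc m) (Suc n) \<alpha>",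
              OF T X B compl_le gen_single[OF c] _ _ _ _ \<kappa>(2) _ \<kappa>(3)])
          show "seq (Suc m) (Suc j) \<kappa>" using \<kappa>(1,2) by (auto simp: seq_def)
          show "\<not> eqv (B k j) d" if "d \<in> {c}" for d k j using that ind' by simp
          show "vanish X (Suc n) (insert d (pt B \<sigma> (Suc l))) f"
            if d: "d \<in> {c}" and l: "l < Suc n" and \<sigma>: "seq (Suc m) (Suc l) \<sigma>" "\<sigma> l < compl (Suc m) (Suc n) \<alpha> l"
            for d \<sigma> l
            unfolding vanish_def
          proof (intro allI impI)
            fix S assume S: "gen X S" "card S = Suc n" "insert d (pt B \<sigma> (Suc l)) \<subseteq> S"
            have cS: "c \<in> S" and pS: "pt B \<sigma> (Suc l) \<subseteq> S - {c}"
            proof -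
              have "c \<notin> pt B \<sigma> (Suc l)" using ind'[of "\<sigma> _"] eqv_refl c X good_nz unfolding pt_def by blast
              then show "c \<in> S" "pt B \<sigma> (Suc l) \<subseteq> S - {c}" using S(3) d by auto
            qed
            have cd: "card (S - {c}) = n" using cS S(2) gen_finite[OF S(1)] by simp
            then have "Suc l \<le> n" using card_mono[OF _ pS] card_pt[OF B X, of \<sigma> "Suc l"] gen_finite[OF S(1)] by simp
            then have ln: "l < n" by simp
            have "vanish (X - orbit c) n (pt B \<sigma> (Suc l)) ?f"
              using vanish_slice_below0[OF Tf X' B' compl_le IH(1) ln \<sigma>(1)] \<sigma>(2) compl_tail[OF ln] by metis
            from vanishD[OF this _ cd pS] gen_diff[OF S(1), of "{c}"] cS
            show "f S = 0" by (simp add: insert_absorb)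
          qed
          show "vanish_below (Suc m - card {c}) (Suc n) (compl (Suc m) (Suc n) \<alpha>) B f"
            unfolding vanish_below_def
          proof (intro allI impI)
            fix \<sigma> assume \<sigma>: "seq (Suc m - card {c}) (Suc n) \<sigma>"
            then have \<sigma>': "seq (Suc m) (Suc n) \<sigma>" and \<sigma>m: "\<And>j. j < Suc n \<Longrightarrow> \<sigma> j \<le> m" by (auto simp: seq_def le_SucI)
            \<comment> \<open>The complement of a sequence bounded by m has positive entries, so it
              exceeds \<alpha> already at place 0, and the condition there has all coordinates on
              the b-grid.\<close>
            have "f (pt A (compl (Suc m) (Suc n) \<sigma>) 0 \<union>
                pt B (compl (Suc m) (Suc n) (compl (Suc m) (Suc n) \<sigma>)) (Suc n - 0)) = 0"
              by (rule interp_zeros_gtD[OF H seq_compl[OF \<sigma>']]) (use True \<sigma>m[of n] in \<open>auto simp: compl_def\<close>)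
            moreover have "pt B (compl (Suc m) (Suc n) (compl (Suc m) (Suc n) \<sigma>)) (Suc n) = pt B \<sigma> (Suc n)"
            proof (rule pt_cong)
              fix j assume "j < Suc n"
              then show "compl (Suc m) (Suc n) (compl (Suc m) (Suc n) \<sigma>) j = \<sigma> j"
                using \<sigma>m[of j] by (simp add: compl_def)
            qed
            ultimately show "f (pt B \<sigma> (Suc n)) = 0" by simp
          qed
        qed simp
        then show "f (pt B \<kappa> (Suc n)) = 0"
          by (rule vanishD[OF _ gen_pt[OF B] card_pt[OF B X] pt_mono]) (use \<kappa>(2) in simp)
      qed
      ultimately show ?thesis by simp
    qed
  qed
qed

text \<open>If the smallest part of \<alpha> is positive, every sequence starting with 0 is
  lexicographically smaller, so the slice at \<open>A 0 0\<close> vanishes on a full grid and a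
  column can be divided out. If it is 0, the slice vanishes by induction, and the lowered degree is
  tested entirely on the b-grid.\<close>

theorem unisolvence:
  assumes "T X m n f" "X \<subseteq> good" "grid X A" "grid X B" "indep A B" "seq m n \<alpha>"
    and "vanish_below m n (compl m n \<alpha>) B f" "vanish_lex m n \<alpha> A f" "f (pt A \<alpha> n) = 0"
  shows "vanish X n {} f"
  using assms
proof (induction n arbitrary: X m f A \<alpha>)
  case 0
  then show ?case by (auto simp: vanish_def gen_def)
next
  case (Suc n)
  show ?case using Suc.prems
  proof (induction m arbitrary: X f A \<alpha>)
    case m: 0
    show ?case
    proof (rule vanish_grid0[OF m.prems(1,2,3)])
      fix \<kappa> assume "seq 0 (Suc n) \<kappa>"
      then have "pt A \<kappa> (Suc n) = pt A \<alpha> (Suc n)" using m.prems(6) by (intro pt_cong) (auto simp: seq_def)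
      then show "f (pt A \<kappa> (Suc n)) = 0" using m.prems(9) by simp
    qed
  next
    case m: (Suc m)
    note T = m.prems(1) and X = m.prems(2) and A = m.prems(3) and B = m.prems(4)
      and \<alpha> = m.prems(6) and below = m.prems(7) and lex = m.prems(8) and at = m.prems(9)
    define c where "c = A 0 0"
    have c: "c \<in> X" using A unfolding c_def by (rule gridD)
    have X': "X - orbit c \<subseteq> good" using X by auto
    have ind: "\<not> eqv (A k j) (B k' j')" for k j k' j' using m.prems(5) by (simp add: indep_def)
    have ind': "\<not> eqv (B k j) c" for k j using ind[of 0 0 k j] eqv_sym unfolding c_def by blast
    have B': "grid (X - orbit c) B" using grid_indep[OF B ind'] .
    have Tf: "T (X - orbit c) (Suc m) n (\<lambda>M. f (insert c M))" by (rule T_slice1[OF T c X])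
    have A1: "grid (X - orbit c) (\<lambda>k j. A k (Suc j))" unfolding c_def by (rule grid_shift_j[OF A])
    show ?case
    proof (cases "\<alpha> 0 = 0")
      case False
      have \<alpha>0: "0 < \<alpha> j" if "j < Suc n" for j using seq_mono[OF \<alpha>, of 0 j] that False by simp
      have "vanish (X - orbit c) n {} (\<lambda>M. f (insert c M))"
        using vanish_lex_first[OF lex] False unfolding c_def
        by (intro vanish_grid0[OF Tf X' A1, unfolded c_def]) simp
      then have van: "vanish X (Suc n) {c} f" by (rule vanish_slice1[OF c])
      let ?A = "\<lambda>k j. A (Suc k) j" and ?g = "quot c f" and ?\<alpha> = "\<lambda>j. \<alpha> j - 1"
      have A': "grid (X - orbit c) ?A" unfolding c_def by (rule grid_shift_k[OF A])
      have Tg: "T (X - orbit c) m (Suc n) ?g" by (rule T_quot[OF T van c X])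
      have "vanish (X - orbit c) (Suc n) {} ?g"
      proof (rule m.IH[OF Tg X' A' B' _ seq_pred[OF \<alpha>]])
        show "indep ?A B" using ind by (simp add: indep_def)
        show "vanish_lex m (Suc n) ?\<alpha> ?A ?g" using False by (intro vanish_lex_quot[OF lex \<alpha>]) simp
        show "vanish_below m (Suc n) (compl m (Suc n) ?\<alpha>) B ?g"
          unfolding vanish_below_def
        proof (intro allI impI, elim exE conjE)
          fix \<kappa> j assume \<kappa>: "seq m (Suc n) \<kappa>" "j < Suc n" "\<kappa> j < compl m (Suc n) ?\<alpha> j"
          have "seq (Suc m) (Suc n) \<kappa>" using \<kappa>(1) by (auto simp: seq_def le_SucI)
          moreover have "compl m (Suc n) ?\<alpha> j = compl (Suc m) (Suc n) \<alpha> j" using \<alpha>0 \<kappa>(2) by (rule compl_pred)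
          ultimately have "f (pt B \<kappa> (Suc n)) = 0" using \<kappa>(2,3) by (intro vanish_belowD[OF below]) auto
          then show "?g (pt B \<kappa> (Suc n)) = 0" by (simp add: quot_def)
        qed
        have "pt ?A ?\<alpha> (Suc n) = pt A \<alpha> (Suc n)"
          unfolding pt_shift by (rule pt_cong) (use \<alpha>0 in auto)
        then show "?g (pt ?A ?\<alpha> (Suc n)) = 0" using at by (simp add: quot_def)
      qed
      then show ?thesis by (rule vanish_quotD[OF T van c X])
    next
      case True
      let ?A = "\<lambda>k j. A k (Suc j)" and ?\<alpha> = "\<lambda>j. \<alpha> (Suc j)"
      have "vanish (X - orbit c) n {} (\<lambda>M. f (insert c M))"
      proof (rule Suc.IH[OF Tf X' A1 B' _ seq_tail[OF \<alpha>]])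
        show "indep ?A B" using ind by (simp add: indep_def)
        show "vanish_lex (Suc m) n ?\<alpha> ?A (\<lambda>M. f (insert c M))"
          unfolding c_def by (rule vanish_lex_slice[OF lex True])
        show "f (insert c (pt ?A ?\<alpha> n)) = 0" using at True by (simp add: pt_Suc c_def)
        show "vanish_below (Suc m) n (compl (Suc m) n ?\<alpha>) B (\<lambda>M. f (insert c M))"
          unfolding vanish_below_def
        proof (intro allI impI, elim exE conjE)
          fix \<kappa> j assume \<kappa>: "seq (Suc m) n \<kappa>" "j < n" "\<kappa> j < compl (Suc m) n ?\<alpha> j"
          have van: "vanish X (Suc n) (pt B \<kappa> (Suc j)) f"
            using \<kappa> compl_tail[OF \<kappa>(2), of "Suc m" \<alpha>]
            by (intro vanish_slice_below0[OF T X B compl_le below]) (auto simp: seq_def)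
          note u = gen_union[OF gen_single[OF c], of "pt B \<kappa> n"]
          show "f (insert c (pt B \<kappa> n)) = 0"
            by (rule vanishD[OF van]) (use u X gen_pt[OF B'] card_pt[OF B X, of \<kappa> n] pt_mono[of "Suc j" n B \<kappa>] \<kappa>(2) in auto)
        qed
      qed
      then have van: "vanish X (Suc n) {c} f" by (rule vanish_slice1[OF c])
      show ?thesis
      proof (rule vanish_grid[OF _ T X B gen_single[OF c]])
        fix \<kappa> assume \<kappa>: "seq (Suc m - card {c}) (Suc n) \<kappa>"
        then have "seq (Suc m) (Suc n) \<kappa>" by (auto simp: seq_def le_SucI)
        \<comment> \<open>Since \<open>\<alpha> 0 = 0\<close>, the last entry of the complement is
          Suc m, larger than every tested entry.\<close>
        moreover have "\<kappa> n < compl (Suc m) (Suc n) \<alpha> n" using seq_le[OF \<kappa>, of n] True by (simp add: compl_def)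
        ultimately show "f (pt B \<kappa> (Suc n)) = 0" by (intro vanish_belowD[OF below, of \<kappa> n]) auto
      qed (use van ind' in auto)
    qed
  qed
qed

end

section \<open>The difference operator\<close>

abbreviation qt_grid :: "complex \<Rightarrow> complex \<Rightarrow> complex \<Rightarrow> nat \<Rightarrow> nat \<Rightarrow> complex" where
  "qt_grid c q t \<equiv> \<lambda>k j. c * q ^ k * t ^ j"

definition pairs :: "complex set \<Rightarrow> complex set set" where
  "pairs Y = {e. e \<subseteq> Y \<and> card e = 2}"

lemma finite_pairs: "finite Y \<Longrightarrow> finite (pairs Y)" by (simp add: pairs_def)

lemma pairs_insert:
  assumes "w \<notin> Y" "finite Y"
  shows "pairs (insert w Y) = pairs Y \<union> (\<lambda>y. {w, y}) ` Y" "pairs Y \<inter> (\<lambda>y. {w, y}) ` Y = {}"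
proof -
  show "pairs (insert w Y) = pairs Y \<union> (\<lambda>y. {w, y}) ` Y"
  proof (intro equalityI subsetI)
    fix e assume e: "e \<in> pairs (insert w Y)"
    show "e \<in> pairs Y \<union> (\<lambda>y. {w, y}) ` Y"
    proof (cases "w \<in> e")
      case True
      have "card (e - {w}) = 1" using e True by (auto simp: pairs_def)
      then obtain y where y: "e - {w} = {y}" by (auto simp: card_1_singleton_iff)
      then have "e = {w, y}" "y \<in> Y" using True e by (auto simp: pairs_def)
      then show ?thesis by blast
    qed (use e in \<open>auto simp: pairs_def\<close>)
  next
    fix e assume "e \<in> pairs Y \<union> (\<lambda>y. {w, y}) ` Y"
    then show "e \<in> pairs (insert w Y)"
      using assms(1) by (auto simp: pairs_def card_insert_if)
  qed
  show "pairs Y \<inter> (\<lambda>y. {w, y}) ` Y = {}" using assms(1) by (auto simp: pairs_def)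
qed

text \<open>A choice of signs in the exponents is encoded by the set \<open>R\<close> of points that
  are inverted.\<close>

definition flip :: "complex set \<Rightarrow> complex \<Rightarrow> complex" where
  "flip R x = (if x \<in> R then 1 / x else x)"

context nome
begin

text \<open>Theta functions at all points of the torus, as functions of the multiset of coordinates: this
  builds in the invariance under permutations.\<close>

definition TM :: "nat \<Rightarrow> nat \<Rightarrow> (complex multiset \<Rightarrow> complex) \<Rightarrow> bool" where
  "TM m n F \<longleftrightarrow> (\<forall>M. Suc (size M) = n \<longrightarrow> 0 \<notin># M \<longrightarrow> (\<lambda>z. F (add_mset z M)) \<in> V m)"

lemma TM_T:
  assumes "TM m n F" "X \<subseteq> good" shows "T X m n (\<lambda>S. F (mset_set S))"
  unfolding T_def
proof (intro allI impI)
  fix M assume M: "gen X M" "Suc (card M) = n"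
  have "0 \<notin># mset_set M" using M(1) assms(2) good_nz gen_finite[OF M(1)] by (auto simp: gen_def)
  then have "(\<lambda>z. F (add_mset z (mset_set M))) \<in> V m" using assms(1) M(2) by (simp add: TM_def)
  then show "\<exists>\<phi>\<in>V m. \<forall>z. z \<notin> M \<longrightarrow> gen X (insert z M) \<longrightarrow> F (mset_set (insert z M)) = \<phi> z"
    using gen_finite[OF M(1)] by (intro bexI) auto
qed

lemma flip_eqv: "x \<noteq> 0 \<Longrightarrow> eqv (flip R x) x"
  by (auto simp: flip_def eqv_def)

lemma flip_inj:
  assumes "gen good S" "x \<in> S" "y \<in> S" "eqv (flip R x) (flip R y)"
  shows "x = y"
proof -
  have nz: "x \<noteq> 0" "y \<noteq> 0" using assms(1-3) good_nz by (auto simp: gen_def)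
  have "eqv x y"
    using eqv_trans[OF eqv_sym[OF flip_eqv[OF nz(1)]] eqv_trans[OF assms(4) flip_eqv[OF nz(2)]]] .
  then show ?thesis using assms(1-3) by (auto simp: gen_def)
qed

lemma inj_on_flip:
  assumes "gen good S" shows "inj_on (flip R) S"
proof (rule inj_onI)
  fix x y assume xy: "x \<in> S" "y \<in> S" "flip R x = flip R y"
  have "x \<noteq> 0" using assms xy(1) good_nz by (auto simp: gen_def)
  then have "flip R x \<noteq> 0" by (simp add: flip_def)
  then show "x = y" using flip_inj[OF assms xy(1,2)] xy(3) eqv_refl by metis
qed

lemma gen_flip:
  assumes "gen good S" shows "gen good (flip R ` S)"
proof -
  have "flip R x \<in> good" if "x \<in> S" for x
  proof -
    have "x \<in> good" using assms that by (auto simp: gen_def)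
    then show ?thesis using good_eqv[OF _ eqv_sym[OF flip_eqv]] good_nz by blast
  qed
  then show ?thesis using flip_inj[OF assms] gen_finite[OF assms] unfolding gen_def by blast
qed

section \<open>The common denominator of the difference operator\<close>

definition th2 :: "complex \<Rightarrow> complex \<Rightarrow> complex" where
  "th2 x z = \<theta> (z * x) * \<theta> (z / x)"

lemma th2_thE: "x \<noteq> 0 \<Longrightarrow> z \<noteq> 0 \<Longrightarrow> th2 x z = (- z / x) * thE x z"
  using theta_inverse[of "x / z"] by (simp add: th2_def thE_def mult_ac)

lemma th2_eq_0_iff: "x \<noteq> 0 \<Longrightarrow> z \<noteq> 0 \<Longrightarrow> th2 x z = 0 \<longleftrightarrow> eqv z x"
  using thE_eq_0_iff[of x z] by (simp add: th2_thE)

lemma th2_flip: "th2 (flip R x) z = th2 x z" by (simp add: th2_def flip_def)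

lemma th2_inverse: "x \<noteq> 0 \<Longrightarrow> z \<noteq> 0 \<Longrightarrow> th2 x (1 / z) = th2 x z / z\<^sup>2"
  by (simp add: th2_thE thE_inverse power2_eq_square)

lemma th2_p: "x \<noteq> 0 \<Longrightarrow> z \<noteq> 0 \<Longrightarrow> th2 x (p * z) = th2 x z / z\<^sup>2"
  by (simp add: th2_thE thE_p power2_eq_square)

lemma holomorphic_th2: "x \<noteq> 0 \<Longrightarrow> th2 x holomorphic_on - {0}"
  unfolding th2_def[abs_def] by (intro holomorphic_intros) auto

lemma theta_sq_p: "z \<noteq> 0 \<Longrightarrow> \<theta> ((p * z)\<^sup>2) = \<theta> (z\<^sup>2) / (p * z ^ 4)"
  using theta_p_mult[of "z\<^sup>2"] theta_p_mult[of "p * z\<^sup>2"]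
  by (simp add: power_mult_distrib power2_eq_square power4_eq_xxxx mult_ac)

lemma theta_sq_inverse: "z \<noteq> 0 \<Longrightarrow> \<theta> ((1 / z)\<^sup>2) = - \<theta> (z\<^sup>2) / z\<^sup>2"
  using theta_inverse[of "z\<^sup>2"] by (simp add: power_divide)

text \<open>The denominator in one variable \<open>z\<close>, with the other variables in
  \<open>M\<close>. By \<open>Th_flip\<close> it is the same for all choices of signs in
  \<open>M\<close>.\<close>

definition Th :: "complex set \<Rightarrow> complex \<Rightarrow> complex" where
  "Th M z = \<theta> (z\<^sup>2) * (\<Prod>x\<in>M. th2 x z)"

lemma Th_flip: "gen good M \<Longrightarrow> Th (flip R ` M) z = Th M z"
  by (simp add: Th_def prod.reindex[OF inj_on_flip] th2_flip)

lemma gen_nz: "gen good M \<Longrightarrow> x \<in> M \<Longrightarrow> x \<noteq> 0" using good_nz by (auto simp: gen_def)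

lemma Th_inverse:
  assumes "gen good M" "z \<noteq> 0" shows "Th M (1 / z) = - Th M z / z ^ (2 * Suc (card M))"
proof -
  have "(\<Prod>x\<in>M. th2 x (1 / z)) = (\<Prod>x\<in>M. th2 x z) / z ^ (2 * card M)"
    using assms by (simp add: th2_inverse gen_nz prod_dividef power_mult cong: prod.cong)
  moreover have "2 * Suc (card M) = 2 + 2 * card M" by simp
  then have "z ^ (2 * Suc (card M)) = z\<^sup>2 * z ^ (2 * card M)" by (simp only: power_add)
  ultimately show ?thesis unfolding Th_def theta_sq_inverse[OF assms(2)] by (simp del: power_Suc mult_Suc_right)
qed

lemma Th_p:
  assumes "gen good M" "z \<noteq> 0" shows "Th M (p * z) = Th M z / (p * z ^ (2 * Suc (card M) + 2))"
proof -
  have "(\<Prod>x\<in>M. th2 x (p * z)) = (\<Prod>x\<in>M. th2 x z) / z ^ (2 * card M)"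
    using assms by (simp add: th2_p gen_nz prod_dividef power_mult cong: prod.cong)
  moreover have "2 * Suc (card M) + 2 = 4 + 2 * card M" by simp
  then have "z ^ (2 * Suc (card M) + 2) = z ^ 4 * z ^ (2 * card M)" by (simp only: power_add)
  ultimately show ?thesis unfolding Th_def theta_sq_p[OF assms(2)] by (simp del: power_Suc mult_Suc_right)
qed

lemma Th_eq_0_iff:
  assumes "gen good M" "z \<noteq> 0" shows "Th M z = 0 \<longleftrightarrow> z\<^sup>2 \<in> pZ \<or> z \<in> orbits M"
proof -
  have "(\<Prod>x\<in>M. th2 x z) = 0 \<longleftrightarrow> (\<exists>x\<in>M. eqv z x)"
    using gen_finite[OF assms(1)] gen_nz[OF assms(1)] assms(2) th2_eq_0_iff by auto
  then show ?thesis using assms(2) by (auto simp: Th_def theta_eq_0_iff orbits_def orbit_def)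
qed

lemma holomorphic_Th: "gen good M \<Longrightarrow> Th M holomorphic_on - {0}"
  unfolding Th_def[abs_def] using gen_nz by (auto intro!: holomorphic_intros holomorphic_th2)

lemma simple_zeros_th2:
  assumes "x \<in> good" shows "simple_zeros_on (- {0}) (th2 x)"
proof -
  have x: "x \<noteq> 0" using assms by (rule good_nz)
  have "((\<lambda>z. z / x) has_field_derivative 1 / x) (at z)" for z
    using x by (auto intro!: derivative_eq_intros)
  then have d1: "deriv (\<lambda>z. z / x) z = 1 / x" for z by (rule DERIV_imp_deriv)
  have "((\<lambda>z. z * x) has_field_derivative x) (at z)" for z
    by (auto intro!: derivative_eq_intros)
  then have d2: "deriv (\<lambda>z. z * x) z = x" for z by (rule DERIV_imp_deriv)
  have "\<theta> (z / x) \<noteq> 0" if "z \<noteq> 0" "\<theta> (z * x) = 0" for z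
  proof
    assume "\<theta> (z / x) = 0"
    then have "z * x \<in> pZ" "z / x \<in> pZ" using that x by (auto simp: theta_eq_0_iff)
    then have "(z * x) / (z / x) \<in> pZ" by (rule pZ_divide)
    then show False using that x assms by (simp add: power2_eq_square good_def)
  qed
  then show ?thesis unfolding th2_def[abs_def] using x
    by (intro simple_zeros_on_mult simple_zeros_theta_comp holomorphic_intros) (auto simp: d1 d2)
qed

text \<open>No two factors share a zero: a point whose square is a power of p is not good, whereas
  the orbits of \<open>M\<close> consist of good points and are pairwise disjoint.\<close>

lemma simple_zeros_Th:
  assumes M: "gen good M" shows "simple_zeros_on (- {0}) (Th M)"
  unfolding Th_def[abs_def]
proof (rule simple_zeros_on_mult)
  have "((\<lambda>z. z\<^sup>2) has_field_derivative 2 * z) (at z)" for z :: complex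
    by (auto intro!: derivative_eq_intros)
  then have d: "deriv (\<lambda>z. z\<^sup>2) z = 2 * z" for z :: complex by (rule DERIV_imp_deriv)
  show "simple_zeros_on (- {0}) (\<lambda>z. \<theta> (z\<^sup>2))"
    by (intro simple_zeros_theta_comp holomorphic_intros) (auto simp: d)
  show "simple_zeros_on (- {0}) (\<lambda>z. \<Prod>x\<in>M. th2 x z)"
  proof (rule simple_zeros_on_prod)
    show "simple_zeros_on (- {0}) (th2 x)" if "x \<in> M" for x
      using M that by (intro simple_zeros_th2) (auto simp: gen_def)
    show "x = y" if xy: "x \<in> M" "y \<in> M" and z: "z \<in> - {0}" "th2 x z = 0" "th2 y z = 0" for x y z
    proof -
      have "eqv z x" "eqv z y" using z th2_eq_0_iff gen_nz[OF M] xy by auto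
      then have "eqv x y" using eqv_trans eqv_sym by blast
      then show ?thesis using M xy by (auto simp: gen_def)
    qed
  qed (use gen_finite[OF M] gen_nz[OF M] holomorphic_th2 in auto)
  show "(\<Prod>x\<in>M. th2 x z) \<noteq> 0" if z: "z \<in> - {0}" "\<theta> (z\<^sup>2) = 0" for z
  proof
    assume "(\<Prod>x\<in>M. th2 x z) = 0"
    then obtain x where x: "x \<in> M" "eqv z x"
      using gen_finite[OF M] gen_nz[OF M] z th2_eq_0_iff by auto
    then have "z \<in> good" using M good_eqv[of x z] eqv_sym[of z x] by (auto simp: gen_def)
    then show False using z by (simp add: good_def theta_eq_0_iff)
  qed
qed (use gen_nz[OF M] in \<open>auto intro!: holomorphic_intros holomorphic_th2\<close>)

end

section \<open>The elliptic difference operator of type BC_n\<close>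

locale difference_operator = nome +
  fixes s t u0 u1 u2 u3 :: complex
  assumes s_nz: "s \<noteq> 0" and t_nz: "t \<noteq> 0"
    and u_nz: "u0 \<noteq> 0" "u1 \<noteq> 0" "u2 \<noteq> 0" "u3 \<noteq> 0"
begin

definition u :: "complex \<Rightarrow> complex" where
  "u y = \<theta> (u0 * y) * \<theta> (u1 * y) * \<theta> (u2 * y) * \<theta> (u3 * y)"

text \<open>The coefficient of a term, as a function of the points after inversion. Unordered pairs
  are two-element sets, so the product of a pair is the product over that set.\<close>

definition K :: "complex set \<Rightarrow> complex" where
  "K Y = (\<Prod>y\<in>Y. u y / \<theta> (y\<^sup>2)) * (\<Prod>e\<in>pairs Y. \<theta> (t * \<Prod>e) / \<theta> (\<Prod>e))"

definition smset :: "complex set \<Rightarrow> complex multiset" where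
  "smset Y = image_mset ((*) s) (mset_set Y)"

text \<open>Every variable is shifted by \<open>s\<close> or 1/\<open>s\<close>, independently. The
  shift by 1/\<open>s\<close> appears as an inversion followed by multiplication with
  \<open>s\<close>, the same thing for functions invariant under inversion. The role of
  \<open>s\<close> is that of q^(1/2).\<close>

definition D :: "(complex multiset \<Rightarrow> complex) \<Rightarrow> complex set \<Rightarrow> complex" where
  "D F S = (\<Sum>R\<in>Pow S. K (flip R ` S) * F (smset (flip R ` S)))"

lemma u_p: "z \<noteq> 0 \<Longrightarrow> u (p * z) = u z / (u0 * u1 * u2 * u3 * z ^ 4)"
  using theta_p_mult[of "u0 * z"] theta_p_mult[of "u1 * z"] theta_p_mult[of "u2 * z"] theta_p_mult[of "u3 * z"] u_nz
  by (simp add: u_def power4_eq_xxxx mult_ac)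

lemma holomorphic_u: "u holomorphic_on - {0}"
  unfolding u_def[abs_def] using u_nz by (intro holomorphic_intros) auto

lemma K_insert:
  assumes "w \<notin> Y" "finite Y"
  shows "K (insert w Y) = u w / \<theta> (w\<^sup>2) * K Y * (\<Prod>y\<in>Y. \<theta> (t * w * y) / \<theta> (w * y))"
proof -
  have inj: "inj_on (\<lambda>y. {w, y}) Y" using assms(1) by (auto simp: inj_on_def doubleton_eq_iff)
  have "\<Prod>{w, y} = w * y" if "y \<in> Y" for y
    using assms(1) that by (subst prod.insert) auto
  then have "(\<Prod>e\<in>(\<lambda>y. {w, y}) ` Y. \<theta> (t * \<Prod>e) / \<theta> (\<Prod>e)) = (\<Prod>y\<in>Y. \<theta> (t * w * y) / \<theta> (w * y))"
    unfolding prod.reindex[OF inj] o_def by (intro prod.cong) (auto simp: mult_ac)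
  then show ?thesis
    unfolding K_def pairs_insert(1)[OF assms]
    using assms by (subst prod.union_disjoint) (auto simp: finite_pairs pairs_insert(2)[OF assms])
qed

text \<open>The numerator of one term over the denominator \<open>Th\<close>: the factors theta(z y)
  and theta(z^2) have been cancelled, so that it is holomorphic in all nonzero
  \<open>z\<close>.\<close>

definition N :: "(complex multiset \<Rightarrow> complex) \<Rightarrow> complex set \<Rightarrow> complex \<Rightarrow> complex" where
  "N F Y z = u z * K Y * (\<Prod>y\<in>Y. \<theta> (t * z * y) * \<theta> (z / y)) * F (add_mset (s * z) (smset Y))"

lemma smset_insert: "w \<notin> Y \<Longrightarrow> finite Y \<Longrightarrow> smset (insert w Y) = add_mset (s * w) (smset Y)"
  by (simp add: smset_def)

lemma N_eq:
  assumes "gen good (insert w Y)" "w \<notin> Y"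
  shows "Th Y w * (K (insert w Y) * F (smset (insert w Y))) = N F Y w"
proof -
  have fin: "finite Y" using gen_finite[OF assms(1)] by simp
  have w: "w \<noteq> 0" "w\<^sup>2 \<notin> pZ" using assms(1) by (auto simp: gen_def good_def)
  have "\<theta> (w * y) \<noteq> 0" if "y \<in> Y" for y
  proof -
    have "w \<noteq> y" using assms(2) that by blast
    then have "\<not> eqv w y" using assms(1) that by (auto simp: gen_def)
    moreover have "y \<noteq> 0" using gen_nz[OF assms(1)] that by blast
    ultimately show ?thesis using w by (simp add: theta_eq_0_iff eqv_def)
  qed
  then have "(\<Prod>y\<in>Y. th2 y w) * (\<Prod>y\<in>Y. \<theta> (t * w * y) / \<theta> (w * y))
      = (\<Prod>y\<in>Y. \<theta> (t * w * y) * \<theta> (w / y))"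
    unfolding prod.distrib[symmetric] by (intro prod.cong) (auto simp: th2_def)
  moreover have "\<theta> (w\<^sup>2) \<noteq> 0" using w by (simp add: theta_eq_0_iff)
  ultimately show ?thesis
    unfolding N_def K_insert[OF assms(2) fin] smset_insert[OF assms(2) fin] Th_def
    by (simp add: field_simps)
qed

lemma smset_nz: "gen good Y \<Longrightarrow> 0 \<notin># smset Y"
  using gen_nz s_nz gen_finite by (auto simp: smset_def)

lemma size_smset: "size (smset Y) = card Y" by (simp add: smset_def)

lemma slice_V:
  assumes "TM m n F" "gen good Y" "Suc (card Y) = n"
  shows "(\<lambda>z. F (add_mset z (smset Y))) \<in> V m"
  using assms smset_nz by (simp add: TM_def size_smset)

lemma holomorphic_N:
  assumes "TM m n F" "gen good Y" "Suc (card Y) = n"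
  shows "N F Y holomorphic_on - {0}"
proof -
  have "(\<lambda>z. F (add_mset z (smset Y))) holomorphic_on - {0}"
    using slice_V[OF assms] by (simp add: V_def)
  then have "((\<lambda>z. F (add_mset z (smset Y))) \<circ> (\<lambda>z. s * z)) holomorphic_on - {0}"
    using s_nz by (intro holomorphic_on_compose_gen[where t = "- {0}"] holomorphic_intros) auto
  then show ?thesis unfolding N_def[abs_def] o_def
    using t_nz gen_nz[OF assms(2)] by (intro holomorphic_intros holomorphic_u) auto
qed

text \<open>The balancing condition \<open>bal\<close> absorbs the parameters. What remains is the
  multiplier of \<open>Th\<close> times that of degree \<open>m\<close>, common to all
  terms.\<close>

lemma N_p:
  assumes "TM m n F" "gen good Y" "Suc (card Y) = n" "z \<noteq> 0"
    and bal: "u0 * u1 * u2 * u3 * t ^ card Y * s ^ (2 * m) = p"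
  shows "N F Y (p * z) = N F Y z / (p * z ^ (2 * n + 2) * (p * z\<^sup>2) ^ m)"
proof -
  have 1: "\<theta> (t * (p * z) * y) * \<theta> (p * z / y) = \<theta> (t * z * y) * \<theta> (z / y) / (t * z\<^sup>2)" if "y \<in> Y" for y
    using theta_p_mult[of "t * z * y"] theta_p_mult[of "z / y"] t_nz \<open>z \<noteq> 0\<close> gen_nz[OF assms(2) that]
    by (simp add: power2_eq_square mult_ac)
  have 2: "(\<Prod>y\<in>Y. \<theta> (t * (p * z) * y) * \<theta> (p * z / y)) =
      (\<Prod>y\<in>Y. \<theta> (t * z * y) * \<theta> (z / y)) / (t * z\<^sup>2) ^ card Y"
    by (simp add: 1 prod_dividef cong: prod.cong)
  have "F (add_mset (p * (s * z)) (smset Y)) = (p * (s * z)\<^sup>2) powi (- int m) * F (add_mset (s * z) (smset Y))"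
    using V_p[OF slice_V[OF assms(1-3)], of "s * z"] s_nz \<open>z \<noteq> 0\<close> by simp
  then have 3: "F (add_mset (s * (p * z)) (smset Y)) = F (add_mset (s * z) (smset Y)) / (p * (s * z)\<^sup>2) ^ m"
    unfolding power_int_minus power_int_of_nat by (simp add: mult_ac divide_inverse)
  have 4: "(u0 * u1 * u2 * u3 * z ^ 4) * (t * z\<^sup>2) ^ card Y * (p * (s * z)\<^sup>2) ^ m
      = (u0 * u1 * u2 * u3 * t ^ card Y * s ^ (2 * m)) * (z ^ (2 * n + 2) * (p * z\<^sup>2) ^ m)"
  proof -
    have "2 * n + 2 = 4 + 2 * card Y" using assms(3) by simp
    then have "z ^ (2 * n + 2) = z ^ 4 * z ^ (2 * card Y)" by (simp only: power_add)
    then show ?thesis by (simp add: power_mult_distrib mult_ac flip: power_mult)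
  qed
  have "N F Y (p * z) = N F Y z / ((u0 * u1 * u2 * u3 * z ^ 4) * (t * z\<^sup>2) ^ card Y * (p * (s * z)\<^sup>2) ^ m)"
    unfolding N_def 2 3 u_p[OF \<open>z \<noteq> 0\<close>] by simp
  then show ?thesis unfolding 4 bal by (simp add: mult_ac)
qed

text \<open>The residues of two terms at \<open>z = x\<close> cancel: the sign changes of \<open>z\<close> and \<open>x\<close> are exchanged.\<close>

lemma N_swap:
  assumes "gen good (insert x Y)" "x \<notin> Y"
  shows "N F (insert (1 / x) Y) x = x ^ (2 * Suc (Suc (card Y))) * N F (insert x Y) (1 / x)"
proof -
  have fin: "finite Y" using gen_finite[OF assms(1)] by simp
  have x: "x \<noteq> 0" "x\<^sup>2 \<notin> pZ" using assms(1) by (auto simp: gen_def good_def)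
  have Yx: "y \<noteq> 0 \<and> \<not> eqv x y" if "y \<in> Y" for y
  proof -
    have "x \<noteq> y" using assms(2) that by blast
    then show ?thesis using assms(1) that gen_nz[OF assms(1)] by (auto simp: gen_def)
  qed
  have x': "1 / x \<notin> Y"
  proof
    assume "1 / x \<in> Y"
    then have "\<not> eqv x (1 / x)" using Yx by blast
    then show False using x(1) by (simp add: eqv_def)
  qed
  have nz: "\<theta> (x * y) \<noteq> 0" "\<theta> (y / x) \<noteq> 0" if "y \<in> Y" for y
    using Yx[OF that] x pZ_swap[of x y] by (auto simp: theta_eq_0_iff eqv_def)
  have trm: "\<theta> (x / y) / \<theta> (y / x) = x\<^sup>2 * (\<theta> (1 / (x * y)) / \<theta> (x * y))" if "y \<in> Y" for y
  proof -
    have "\<theta> (x / y) = - (x / y) * \<theta> (y / x)" "\<theta> (1 / (x * y)) = - \<theta> (x * y) / (x * y)"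
      using theta_inverse[of "y / x"] theta_inverse[of "x * y"] Yx[OF that] x by simp_all
    then show ?thesis using nz[OF that] Yx[OF that] x(1) by (simp add: power2_eq_square)
  qed
  define a where "a = \<theta> (x\<^sup>2)"
  have a: "a \<noteq> 0" using x by (simp add: a_def theta_eq_0_iff)
  have b: "\<theta> ((1 / x)\<^sup>2) = - a / x\<^sup>2" using theta_sq_inverse[OF x(1)] by (simp add: a_def)
  have L: "(\<Prod>y\<in>Y. \<theta> (t * (1 / x) * y) / \<theta> (1 / x * y)) * (\<Prod>y\<in>Y. \<theta> (t * x * y) * \<theta> (x / y))
      = x ^ (2 * card Y) * ((\<Prod>y\<in>Y. \<theta> (t * x * y) / \<theta> (x * y)) * (\<Prod>y\<in>Y. \<theta> (t * (1 / x) * y) * \<theta> (1 / x / y)))"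
  proof -
    have "\<theta> (t * (1 / x) * y) / \<theta> (1 / x * y) * (\<theta> (t * x * y) * \<theta> (x / y)) =
        x\<^sup>2 * (\<theta> (t * x * y) / \<theta> (x * y) * (\<theta> (t * (1 / x) * y) * \<theta> (1 / x / y)))" if "y \<in> Y" for y
    proof -
      have "\<theta> (t * (1 / x) * y) / \<theta> (1 / x * y) * (\<theta> (t * x * y) * \<theta> (x / y)) =
          \<theta> (t * (1 / x) * y) * \<theta> (t * x * y) * (\<theta> (x / y) / \<theta> (y / x))" by simp
      also have "\<dots> = \<theta> (t * (1 / x) * y) * \<theta> (t * x * y) * (x\<^sup>2 * (\<theta> (1 / (x * y)) / \<theta> (x * y)))"
        by (simp only: trm[OF that])
      finally show ?thesis by simp
    qed
    then have "(\<Prod>y\<in>Y. \<theta> (t * (1 / x) * y) / \<theta> (1 / x * y) * (\<theta> (t * x * y) * \<theta> (x / y))) =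
        (\<Prod>y\<in>Y. x\<^sup>2 * (\<theta> (t * x * y) / \<theta> (x * y) * (\<theta> (t * (1 / x) * y) * \<theta> (1 / x / y))))"
      by (rule prod.cong[OF refl])
    then show ?thesis by (simp only: prod.distrib prod_constant power_mult)
  qed
  have F: "F (add_mset (s * x) (smset (insert (1 / x) Y))) = F (add_mset (s * (1 / x)) (smset (insert x Y)))"
    by (simp only: smset_insert[OF x' fin] smset_insert[OF assms(2) fin] add_mset_commute)
  define G where "G = F (add_mset (s * (1 / x)) (smset (insert x Y)))"
  define P1 where "P1 = (\<Prod>y\<in>Y. \<theta> (t * (1 / x) * y) / \<theta> (1 / x * y))"
  define P2 where "P2 = (\<Prod>y\<in>Y. \<theta> (t * x * y) * \<theta> (x / y))"
  define P3 where "P3 = (\<Prod>y\<in>Y. \<theta> (t * x * y) / \<theta> (x * y))"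
  define P4 where "P4 = (\<Prod>y\<in>Y. \<theta> (t * (1 / x) * y) * \<theta> (1 / x / y))"
  have L': "P1 * P2 = x ^ (2 * card Y) * (P3 * P4)" using L by (simp only: P1_def P2_def P3_def P4_def)
  have "N F (insert (1 / x) Y) x = u x * (u (1 / x) / (- a / x\<^sup>2) * K Y * P1) * (\<theta> t * a * P2) * G"
    unfolding N_def K_insert[OF x' fin] F G_def P1_def P2_def b
    using fin x' x(1) by (simp add: power2_eq_square a_def)
  also have "\<dots> = - u x * u (1 / x) * K Y * \<theta> t * x\<^sup>2 * (P1 * P2) * G"
    using a x(1) by (simp add: field_simps)
  also have "\<dots> = x ^ (2 * Suc (Suc (card Y))) *
      (u (1 / x) * (u x / a * K Y * P3) * (\<theta> t * (- a / x\<^sup>2) * P4) * G)"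
    unfolding L' using a x(1) by (simp add: field_simps power2_eq_square power_mult power4_eq_xxxx)
  also have "u (1 / x) * (u x / a * K Y * P3) * (\<theta> t * (- a / x\<^sup>2) * P4) * G = N F (insert x Y) (1 / x)"
    unfolding b[symmetric] unfolding N_def K_insert[OF assms(2) fin] P3_def P4_def G_def[symmetric] a_def
    using fin assms(2) x(1) by (simp add: power2_eq_square)
  finally show ?thesis .
qed

text \<open>After multiplication by \<open>Th\<close>, the slice becomes a holomorphic function \<open>H\<close> that is
  antisymmetric up to monomials, hence vanishes at the zeros of \<open>Th\<close>.\<close>

theorem T_D:
  assumes F: "TM m n F" and bal: "u0 * u1 * u2 * u3 * t ^ (n - 1) * s ^ (2 * m) = p"
  shows "T good m n (D F)"
  unfolding T_def
proof (intro allI impI)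
  fix M assume M: "gen good M" "Suc (card M) = n"
  define Y where "Y = (\<lambda>R. flip R ` M)"
  define NN where "NN = (\<lambda>z. \<Sum>R\<in>Pow M. N F (Y R) z)"
  \<comment> \<open>\<open>NN\<close> collects the terms in which \<open>z\<close> is not inverted.
    The other terms are \<open>NN (1 / z)\<close>, with factor and sign supplied by
    \<open>Th_inverse\<close>.\<close>
  define H where "H = (\<lambda>z. NN z - z ^ (2 * n) * NN (1 / z))"
  define E where "E = (\<lambda>z. p * z ^ (2 * n + 2) * (p * z\<^sup>2) ^ m)"
  have finM: "finite M" using gen_finite[OF M(1)] .
  have Y: "gen good (Y R)" "card (Y R) = card M" for R
    using gen_flip[OF M(1)] inj_on_flip[OF M(1)] by (auto simp: Y_def card_image)
  have cY: "Suc (card (Y R)) = n" for R using Y(2) M(2) by simp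
  have holN: "NN holomorphic_on - {0}"
    unfolding NN_def by (intro holomorphic_intros holomorphic_N[OF F Y(1) cY])
  have "(NN \<circ> (\<lambda>z. 1 / z)) holomorphic_on - {0}"
    using holN by (intro holomorphic_on_compose_gen[where t = "- {0}"] holomorphic_intros) auto
  then have holH: "H holomorphic_on - {0}"
    unfolding H_def o_def by (intro holomorphic_intros holN)
  have NN_p: "NN (p * z) = NN z / E z" if "z \<noteq> 0" for z
  proof -
    have "u0 * u1 * u2 * u3 * t ^ card (Y R) * s ^ (2 * m) = p" for R
      using bal Y(2) M(2) by auto
    then show ?thesis
      unfolding NN_def E_def sum_divide_distrib by (intro sum.cong N_p[OF F Y(1) cY that]) auto
  qed
  have E_nz: "E z \<noteq> 0" if "z \<noteq> 0" for z using that by (simp add: E_def)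
  have H_inverse: "H (1 / z) = - H z / z ^ (2 * n)" if "z \<noteq> 0" for z
    using that by (simp add: H_def field_simps)
  have H_p: "H (p * z) = H z / E z" if z: "z \<noteq> 0" for z
  proof -
    have "p * (1 / (p * z)) = 1 / z" by simp
    then have "NN (1 / z) = NN (1 / (p * z)) / E (1 / (p * z))"
      using NN_p[of "1 / (p * z)"] z by simp
    then have "NN (1 / (p * z)) = E (1 / (p * z)) * NN (1 / z)" using E_nz[of "1 / (p * z)"] z by simp
    moreover have "(p * z) ^ (2 * n) * E (1 / (p * z)) = z ^ (2 * n) / E z"
    proof -
      have "p * (1 / (p * z))\<^sup>2 = 1 / (p * z\<^sup>2)" by (simp add: power2_eq_square)
      then have "E (1 / (p * z)) = p / ((p * z) ^ (2 * n) * (p * z)\<^sup>2 * (p * z\<^sup>2) ^ m)"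
        unfolding E_def by (simp add: power_divide power_add power2_eq_square mult_ac)
      moreover have "E z = p * (z ^ (2 * n) * z\<^sup>2) * (p * z\<^sup>2) ^ m"
        unfolding E_def by (simp add: power_add power2_eq_square)
      ultimately show ?thesis using z by (simp add: power2_eq_square mult_ac)
    qed
    ultimately have "(p * z) ^ (2 * n) * NN (1 / (p * z)) = z ^ (2 * n) / E z * NN (1 / z)"
      by (simp only: mult.assoc[symmetric])
    then show ?thesis
      unfolding H_def NN_p[OF z] by (simp add: diff_divide_distrib)
  qed
  have H_M: "H x = 0" if x: "x \<in> M" for x
  proof -
    have x0: "x \<noteq> 0" using gen_nz[OF M(1) x] .
    define M' where "M' = M - {x}"
    have M': "M = insert x M'" "x \<notin> M'" "finite M'" using x finM by (auto simp: M'_def)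
    have img: "Y R = insert x (flip R ` M')" "Y (insert x R) = insert (1 / x) (flip R ` M')" "x \<notin> flip R ` M'"
      if "R \<in> Pow M'" for R
    proof -
      have R: "x \<notin> R" using that M'(2) by auto
      show "Y R = insert x (flip R ` M')" using R by (simp add: Y_def M'(1) flip_def)
      have 1: "flip (insert x R) ` M' = flip R ` M'" "flip (insert x R) x = 1 / x"
        by (rule image_cong) (use M'(2) in \<open>auto simp: flip_def\<close>)
      show "Y (insert x R) = insert (1 / x) (flip R ` M')"
        unfolding Y_def M'(1) image_insert 1 ..
      have f: "flip R x = x" using R by (simp add: flip_def)
      show "x \<notin> flip R ` M'"
      proof
        assume "x \<in> flip R ` M'"
        then obtain y where y: "y \<in> M'" "flip R x = flip R y" using f by auto
        then have "x = y" using inj_onD[OF inj_on_flip[OF M(1)] y(2)] M'(1) x by blast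
        then show False using y(1) M'(2) by blast
      qed
    qed
    \<comment> \<open>Sign choices are split by whether \<open>x\<close> is inverted. At z = x the
      uninverted half vanishes through theta(x / x), at z = 1/x the inverted half does;
      \<open>N_swap\<close> matches the two halves that remain.\<close>
    have split: "(\<Sum>R\<in>Pow M. g R) = (\<Sum>R\<in>Pow M'. g R) + (\<Sum>R\<in>Pow M'. g (insert x R))" for g :: "complex set \<Rightarrow> complex"
    proof -
      have "inj_on (insert x) (Pow M')" using M'(2) by (auto simp: inj_on_def)
      then show ?thesis unfolding M'(1) Pow_insert
        using M'(2,3) by (subst sum.union_disjoint) (auto simp: sum.reindex)
    qed
    have z1: "N F (Y R) x = 0" if "R \<in> Pow M'" for R
    proof -
      have "(\<Prod>y\<in>Y R. \<theta> (t * x * y) * \<theta> (x / y)) = 0"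
        using img(1)[OF that] x0 M'(3) by (intro prod_zero) auto
      then show ?thesis by (simp add: N_def)
    qed
    have z2: "N F (Y (insert x R)) (1 / x) = 0" if "R \<in> Pow M'" for R
    proof -
      have "(\<Prod>y\<in>Y (insert x R). \<theta> (t * (1 / x) * y) * \<theta> (1 / x / y)) = 0"
        using img(2)[OF that] x0 M'(3) by (intro prod_zero) auto
      then show ?thesis by (simp add: N_def)
    qed
    have sw: "N F (Y (insert x R)) x = x ^ (2 * n) * N F (Y R) (1 / x)" if "R \<in> Pow M'" for R
    proof -
      have "Suc (card (flip R ` M')) = card M"
        using Y(2)[of R] img(1,3)[OF that] M'(3) by simp
      then have n: "Suc (Suc (card (flip R ` M'))) = n" using M(2) by simp
      have "gen good (insert x (flip R ` M'))" using Y(1)[of R] img(1)[OF that] by simp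
      from N_swap[OF this img(3)[OF that], of F] show ?thesis
        unfolding img(1,2)[OF that] n .
    qed
    have "(\<Sum>R\<in>Pow M'. N F (Y R) x) = 0" "(\<Sum>R\<in>Pow M'. N F (Y (insert x R)) (1 / x)) = 0"
      using z1 z2 by (blast intro: sum.neutral)+
    moreover have "(\<Sum>R\<in>Pow M'. N F (Y (insert x R)) x) = (\<Sum>R\<in>Pow M'. x ^ (2 * n) * N F (Y R) (1 / x))"
      using sw by (rule sum.cong[OF refl])
    ultimately show ?thesis
      unfolding H_def NN_def split by (simp add: sum_distrib_left)
  qed
  \<comment> \<open>These points are fixed by z -> 1/z or by z -> p/z, and there the functional
    equations of \<open>H\<close> read H w = - H w.\<close>
  have H_fix: "H w = 0" if w: "w\<^sup>2 = 1 \<or> w\<^sup>2 = p" for w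
  proof -
    have w0: "w \<noteq> 0" using w by auto
    have "H w = - H w"
    proof (cases "w\<^sup>2 = 1")
      case True
      then have "1 / w = w" using w0 by (simp add: power2_eq_square field_simps)
      moreover have "w ^ (2 * n) = 1" using True by (simp add: power_mult)
      ultimately show ?thesis using H_inverse[OF w0] by simp
    next
      case False
      then have p: "w\<^sup>2 = p" using w by simp
      then have "p * (1 / w) = w" using w0 by (simp add: power2_eq_square field_simps)
      then have "H w = H (1 / w) / E (1 / w)" using H_p[of "1 / w"] w0 by simp
      moreover have "E (1 / w) = 1 / w ^ (2 * n)"
      proof -
        have "p * (1 / w)\<^sup>2 = 1" using p w0 by (simp add: power_divide)
        then show ?thesis unfolding E_def using p w0 by (simp add: power_add power_divide power2_eq_square)
      qed
      ultimately show ?thesis using H_inverse[OF w0] w0 by simp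
    qed
    then show ?thesis by simp
  qed
  have H_eqv: "H x = 0 \<longleftrightarrow> H y = 0" if "eqv x y" for x y
    by (rule zero_eqv[OF _ _ that]) (auto simp: H_p H_inverse E_nz)
  have H_zero: "H z = 0" if z: "z \<noteq> 0" "Th M z = 0" for z
  proof -
    consider "z\<^sup>2 \<in> pZ" | "z \<in> orbits M" using z Th_eq_0_iff[OF M(1)] by blast
    then show ?thesis
    proof cases
      case 1
      then obtain k where k: "z\<^sup>2 = p powi k" by (auto simp: pZ_def)
      \<comment> \<open>Halving the exponent moves \<open>z\<close> within its orbit to a point
        whose square is 1 or p, according to the parity of \<open>k\<close>.\<close>
      define j where "j = k div 2"
      define w where "w = z / p powi j"
      have "w\<^sup>2 = p powi (k - 2 * j)"
      proof -
        have "p powi (k - 2 * j) = p powi k / (p powi j * p powi j)"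
          by (simp only: power_int_diff power_int_add mult_2 p_nz not_False_eq_True simp_thms)
        then show ?thesis using k by (simp add: w_def power_divide power2_eq_square)
      qed
      moreover have "k - 2 * j = 0 \<or> k - 2 * j = 1" unfolding j_def by presburger
      ultimately have "w\<^sup>2 = 1 \<or> w\<^sup>2 = p" by auto
      then have "H w = 0" by (rule H_fix)
      moreover have "eqv z w" using z(1) by (simp add: eqv_def w_def)
      ultimately show ?thesis using H_eqv by blast
    next
      case 2
      then show ?thesis using H_eqv H_M by (auto simp: orbits_def orbit_def)
    qed
  qed
  obtain \<phi> where \<phi>: "\<phi> holomorphic_on - {0}" "\<And>z. z \<noteq> 0 \<Longrightarrow> H z = Th M z * \<phi> z"
    using holomorphic_divide_simple_zeros[OF _ holH holomorphic_Th[OF M(1)] simple_zeros_Th[OF M(1)]] H_zero by auto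
  have cont: "continuous_on (- {0}) \<phi>" using \<phi>(1) by (rule holomorphic_on_imp_continuous_on)
  define C where "C = - good \<union> orbits M"
  have C: "countable C"
  proof -
    have "countable (orbits M)" unfolding orbits_def
      by (rule countable_UN[OF countable_finite[OF finM] countable_orbit])
    then show ?thesis unfolding C_def using countable_not_good by (rule countable_Un[rotated])
  qed
  have Th_nz: "z \<noteq> 0" "Th M z \<noteq> 0" if "z \<notin> C" for z
  proof -
    have "z \<in> good" "z \<notin> orbits M" using that by (auto simp: C_def)
    then show "z \<noteq> 0" "Th M z \<noteq> 0" using Th_eq_0_iff[OF M(1), of z] by (auto simp: good_def)
  qed
  have "\<phi> (1 / z) = \<phi> z" if z: "z \<noteq> 0" for z
  proof (rule eq_off_countable[where S = "- {0}" and C = C and f = "\<lambda>z. \<phi> (1 / z)" and g = \<phi>])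
    show "continuous_on (- {0}) (\<lambda>z. \<phi> (1 / z))"
      by (rule continuous_on_compose2[OF cont]) (auto intro!: continuous_intros)
    fix x assume "x \<notin> C"
    note nz = Th_nz[OF this]
    show "\<phi> (1 / x) = \<phi> x"
      using \<phi>(2)[of x] \<phi>(2)[of "1 / x"] H_inverse[OF nz(1)] Th_inverse[OF M(1) nz(1)] nz M(2) by simp
  qed (use z cont C in auto)
  moreover have "\<phi> (p * z) = (p * z\<^sup>2) powi (- int m) * \<phi> z" if z: "z \<noteq> 0" for z
  proof (rule eq_off_countable[where S = "- {0}" and C = C and f = "\<lambda>z. \<phi> (p * z)"
        and g = "\<lambda>z. (p * z\<^sup>2) powi (- int m) * \<phi> z"])
    show "continuous_on (- {0}) (\<lambda>z. \<phi> (p * z))"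
      by (rule continuous_on_compose2[OF cont]) (auto intro!: continuous_intros)
    show "continuous_on (- {0}) (\<lambda>z. (p * z\<^sup>2) powi (- int m) * \<phi> z)"
      by (intro continuous_intros cont) auto
    fix x assume "x \<notin> C"
    note nz = Th_nz[OF this]
    have "Th M x / (p * x ^ (2 * n + 2)) * \<phi> (p * x) = Th M x * \<phi> x / E x"
      using \<phi>(2)[of x] \<phi>(2)[of "p * x"] H_p[OF nz(1)] Th_p[OF M(1) nz(1)] nz M(2) by simp
    then have "\<phi> (p * x) = \<phi> x / (p * x\<^sup>2) ^ m" using nz by (simp add: E_def field_simps)
    then show "\<phi> (p * x) = (p * x\<^sup>2) powi (- int m) * \<phi> x"
      unfolding power_int_minus power_int_of_nat by (simp add: divide_inverse mult.commute)
  qed (use z C in auto)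
  ultimately have "\<phi> \<in> V m" using \<phi>(1) by (simp add: V_def)
  moreover have "D F (insert z M) = \<phi> z" if z: "z \<notin> M" "gen good (insert z M)" for z
  proof -
    have z0: "z \<noteq> 0" "z \<in> good" using z(2) good_nz by (auto simp: gen_def)
    have img: "flip R ` insert z M = insert z (Y R)" "flip (insert z R) ` insert z M = insert (1 / z) (Y R)"
      "z \<notin> Y R" "1 / z \<notin> Y R" if "R \<in> Pow M" for R
    proof -
      have R: "z \<notin> R" using that z(1) by auto
      show 1: "flip R ` insert z M = insert z (Y R)" using R by (simp add: Y_def flip_def)
      have 3: "flip (insert z R) ` M = Y R"
        unfolding Y_def by (rule image_cong) (use z(1) in \<open>auto simp: flip_def\<close>)
      have f: "flip R z = z" "flip (insert z R) z = 1 / z" using R by (simp_all add: flip_def)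
      show "flip (insert z R) ` insert z M = insert (1 / z) (Y R)" unfolding image_insert 3 f ..
      have notin: "flip Q z \<notin> flip Q ` M" for Q
      proof
        assume "flip Q z \<in> flip Q ` M"
        then obtain y where y: "y \<in> M" "flip Q z = flip Q y" by blast
        then have "z = y" using inj_onD[OF inj_on_flip[OF z(2)] y(2)] by blast
        then show False using y(1) z(1) by blast
      qed
      show "z \<notin> Y R" using notin[of R] f(1) by (simp add: Y_def)
      show "1 / z \<notin> Y R" using notin[of "insert z R"] unfolding 3 f .
    qed
    have inj: "inj_on (insert z) (Pow M)" using z(1) by (auto simp: inj_on_def)
    define G where "G = (\<lambda>Z. K Z * F (smset Z))"
    have 1: "Th M z * G (insert z (Y R)) = N F (Y R) z" if "R \<in> Pow M" for R
      using N_eq[of z "Y R" F] gen_flip[OF z(2), of R] img(1,3)[OF that] Th_flip[OF M(1)] by (simp add: G_def Y_def)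
    have 2: "Th M z * G (insert (1 / z) (Y R)) = - (z ^ (2 * n)) * N F (Y R) (1 / z)" if "R \<in> Pow M" for R
    proof -
      have "Th M (1 / z) * G (insert (1 / z) (Y R)) = N F (Y R) (1 / z)"
        using N_eq[of "1 / z" "Y R" F] gen_flip[OF z(2), of "insert z R"] img(2,4)[OF that] Th_flip[OF M(1)]
        by (simp add: G_def Y_def)
      moreover have "Th M z = - (z ^ (2 * n)) * Th M (1 / z)"
        unfolding Th_inverse[OF M(1) z0(1)] M(2) using z0(1) by simp
      ultimately show ?thesis by simp
    qed
    have "D F (insert z M) = (\<Sum>R\<in>Pow M. G (insert z (Y R))) + (\<Sum>R\<in>Pow M. G (insert (1 / z) (Y R)))"
    proof -
      have "D F (insert z M) = (\<Sum>R\<in>Pow M \<union> insert z ` Pow M. G (flip R ` insert z M))"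
        by (simp only: D_def Pow_insert G_def)
      also have "\<dots> = (\<Sum>R\<in>Pow M. G (flip R ` insert z M)) + (\<Sum>R\<in>insert z ` Pow M. G (flip R ` insert z M))"
        using finM z(1) by (intro sum.union_disjoint) auto
      also have "(\<Sum>R\<in>insert z ` Pow M. G (flip R ` insert z M)) = (\<Sum>R\<in>Pow M. G (flip (insert z R) ` insert z M))"
        unfolding sum.reindex[OF inj] o_def ..
      also have "(\<Sum>R\<in>Pow M. G (flip (insert z R) ` insert z M)) = (\<Sum>R\<in>Pow M. G (insert (1 / z) (Y R)))"
        by (rule sum.cong[OF refl]) (simp only: img(2))
      also have "(\<Sum>R\<in>Pow M. G (flip R ` insert z M)) = (\<Sum>R\<in>Pow M. G (insert z (Y R)))"
        by (rule sum.cong[OF refl]) (simp only: img(1))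
      finally show ?thesis .
    qed
    moreover have "(\<Sum>R\<in>Pow M. Th M z * G (insert z (Y R))) = NN z"
      unfolding NN_def by (rule sum.cong[OF refl]) (rule 1)
    moreover have "(\<Sum>R\<in>Pow M. Th M z * G (insert (1 / z) (Y R))) = - (z ^ (2 * n)) * NN (1 / z)"
      unfolding NN_def sum_distrib_left by (rule sum.cong[OF refl]) (rule 2)
    ultimately have "Th M z * D F (insert z M) = H z"
      by (simp add: distrib_left sum_distrib_left[symmetric] H_def)
    moreover have "z \<notin> C"
    proof
      assume "z \<in> C"
      then obtain x where "x \<in> M" "eqv z x" using z0(2) by (auto simp: C_def orbits_def orbit_def)
      then show False using z by (auto simp: gen_def)
    qed
    ultimately show ?thesis using \<phi>(2)[OF z0(1)] Th_nz by simp
  qed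
  ultimately show "\<exists>\<phi>\<in>V m. \<forall>z. z \<notin> M \<longrightarrow> gen good (insert z M) \<longrightarrow> D F (insert z M) = \<phi> z"
    by blast
qed

section \<open>Values of the operator on grid points\<close>

lemma TM_inverse:
  assumes F: "TM m n F"
  shows "0 \<notin># M \<Longrightarrow> size M + size X = n \<Longrightarrow> (\<And>x. x \<in># X \<Longrightarrow> g x \<noteq> 0 \<and> (h x = g x \<or> h x = 1 / g x)) \<Longrightarrow>
    F (M + image_mset g X) = F (M + image_mset h X)"
proof (induction X arbitrary: M)
  case (add x X)
  have gx: "g x \<noteq> 0" "h x = g x \<or> h x = 1 / g x" using add.prems(3)[of x] by auto
  have "F (add_mset (g x) M + image_mset g X) = F (add_mset (g x) M + image_mset h X)"
    using add.prems gx by (intro add.IH) auto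
  moreover have "F (add_mset (h x) (M + image_mset h X)) = F (add_mset (g x) (M + image_mset h X))"
  proof -
    have "h y \<noteq> 0" if "y \<in># X" for y using add.prems(3)[of y] that by auto
    then have "0 \<notin># M + image_mset h X" using add.prems(1) by auto
    then have "(\<lambda>z. F (add_mset z (M + image_mset h X))) \<in> V m"
      using F add.prems(2) by (auto simp: TM_def)
    from V_inverse[OF this gx(1)] gx(2) show ?thesis by auto
  qed
  ultimately show ?case by simp
qed simp

text \<open>Multiplied by \<open>s\<close>, an uninverted point keeps its part on the grid started
  at s c, while an inverted one becomes equivalent to the point with part one less. If the lowered
  sequence is not increasing or not nonnegative, the coefficient is 0: inverting the later but not
  the earlier of two neighbours with equal parts gives the factor theta(1), and inverting a first
  point with part 0 gives u(1/c) = 0.\<close>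

lemma D_term:
  assumes F: "TM m n F" and c: "c \<noteq> 0" "u (1 / c) = 0"
    and A': "grid good (qt_grid c (s\<^sup>2) t)" and A: "grid good (qt_grid (s * c) (s\<^sup>2) t)"
    and \<kappa>: "seq m n \<kappa>" and S: "S = pt (qt_grid c (s\<^sup>2) t) \<kappa> n" and R: "R \<subseteq> S"
    and K: "K (flip R ` S) \<noteq> 0"
  obtains \<kappa>' where "seq m n \<kappa>'" "\<And>j. j < n \<Longrightarrow> \<kappa>' j \<le> \<kappa> j" "R \<noteq> {} \<Longrightarrow> \<exists>j<n. \<kappa>' j < \<kappa> j"
    "F (smset (flip R ` S)) = F (mset_set (pt (qt_grid (s * c) (s\<^sup>2) t) \<kappa>' n))"
proof
  define x where "x = (\<lambda>j. c * (s\<^sup>2) ^ \<kappa> j * t ^ j)"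
  have Sx: "S = x ` {..<n}" by (simp add: S pt_def x_def)
  have x0: "x j \<noteq> 0" for j using c(1) s_nz t_nz by (simp add: x_def)
  have genS: "gen good S" unfolding S using gen_pt[OF A'] .
  have finS: "finite S" using gen_finite[OF genS] .
  have x_inj: "inj_on x {..<n}"
    unfolding x_def by (rule grid_inj_on[OF A' order_refl])
  have finY: "finite (flip R ` S)" using finS by simp
  have u_ne: "u (flip R (x j)) \<noteq> 0" if "j < n" for j
    using K finY that unfolding K_def Sx by auto
  have pair_ne: "t * (flip R (x i) * flip R (x j)) \<noteq> 1" if ij: "i < n" "j < n" "i \<noteq> j" for i j
  proof
    assume eq: "t * (flip R (x i) * flip R (x j)) = 1"
    have "x i \<noteq> x j" using inj_onD[OF x_inj, of i j] ij by auto
    then have ne: "flip R (x i) \<noteq> flip R (x j)"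
      using inj_onD[OF inj_on_flip[OF genS], of R "x i" "x j"] ij by (auto simp: Sx)
    then have "{flip R (x i), flip R (x j)} \<in> pairs (flip R ` S)" using ij by (auto simp: pairs_def Sx)
    moreover have "\<theta> (t * \<Prod>{flip R (x i), flip R (x j)}) = 0" using ne eq by simp
    ultimately have "K (flip R ` S) = 0"
      using finite_pairs[OF finY] unfolding K_def by (auto intro!: prod_zero bexI)
    then show False using K by simp
  qed
  have step: "x i \<in> R" if "Suc i < n" "x (Suc i) \<in> R" "\<kappa> (Suc i) = \<kappa> i" for i
  proof (rule ccontr)
    assume "x i \<notin> R"
    then have "t * (flip R (x i) * flip R (x (Suc i))) = 1"
      using that(2,3) c(1) s_nz t_nz unfolding flip_def by (simp add: x_def field_simps)
    then show False using pair_ne[of i "Suc i"] that(1) by simp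
  qed
  have down: "x i \<in> R" if "i \<le> j" "j < n" "x j \<in> R" "\<kappa> j = \<kappa> i" for i j
    using that
  proof (induction j)
    case (Suc j)
    show ?case
    proof (cases "i = Suc j")
      case False
      then have "i \<le> j" using Suc.prems(1) by simp
      then have "\<kappa> i \<le> \<kappa> j" "\<kappa> j \<le> \<kappa> (Suc j)" using seq_mono[OF \<kappa>] Suc.prems(2) by auto
      then have "\<kappa> j = \<kappa> i" "\<kappa> (Suc j) = \<kappa> j" using Suc.prems(4) by auto
      then show ?thesis using Suc.IH[OF \<open>i \<le> j\<close>] step[of j] Suc.prems(2,3) by simp
    qed (use Suc.prems in simp)
  qed simp
  have pos: "0 < \<kappa> j" if "j < n" "x j \<in> R" for j
  proof (rule ccontr)
    assume "\<not> 0 < \<kappa> j"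
    then have "\<kappa> 0 = 0" "\<kappa> j = \<kappa> 0" using seq_mono[OF \<kappa>, of 0 j] that(1) by auto
    then have "x 0 \<in> R" using down[of 0 j] that by simp
    then have "flip R (x 0) = 1 / c" using \<open>\<kappa> 0 = 0\<close> unfolding flip_def by (simp add: x_def)
    then show False using u_ne[of 0] c(2) that(1) by simp
  qed
  define \<kappa>' where "\<kappa>' = (\<lambda>j. \<kappa> j - (if x j \<in> R then 1 else 0))"
  show "seq m n \<kappa>'"
  proof (rule seqI)
    show "\<kappa>' i \<le> \<kappa>' j" if ij: "i \<le> j" "j < n" for i j
    proof (cases "\<kappa> i = \<kappa> j")
      case True
      then show ?thesis using down[of i j] ij by (auto simp: \<kappa>'_def)
    next
      case False
      then have "\<kappa> i < \<kappa> j" using seq_mono[OF \<kappa> ij] by simp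
      then show ?thesis by (auto simp: \<kappa>'_def)
    qed
    show "\<kappa>' j \<le> m" if "j < n" for j using seq_le[OF \<kappa> that] by (simp add: \<kappa>'_def)
  qed
  show "\<kappa>' j \<le> \<kappa> j" for j by (simp add: \<kappa>'_def)
  show "\<exists>j<n. \<kappa>' j < \<kappa> j" if ne: "R \<noteq> {}"
  proof -
    obtain j where "j < n" "x j \<in> R" using ne R unfolding Sx by blast
    then show ?thesis using pos by (auto simp: \<kappa>'_def intro!: exI[of _ j])
  qed
  show "F (smset (flip R ` S)) = F (mset_set (pt (qt_grid (s * c) (s\<^sup>2) t) \<kappa>' n))"
  proof -
    define h where "h = (\<lambda>j. s * c * (s\<^sup>2) ^ \<kappa>' j * t ^ j)"
    have "inj_on (\<lambda>j. flip R (x j)) {..<n}"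
      using comp_inj_on[OF x_inj, of "flip R"] inj_on_flip[OF genS] by (simp add: Sx o_def)
    from image_mset_mset_set[OF this] have 1: "mset_set (flip R ` S) = image_mset (\<lambda>j. flip R (x j)) (mset_set {..<n})"
      by (simp add: Sx image_image)
    have "inj_on h {..<n}"
      unfolding h_def by (rule grid_inj_on[OF A order_refl])
    from image_mset_mset_set[OF this]
    have 2: "mset_set (pt (qt_grid (s * c) (s\<^sup>2) t) \<kappa>' n) = image_mset h (mset_set {..<n})"
      by (simp add: pt_def h_def)
    have "F ({#} + image_mset (\<lambda>j. s * flip R (x j)) (mset_set {..<n})) = F ({#} + image_mset h (mset_set {..<n}))"
    proof (rule TM_inverse[OF F])
      fix j assume "j \<in># mset_set {..<n}"
      then have j: "j < n" by simp
      show "s * flip R (x j) \<noteq> 0 \<and> (h j = s * flip R (x j) \<or> h j = 1 / (s * flip R (x j)))"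
      proof (cases "x j \<in> R")
        case False
        then show ?thesis using x0[of j] s_nz by (simp add: flip_def h_def \<kappa>'_def) (simp add: x_def)
      next
        case True
        obtain k where k: "\<kappa> j = Suc k" using pos[OF j True] gr0_conv_Suc by blast
        have "h j = x j / s"
          unfolding h_def \<kappa>'_def using True k s_nz by (simp add: x_def power2_eq_square)
        then show ?thesis using True x0[of j] s_nz by (simp add: flip_def)
      qed
    qed auto
    then show ?thesis unfolding smset_def 1 2 by (simp add: image_mset.compositionality o_def)
  qed
qed

lemma flip_empty [simp]: "flip {} x = x" by (simp add: flip_def)

text \<open>By \<open>D_term\<close> every nonzero coefficient with a nonempty set of inversions
  belongs to a strictly smaller sequence, where \<open>F\<close> vanishes; the term without
  inversions is left.\<close>

lemma D_single:
  assumes F: "TM m n F" and c: "c \<noteq> 0" "u (1 / c) = 0"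
    and A': "grid good (qt_grid c (s\<^sup>2) t)" and A: "grid good (qt_grid (s * c) (s\<^sup>2) t)"
    and \<kappa>: "seq m n \<kappa>"
    and zero: "\<And>\<kappa>'. seq m n \<kappa>' \<Longrightarrow> (\<And>j. j < n \<Longrightarrow> \<kappa>' j \<le> \<kappa> j) \<Longrightarrow> \<exists>j<n. \<kappa>' j < \<kappa> j \<Longrightarrow>
      F (mset_set (pt (qt_grid (s * c) (s\<^sup>2) t) \<kappa>' n)) = 0"
  shows "D F (pt (qt_grid c (s\<^sup>2) t) \<kappa> n) =
    K (pt (qt_grid c (s\<^sup>2) t) \<kappa> n) * F (mset_set (pt (qt_grid (s * c) (s\<^sup>2) t) \<kappa> n))"
proof -
  define S where "S = pt (qt_grid c (s\<^sup>2) t) \<kappa> n"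
  have fin: "finite S" by (simp add: S_def)
  have "K (flip R ` S) * F (smset (flip R ` S)) = 0" if R: "R \<in> Pow S - {{}}" for R
  proof (rule ccontr)
    assume ne: "\<not> ?thesis"
    then have "K (flip R ` S) \<noteq> 0" by simp
    have RS: "R \<subseteq> S" "R \<noteq> {}" using R by auto
    show False
    proof (rule D_term[OF F c A' A \<kappa> S_def RS(1) \<open>K (flip R ` S) \<noteq> 0\<close>])
      fix \<kappa>' assume *: "seq m n \<kappa>'" "\<And>j. j < n \<Longrightarrow> \<kappa>' j \<le> \<kappa> j" "R \<noteq> {} \<Longrightarrow> \<exists>j<n. \<kappa>' j < \<kappa> j"
        and eq: "F (smset (flip R ` S)) = F (mset_set (pt (qt_grid (s * c) (s\<^sup>2) t) \<kappa>' n))"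
      have "F (smset (flip R ` S)) = 0" unfolding eq by (rule zero[OF *(1,2) *(3)[OF RS(2)]])
      then show False using ne by simp
    qed
  qed
  then have "(\<Sum>R\<in>Pow S - {{}}. K (flip R ` S) * F (smset (flip R ` S))) = 0" by (intro sum.neutral) blast
  then have "D F S = K (flip {} ` S) * F (smset (flip {} ` S))"
    unfolding D_def using sum.remove[of "Pow S" "{}" "\<lambda>R. K (flip R ` S) * F (smset (flip R ` S))"] fin by simp
  then have 1: "D F S = K S * F (smset S)" by simp
  have "inj_on (\<lambda>j. c * (s\<^sup>2) ^ \<kappa> j * t ^ j) {..<n}" "inj_on (\<lambda>j. s * c * (s\<^sup>2) ^ \<kappa> j * t ^ j) {..<n}"
    by (rule grid_inj_on[OF A' order_refl], rule grid_inj_on[OF A order_refl])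
  then have "smset S = mset_set (pt (qt_grid (s * c) (s\<^sup>2) t) \<kappa> n)"
    unfolding smset_def S_def pt_def
    by (simp add: image_mset_mset_set[symmetric] image_mset.compositionality o_def mult.assoc)
  then show ?thesis using 1 by (simp add: S_def)
qed

lemma D_vanish:
  assumes "TM m n F" "c \<noteq> 0" "u (1 / c) = 0"
    and "grid good (qt_grid c (s\<^sup>2) t)" "grid good (qt_grid (s * c) (s\<^sup>2) t)"
    and "seq m n \<kappa>"
    and "\<And>\<kappa>'. seq m n \<kappa>' \<Longrightarrow> (\<And>j. j < n \<Longrightarrow> \<kappa>' j \<le> \<kappa> j) \<Longrightarrow>
      F (mset_set (pt (qt_grid (s * c) (s\<^sup>2) t) \<kappa>' n)) = 0"
  shows "D F (pt (qt_grid c (s\<^sup>2) t) \<kappa> n) = 0"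
  using D_single[OF assms(1-6)] assms(6,7) by simp

end

context nome
begin

section \<open>Multiplicatively independent parameters\<close>

definition free_params :: "complex \<Rightarrow> complex \<Rightarrow> complex \<Rightarrow> complex \<Rightarrow> bool" where
  "free_params a b q t \<longleftrightarrow> a \<noteq> 0 \<and> b \<noteq> 0 \<and> q \<noteq> 0 \<and> t \<noteq> 0 \<and>
     (\<forall>i j k l :: int. a powi i * b powi j * q powi k * t powi l \<in> pZ \<longrightarrow> i = 0 \<and> j = 0 \<and> k = 0 \<and> l = 0)"

lemma free_paramsD:
  assumes "free_params a b q t" "x \<in> pZ" "x = a powi i * b powi j * q powi k * t powi l"
  shows "i = 0" "j = 0" "k = 0" "l = 0"
  using assms unfolding free_params_def by blast+

lemma free_params_nz:
  assumes "free_params a b q t" shows "a \<noteq> 0" "b \<noteq> 0" "q \<noteq> 0" "t \<noteq> 0"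
  using assms by (auto simp: free_params_def)

lemma free_params_swap: "free_params a b q t \<Longrightarrow> free_params b a q t"
  unfolding free_params_def by (metis mult.commute)

lemma pZ_square: "x \<in> pZ \<Longrightarrow> x\<^sup>2 \<in> pZ" by (simp add: power2_eq_square pZ_mult)

text \<open>Squaring removes the half-integral powers of q: a relation for a/s and b/s becomes one
  for a and b, with doubled exponents.\<close>

lemma free_params_sqrt:
  assumes "free_params a b (s\<^sup>2) t" shows "free_params (a / s) (b / s) (s\<^sup>2) t"
proof -
  have nz: "a \<noteq> 0" "b \<noteq> 0" "s \<noteq> 0" "t \<noteq> 0" using free_params_nz[OF assms] by auto
  have "i = 0 \<and> j = 0 \<and> k = 0 \<and> l = 0"
    if "(a / s) powi i * (b / s) powi j * (s\<^sup>2) powi k * t powi l \<in> pZ" for i j k l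
  proof -
    have "((a / s) powi i * (b / s) powi j * (s\<^sup>2) powi k * t powi l)\<^sup>2
      = a powi (2 * i) * b powi (2 * j) * (s\<^sup>2) powi (2 * k - i - j) * t powi (2 * l)"
    proof -
      have sq: "(z powi e)\<^sup>2 = z powi (2 * e)" if "z \<noteq> 0" for z :: complex and e
        using that by (simp only: power2_eq_square mult_2 power_int_add simp_thms)
      have s2: "(s\<^sup>2) powi e = s powi (2 * e)" for e
        using nz by (simp only: power2_eq_square power_int_mult_distrib mult_2 power_int_add simp_thms)
      have e: "2 * (2 * k - i - j) = 4 * k - 2 * i - 2 * j" by simp
      have R: "(s\<^sup>2) powi (2 * k - i - j) = s powi (4 * k) / s powi (2 * i) / s powi (2 * j)"
        unfolding s2 e using nz by (simp only: power_int_diff simp_thms)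
      have L: "((a / s) powi i * (b / s) powi j * (s\<^sup>2) powi k * t powi l)\<^sup>2
        = (a powi (2 * i) / s powi (2 * i)) * (b powi (2 * j) / s powi (2 * j)) * s powi (4 * k) * t powi (2 * l)"
        using nz by (simp add: power_mult_distrib sq power_int_divide_distrib power_divide s2)
      show ?thesis unfolding L R by (simp only: divide_inverse mult_ac)
    qed
    then have "a powi (2 * i) * b powi (2 * j) * (s\<^sup>2) powi (2 * k - i - j) * t powi (2 * l) \<in> pZ"
      using pZ_square[OF that] by simp
    from free_paramsD[OF assms this refl] show ?thesis by auto
  qed
  then show ?thesis using nz unfolding free_params_def by auto
qed

lemma grid_free:
  assumes "free_params a b q t" shows "grid good (qt_grid a q t)"
proof -
  note nz = free_params_nz[OF assms]
  have "(a * q ^ k * t ^ j)\<^sup>2 \<notin> pZ" for k j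
  proof
    assume "(a * q ^ k * t ^ j)\<^sup>2 \<in> pZ"
    moreover have "(a * q ^ k * t ^ j)\<^sup>2 = a powi 2 * b powi 0 * q powi int (2 * k) * t powi int (2 * j)"
      unfolding power_int_of_nat by (simp add: power_mult_distrib mult.commute flip: power_mult)
    ultimately show False using free_paramsD(1)[OF assms] by fastforce
  qed
  moreover have "k = k' \<and> j = j'" if "eqv (a * q ^ k * t ^ j) (a * q ^ k' * t ^ j')" for k j k' j'
    using that unfolding eqv_def
  proof
    assume r: "(a * q ^ k * t ^ j) / (a * q ^ k' * t ^ j') \<in> pZ"
    have "(a * q ^ k * t ^ j) / (a * q ^ k' * t ^ j') =
        a powi 0 * b powi 0 * q powi (int k - int k') * t powi (int j - int j')"
      using nz by (simp add: power_int_diff)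
    from free_paramsD(3,4)[OF assms r this] show ?thesis by simp
  next
    assume r: "(a * q ^ k * t ^ j) * (a * q ^ k' * t ^ j') \<in> pZ"
    have "(a * q ^ k * t ^ j) * (a * q ^ k' * t ^ j') =
        a powi 2 * b powi 0 * q powi (int k + int k') * t powi (int j + int j')"
      using nz by (simp add: power_int_add power2_eq_square)
    from free_paramsD(1)[OF assms r this] show ?thesis by simp
  qed
  ultimately show ?thesis using nz by (auto simp: grid_def good_def)
qed

lemma indep_free:
  assumes "free_params a b q t" shows "indep (qt_grid a q t) (qt_grid b q t)"
  unfolding indep_def eqv_def
proof (intro allI notI, elim disjE)
  note nz = free_params_nz[OF assms]
  fix k j k' j'
  {
    assume r: "(a * q ^ k * t ^ j) / (b * q ^ k' * t ^ j') \<in> pZ"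
    have "(a * q ^ k * t ^ j) / (b * q ^ k' * t ^ j') =
        a powi 1 * b powi (- 1) * q powi (int k - int k') * t powi (int j - int j')"
      using nz by (simp add: power_int_diff power_int_minus divide_inverse)
    from free_paramsD(1)[OF assms r this] show False by simp
  next
    assume r: "(a * q ^ k * t ^ j) * (b * q ^ k' * t ^ j') \<in> pZ"
    have "(a * q ^ k * t ^ j) * (b * q ^ k' * t ^ j') =
        a powi 1 * b powi 1 * q powi (int k + int k') * t powi (int j + int j')"
      using nz by (simp add: power_int_add)
    from free_paramsD(1)[OF assms r this] show False by simp
  }
qed

lemma vanish_lex_dominated:
  assumes "vanish_lex m n \<alpha> A f" "seq m n \<kappa>'" "\<And>j. j < n \<Longrightarrow> \<kappa>' j \<le> \<alpha> j" "\<exists>j<n. \<kappa>' j < \<alpha> j"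
  shows "f (pt A \<kappa>' n) = 0"
proof -
  define i where "i = (LEAST j. j < n \<and> \<kappa>' j < \<alpha> j)"
  have i: "i < n \<and> \<kappa>' i < \<alpha> i" unfolding i_def using assms(4) by (rule LeastI_ex)
  have "\<kappa>' j = \<alpha> j" if "j < i" for j
    using not_less_Least[OF that[unfolded i_def]] assms(3)[of j] that i by auto
  then show ?thesis using i by (intro vanish_lexD[OF assms(1,2), of i]) auto
qed

text \<open>The extra vanishing. The parameter \<open>c\<close> of the difference operator is free: choosing it such that the
  operator annihilates the value at \<open>\<alpha>\<close> makes the image zero by unisolvence, and the image at \<open>\<mu>\<close> is a
  nonzero multiple of the value at \<open>\<mu>\<close>.\<close>

theorem vanish_lex_imp_below:
  assumes F: "TM m n F" and free: "free_params a b q t" and \<alpha>: "seq m n \<alpha>"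
    and below: "vanish_below m n (compl m n \<alpha>) (qt_grid b q t) (\<lambda>S. F (mset_set S))"
    and lex: "vanish_lex m n \<alpha> (qt_grid a q t) (\<lambda>S. F (mset_set S))"
  shows "vanish_below m n \<alpha> (qt_grid a q t) (\<lambda>S. F (mset_set S))"
proof -
  define s where "s = csqrt q"
  have q: "q = s\<^sup>2" by (simp add: s_def)
  define a' b' where "a' = a / s" and "b' = b / s"
  have free': "free_params a' b' (s\<^sup>2) t" unfolding a'_def b'_def
    using free_params_sqrt free unfolding q by blast
  note nz = free_params_nz[OF free] and nz' = free_params_nz[OF free']
  have s0: "s \<noteq> 0" using nz q by auto
  have sa: "s * a' = a" "s * b' = b" using s0 by (auto simp: a'_def b'_def)
  let ?A = "qt_grid (s * a') (s\<^sup>2) t" and ?B = "qt_grid (s * b') (s\<^sup>2) t"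
  let ?A' = "qt_grid a' (s\<^sup>2) t" and ?B' = "qt_grid b' (s\<^sup>2) t"
  have A: "grid good ?A" and B: "grid good ?B"
    using grid_free[OF free] grid_free[OF free_params_swap[OF free]] by (simp_all add: sa q)
  have A': "grid good ?A'" and B': "grid good ?B'"
    using grid_free[OF free'] grid_free[OF free_params_swap[OF free']] by simp_all
  have below': "vanish_below m n (compl m n \<alpha>) ?B (\<lambda>S. F (mset_set S))"
    and lex': "vanish_lex m n \<alpha> ?A (\<lambda>S. F (mset_set S))"
    using below lex by (simp_all add: sa q)
  \<comment> \<open>Induction on the size of \<open>\<mu>\<close> with the place \<open>j0\<close>
    fixed: a smaller sequence inside \<open>\<mu>\<close> is too small at the same place.\<close>
  have main: "F (mset_set (pt ?A \<mu> n)) = 0" if "seq m n \<mu>" "j0 < n" "\<mu> j0 < \<alpha> j0" for \<mu> j0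
    using that
  proof (induction "\<Sum>j<n. \<mu> j" arbitrary: \<mu> rule: less_induct)
    case less
    note \<mu> = less.prems(1) and j0 = less.prems(2,3)
    \<comment> \<open>With this value \<open>u\<close> vanishes at coordinate \<open>j0\<close> of
      the point of \<alpha>, which makes the coefficient at \<alpha> zero.\<close>
    define c where "c = 1 / (a' * (s\<^sup>2) ^ \<alpha> j0 * t ^ j0)"
    \<comment> \<open>The last parameter is forced by the balancing condition in
      \<open>T_D\<close>.\<close>
    define d where "d = p / (a' * b' * c * t ^ (n - 1) * s ^ (2 * m))"
    have cd: "c \<noteq> 0" "d \<noteq> 0" using nz' s0 by (simp_all add: c_def d_def)
    interpret difference_operator p s t a' b' c d
      by unfold_locales (use nz' s0 cd in auto)
    \<comment> \<open>The parameters a' and b' provide the zeros at 1/a' and 1/b' that keep the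
      operator inside both grids.\<close>
    have u0: "u (1 / a') = 0" "u (1 / b') = 0" using nz' by (simp_all add: u_def)
    have T: "T good m n (D F)"
      by (rule T_D[OF F]) (use nz' s0 cd in \<open>simp add: d_def\<close>)
    have "vanish good n {} (D F)"
    proof (rule unisolvence[OF T order_refl A' B' indep_free[OF free'] \<alpha>])
      show "vanish_below m n (compl m n \<alpha>) ?B' (D F)"
        unfolding vanish_below_def
      proof (intro allI impI, elim exE conjE)
        fix \<kappa> j assume \<kappa>: "seq m n \<kappa>" "j < n" "\<kappa> j < compl m n \<alpha> j"
        show "D F (pt ?B' \<kappa> n) = 0"
        proof (rule D_vanish[OF F nz'(2) u0(2) B' B \<kappa>(1)])
          fix \<kappa>' assume "seq m n \<kappa>'" "\<And>j. j < n \<Longrightarrow> \<kappa>' j \<le> \<kappa> j"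
          then show "F (mset_set (pt ?B \<kappa>' n)) = 0"
            using vanish_belowD[OF below' _ \<kappa>(2)] \<kappa>(2,3) by (meson le_less_trans)
        qed
      qed
      show "vanish_lex m n \<alpha> ?A' (D F)"
        unfolding vanish_lex_def
      proof (intro allI impI)
        fix \<kappa> i assume \<kappa>: "seq m n \<kappa>" "i < n" "\<forall>j<i. \<kappa> j = \<alpha> j" "\<kappa> i < \<alpha> i"
        show "D F (pt ?A' \<kappa> n) = 0"
        proof (rule D_vanish[OF F nz'(1) u0(1) A' A \<kappa>(1)])
          fix \<kappa>' assume \<kappa>': "seq m n \<kappa>'" "\<And>j. j < n \<Longrightarrow> \<kappa>' j \<le> \<kappa> j"
          \<comment> \<open>A sequence below \<open>\<kappa>\<close> is again lexicographically
            below \<alpha>, but may differ from it at an earlier place than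
            \<open>i\<close>.\<close>
          define i' where "i' = (LEAST j. \<kappa>' j < \<alpha> j)"
          have lt: "\<kappa>' i < \<alpha> i" using \<kappa>'(2)[OF \<kappa>(2)] \<kappa>(4) by simp
          then have i': "i' \<le> i" "\<kappa>' i' < \<alpha> i'" unfolding i'_def by (rule Least_le, rule LeastI)
          have "\<kappa>' j = \<alpha> j" if "j < i'" for j
            using not_less_Least[OF that[unfolded i'_def]] \<kappa>'(2)[of j] \<kappa>(2,3) that i'(1) by auto
          then show "F (mset_set (pt ?A \<kappa>' n)) = 0"
            using i' \<kappa>(2) by (intro vanish_lexD[OF lex' \<kappa>'(1), of i']) auto
        qed
      qed
      have "D F (pt ?A' \<alpha> n) = K (pt ?A' \<alpha> n) * F (mset_set (pt ?A \<alpha> n))"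
        by (rule D_single[OF F nz'(1) u0(1) A' A \<alpha>]) (rule vanish_lex_dominated[OF lex'])
      moreover have "c * ?A' (\<alpha> j0) j0 = 1" using nz' s0 by (simp add: c_def)
      then have "u (?A' (\<alpha> j0) j0) = 0" unfolding u_def by simp
      then have "K (pt ?A' \<alpha> n) = 0"
        unfolding K_def using pt_memI[OF j0(1), of ?A' \<alpha>] by (auto intro!: prod_zero bexI)
      ultimately show "D F (pt ?A' \<alpha> n) = 0" by simp
    qed
    then have "D F (pt ?A' \<mu> n) = 0"
      by (rule vanishD[OF _ gen_pt[OF A'] card_pt[OF A' order_refl]]) simp
    moreover have "D F (pt ?A' \<mu> n) = K (pt ?A' \<mu> n) * F (mset_set (pt ?A \<mu> n))"
    proof (rule D_single[OF F nz'(1) u0(1) A' A \<mu>])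
      fix \<kappa>' assume \<kappa>': "seq m n \<kappa>'" "\<And>j. j < n \<Longrightarrow> \<kappa>' j \<le> \<mu> j" "\<exists>j<n. \<kappa>' j < \<mu> j"
      have "(\<Sum>j<n. \<kappa>' j) < (\<Sum>j<n. \<mu> j)" using \<kappa>'(2,3) by (intro sum_strict_mono_ex1) auto
      then show "F (mset_set (pt ?A \<kappa>' n)) = 0"
        using \<kappa>'(2)[OF j0(1)] j0 by (intro less.hyps[OF _ \<kappa>'(1) j0(1)]) auto
    qed
    moreover have "K (pt ?A' \<mu> n) \<noteq> 0"
    proof -
      have mem: "\<exists>j<n. y = ?A' (\<mu> j) j" if "y \<in> pt ?A' \<mu> n" for y using that by (auto simp: pt_def)
      have th: "\<theta> x \<noteq> 0" if "x = a' powi i * b' powi j * (s\<^sup>2) powi k * t powi l" "\<not> (i = 0 \<and> j = 0 \<and> k = 0 \<and> l = 0)"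
        for x i j k l
      proof -
        have "x \<notin> pZ" using free_paramsD[OF free' _ that(1)] that(2) by blast
        moreover have "x \<noteq> 0" using nz' that(1) by simp
        ultimately show ?thesis by (simp add: theta_eq_0_iff)
      qed
      have 1: "u y / \<theta> (y\<^sup>2) \<noteq> 0" if ymem: "y \<in> pt ?A' \<mu> n" for y
      proof -
        obtain j where j: "j < n" "y = ?A' (\<mu> j) j" using mem[OF ymem] by blast
        have "\<theta> (a' * y) \<noteq> 0"
          by (rule th[of _ 2 0 "int (\<mu> j)" "int j"]) (simp_all add: j power2_eq_square)
        moreover have "\<theta> (b' * y) \<noteq> 0"
          by (rule th[of _ 1 1 "int (\<mu> j)" "int j"]) (simp_all add: j)
        \<comment> \<open>The exponent of t vanishes only for j = j0, and there the exponent of q is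
          the negative number \<open>\<mu> j0 - \<alpha> j0\<close>.\<close>
        moreover have "\<theta> (c * y) \<noteq> 0"
        proof (rule th[of _ 0 0 "int (\<mu> j) - int (\<alpha> j0)" "int j - int j0"])
          show "c * y = a' powi 0 * b' powi 0 * (s\<^sup>2) powi (int (\<mu> j) - int (\<alpha> j0)) * t powi (int j - int j0)"
            using nz' by (simp add: c_def j power_int_diff del: power2_eq_square)
          show "\<not> ((0::int) = 0 \<and> (0::int) = 0 \<and> int (\<mu> j) - int (\<alpha> j0) = 0 \<and> int j - int j0 = 0)"
            using j0(2) by auto
        qed
        moreover have "\<theta> (d * y) \<noteq> 0"
        proof -
          \<comment> \<open>\<open>c\<close> cancels the a' in the denominator of \<open>d\<close>.
            The remaining monomial has exponent -1 at b', so independence keeps it away from the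
            powers of p.\<close>
          have "d * y = p * (a' * (s\<^sup>2) ^ (\<alpha> j0 + \<mu> j) * t ^ (j0 + j) / (b' * (s\<^sup>2) ^ m * t ^ (n - 1)))"
            using nz' unfolding d_def power_mult by (simp add: c_def j power_add mult_ac)
          moreover have "\<theta> (a' * (s\<^sup>2) ^ (\<alpha> j0 + \<mu> j) * t ^ (j0 + j) / (b' * (s\<^sup>2) ^ m * t ^ (n - 1))) \<noteq> 0"
          proof (rule th[of _ 1 "- 1" "int (\<alpha> j0 + \<mu> j) - int m" "int (j0 + j) - int (n - 1)"])
            have q: "(s\<^sup>2) powi (int (\<alpha> j0 + \<mu> j) - int m) = (s\<^sup>2) ^ (\<alpha> j0 + \<mu> j) / (s\<^sup>2) ^ m"
              using nz' by (simp only: power_int_diff power_int_of_nat simp_thms)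
            have t: "t powi (int (j0 + j) - int (n - 1)) = t ^ (j0 + j) / t ^ (n - 1)"
              using nz' by (simp only: power_int_diff power_int_of_nat simp_thms)
            have b: "b' powi (- 1) = 1 / b'" by (simp add: power_int_minus divide_inverse)
            show "a' * (s\<^sup>2) ^ (\<alpha> j0 + \<mu> j) * t ^ (j0 + j) / (b' * (s\<^sup>2) ^ m * t ^ (n - 1)) =
                a' powi 1 * b' powi (- 1) * (s\<^sup>2) powi (int (\<alpha> j0 + \<mu> j) - int m)
                * t powi (int (j0 + j) - int (n - 1))"
              unfolding q t b by simp
          qed simp
          ultimately show ?thesis
            using theta_p_mult[of "a' * (s\<^sup>2) ^ (\<alpha> j0 + \<mu> j) * t ^ (j0 + j) / (b' * (s\<^sup>2) ^ m * t ^ (n - 1))"] nz'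
            by simp
        qed
        moreover have "\<theta> (y\<^sup>2) \<noteq> 0"
        proof (rule th[of _ 2 0 "int (2 * \<mu> j)" "int (2 * j)"])
          show "y\<^sup>2 = a' powi 2 * b' powi 0 * (s\<^sup>2) powi int (2 * \<mu> j) * t powi int (2 * j)"
            unfolding power_int_of_nat mult_2 power_add by (simp add: j power2_eq_square mult_ac)
        qed simp
        ultimately show ?thesis by (simp add: u_def)
      qed
      have 2: "\<theta> (t * \<Prod>e) / \<theta> (\<Prod>e) \<noteq> 0" if epairs: "e \<in> pairs (pt ?A' \<mu> n)" for e
      proof -
        obtain y y' where y: "e = {y, y'}" "y \<noteq> y'" "y \<in> pt ?A' \<mu> n" "y' \<in> pt ?A' \<mu> n"
          using epairs by (auto simp: pairs_def card_2_iff)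
        obtain j j' where j: "y = ?A' (\<mu> j) j" "y' = ?A' (\<mu> j') j'" using mem y(3,4) by blast
        have e: "\<Prod>e = ?A' (\<mu> j) j * ?A' (\<mu> j') j'" using y(1,2) j by simp
        have "\<theta> (t * \<Prod>e) \<noteq> 0" unfolding e
        proof (rule th[of _ 2 0 "int (\<mu> j + \<mu> j')" "int (Suc (j + j'))"])
          show "t * (?A' (\<mu> j) j * ?A' (\<mu> j') j')
            = a' powi 2 * b' powi 0 * (s\<^sup>2) powi int (\<mu> j + \<mu> j') * t powi int (Suc (j + j'))"
            unfolding power_int_of_nat power_Suc power_add by (simp add: power2_eq_square mult_ac)
        qed simp
        moreover have "\<theta> (\<Prod>e) \<noteq> 0" unfolding e
        proof (rule th[of _ 2 0 "int (\<mu> j + \<mu> j')" "int (j + j')"])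
          show "?A' (\<mu> j) j * ?A' (\<mu> j') j'
            = a' powi 2 * b' powi 0 * (s\<^sup>2) powi int (\<mu> j + \<mu> j') * t powi int (j + j')"
            unfolding power_int_of_nat power_add by (simp add: power2_eq_square mult_ac)
        qed simp
        ultimately show ?thesis by simp
      qed
      show ?thesis unfolding K_def using 1 2 by (simp add: finite_pairs)
    qed
    ultimately show ?case by simp
  qed
  then show ?thesis unfolding vanish_below_def by (auto simp: sa q)
qed

end

section \<open>Interpolation theta functions\<close>

context nome
begin

lemma generic_params_free:
  assumes "generic_params p [a, b, q, t]" shows "free_params a b q t"
proof -
  have nz: "a \<noteq> 0" "b \<noteq> 0" "q \<noteq> 0" "t \<noteq> 0" using assms by (auto simp: generic_params_def)
  have "i = 0 \<and> j = 0 \<and> k = 0 \<and> l = 0" if pZ: "a powi i * b powi j * q powi k * t powi l \<in> pZ" for i j k l :: int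
  proof -
    obtain s where s: "a powi i * b powi j * q powi k * t powi l = p powi s" using pZ by (auto simp: pZ_def)
    define e where "e = (\<lambda>r. [i, j, k, l] ! r)"
    have e: "e 0 = i" "e (Suc 0) = j" "e (Suc (Suc 0)) = k" "e (Suc (Suc (Suc 0))) = l" by (simp_all add: e_def)
    have "(\<Prod>r<length [a, b, q, t]. ([a, b, q, t] ! r) powi e r) = p powi s"
      by (simp add: lessThan_Suc e s mult_ac flip: s)
    then have "\<forall>r<length [a, b, q, t]. e r = 0"
      using assms unfolding generic_params_def by blast
    then have "e 0 = 0" "e (Suc 0) = 0" "e (Suc (Suc 0)) = 0" "e (Suc (Suc (Suc 0))) = 0" by simp_all
    then show ?thesis by (simp add: e)
  qed
  then show ?thesis using nz unfolding free_params_def by blast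
qed

text \<open>One coordinate at a time: for fixed generic \<open>z\<close> with its orbit removed,
  induction on \<open>r\<close> treats the other coordinates, and continuity in \<open>z\<close>
  then fills the countable exceptional set. Multisets allow repeated coordinates in the
  result.\<close>

lemma TM_zero_ext:
  "TM m r h \<Longrightarrow> W \<subseteq> good \<Longrightarrow> countable (- W) \<Longrightarrow> (\<And>S. gen W S \<Longrightarrow> card S = r \<Longrightarrow> h (mset_set S) = 0) \<Longrightarrow>
    size M = r \<Longrightarrow> 0 \<notin># M \<Longrightarrow> h M = 0"
proof (induction r arbitrary: h W M)
  case 0
  then show ?case using "0.prems"(4)[of "{}"] by (simp add: gen_def)
next
  case (Suc r)
  obtain w M' where M: "M = add_mset w M'" using Suc.prems(5) by (metis size_eq_Suc_imp_eq_union)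
  have M': "size M' = r" "0 \<notin># M'" "w \<noteq> 0" using Suc.prems(5,6) M by auto
  have zero: "h (add_mset z M') = 0" if z: "z \<in> W" for z
  proof (rule Suc.IH[where W = "W - orbit z" and h = "\<lambda>M. h (add_mset z M)" and M = M'])
    have z0: "z \<noteq> 0" using z Suc.prems(2) good_nz by blast
    show "TM m r (\<lambda>M. h (add_mset z M))"
      unfolding TM_def
    proof (intro allI impI)
      fix N :: "complex multiset" assume "Suc (size N) = r" "0 \<notin># N"
      then have "(\<lambda>y. h (add_mset y (add_mset z N))) \<in> V m"
        using Suc.prems(1) z0 by (simp add: TM_def)
      then show "(\<lambda>y. h (add_mset z (add_mset y N))) \<in> V m" by (simp add: add_mset_commute)
    qed
    have "- (W - orbit z) = - W \<union> orbit z" by auto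
    then show "countable (- (W - orbit z))" using Suc.prems(3) countable_orbit by simp
    fix S assume S: "gen (W - orbit z) S" "card S = r"
    have u: "gen W (insert z S)" "z \<notin> S" "card (insert z S) = Suc r"
      using gen_union[OF gen_single[OF z], of S] S Suc.prems(2) by auto
    then show "h (add_mset z (mset_set S)) = 0"
      using Suc.prems(4)[OF u(1,3)] gen_finite[OF S(1)] by simp
  qed (use Suc.prems(2) M' in auto)
  have V: "(\<lambda>z. h (add_mset z M')) \<in> V m" using Suc.prems(1) M' by (simp add: TM_def)
  have "h (add_mset w M') = 0"
    by (rule eq_off_countable[where S = "- {0}" and C = "- W" and f = "\<lambda>z. h (add_mset z M')" and g = "\<lambda>_. 0"])
      (use V_cont[OF V] Suc.prems(3) zero M'(3) in auto)
  then show ?case by (simp add: M)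
qed

text \<open>Slice vanishing is known for generic free variables only; continuity extends it to all
  nonzero ones, also when they are equivalent to one another or to the fixed coordinates.\<close>

lemma slice_zero:
  assumes F: "TM m n F" and A: "grid good A" and \<beta>: "\<And>j. j < n \<Longrightarrow> \<beta> j \<le> m"
    and below: "vanish_below m n \<beta> A (\<lambda>S. F (mset_set S))"
    and l: "l < n" "seq m (Suc l) \<kappa>" "\<kappa> l < \<beta> l"
    and M: "size M + Suc l = n" "0 \<notin># M"
  shows "F (mset_set (pt A \<kappa> (Suc l)) + M) = 0"
proof -
  define P where "P = pt A \<kappa> (Suc l)"
  have P: "gen good P" "card P = Suc l" "finite P"
    using gen_pt[OF A] card_pt[OF A order_refl] by (auto simp: P_def)
  have van: "vanish good n P (\<lambda>S. F (mset_set S))"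
    unfolding P_def by (rule vanish_slice_below0[OF TM_T[OF F order_refl] order_refl A \<beta> below l])
  define h where "h = (\<lambda>M. F (mset_set P + M))"
  have P0: "0 \<notin># mset_set P" using gen_nz[OF P(1)] P(3) by auto
  have "h M = 0"
  proof (rule TM_zero_ext[where W = "good - orbits P"])
    show "TM m (size M) h"
      unfolding TM_def
    proof (intro allI impI)
      fix N :: "complex multiset" assume "Suc (size N) = size M" "0 \<notin># N"
      then show "(\<lambda>z. h (add_mset z N)) \<in> V m"
        using F P0 P(2) M(1) by (simp add: TM_def h_def)
    qed
    have "- (good - orbits P) = - good \<union> orbits P" by auto
    moreover have "countable (orbits P)" unfolding orbits_def
      by (rule countable_UN[OF countable_finite[OF P(3)] countable_orbit])
    ultimately show "countable (- (good - orbits P))" using countable_not_good by simp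
    fix S assume S: "gen (good - orbits P) S" "card S = size M"
    note u = gen_union[OF P(1) S(1) order_refl]
    have "F (mset_set (P \<union> S)) = 0" by (rule vanishD[OF van u(1)]) (use u(3) S(2) P(2) M(1) in auto)
    then show "h (mset_set S) = 0" using u(2) P(3) gen_finite[OF S(1)] by (simp add: h_def mset_set_Union)
  qed (use M in auto)
  then show ?thesis by (simp add: h_def P_def)
qed

end

section \<open>Symmetric functions as functions of multisets\<close>

text \<open>The enumeration is arbitrary; for symmetric \<open>P\<close> and a multiset of
  \<open>n\<close> nonzero points every choice gives the same value.\<close>

definition of_mset :: "nat \<Rightarrow> ((nat \<Rightarrow> complex) \<Rightarrow> complex) \<Rightarrow> complex multiset \<Rightarrow> complex" where
  "of_mset n P M = P (\<lambda>i\<in>{1..n}. (SOME xs. mset xs = M) ! (i - 1))"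

lemma of_mset_eq:
  assumes sym: "\<And>x \<pi>. x \<in> torus n \<Longrightarrow> \<pi> permutes {1..n} \<Longrightarrow> P (x \<circ> \<pi>) = P x" and x: "x \<in> torus n"
  shows "of_mset n P (image_mset x (mset_set {1..n})) = P x"
proof -
  define ys where "ys = map x [1..<Suc n]"
  define xs where "xs = (SOME xs. mset xs = image_mset x (mset_set {1..n}))"
  have "mset ys = image_mset x (mset_set {1..n})"
    by (simp add: ys_def atLeastLessThanSuc_atLeastAtMost[symmetric] del: upt_Suc)
  then have xs: "mset xs = mset ys" unfolding xs_def by (metis (mono_tags) someI)
  then obtain \<pi> where \<pi>: "\<pi> permutes {..<length ys}" "permute_list \<pi> ys = xs"
    using mset_eq_permutation by metis
  have len: "length ys = n" by (simp add: ys_def)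
  \<comment> \<open>The permutation of list positions, which start at 0, is carried over to indices
    starting at 1 and extended by the identity.\<close>
  define \<rho> where "\<rho> = (\<lambda>i. if i \<in> {1..n} then Suc (\<pi> (i - 1)) else i)"
  have "bij_betw \<rho> {1..n} {1..n}"
  proof -
    have "bij_betw (\<lambda>i. i - 1) {1..n} {..<n}"
      by (rule bij_betw_byWitness[of _ Suc]) auto
    moreover have "bij_betw \<pi> {..<n} {..<n}" using permutes_imp_bij[OF \<pi>(1)] len by simp
    moreover have "bij_betw Suc {..<n} {1..n}"
      by (rule bij_betw_byWitness[of _ "\<lambda>i. i - 1"]) auto
    ultimately have "bij_betw (Suc \<circ> (\<pi> \<circ> (\<lambda>i. i - 1))) {1..n} {1..n}"
      by (intro bij_betw_trans)
    then show ?thesis by (rule bij_betw_cong[THEN iffD1, rotated]) (simp add: \<rho>_def)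
  qed
  then have \<rho>: "\<rho> permutes {1..n}" by (rule bij_imp_permutes) (auto simp: \<rho>_def)
  have "(\<lambda>i\<in>{1..n}. xs ! (i - 1)) = x \<circ> \<rho>"
  proof
    fix i
    show "(\<lambda>i\<in>{1..n}. xs ! (i - 1)) i = (x \<circ> \<rho>) i"
    proof (cases "i \<in> {1..n}")
      case True
      then have i: "i - 1 < n" by auto
      then have "\<pi> (i - 1) < n" using permutes_in_image[OF \<pi>(1), of "i - 1"] len by simp
      then have "xs ! (i - 1) = x (Suc (\<pi> (i - 1)))"
        unfolding \<pi>(2)[symmetric] using i len \<pi>(1) by (simp add: permute_list_nth ys_def del: upt_Suc)
      then show ?thesis using True by (simp add: \<rho>_def)
    next
      case False
      then have "x i = undefined" using x PiE_arb[of x "{1..n}" _ i] unfolding torus_def by blast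
      then show ?thesis using False by (auto simp: \<rho>_def)
    qed
  qed
  then show ?thesis using sym[OF x \<rho>] by (simp add: of_mset_def xs_def)
qed

lemma torus_upd: "x \<in> torus n \<Longrightarrow> i \<in> {1..n} \<Longrightarrow> z \<noteq> 0 \<Longrightarrow> x(i := z) \<in> torus n"
  unfolding torus_def by (auto simp: PiE_iff extensional_def)

context nome
begin

text \<open>By symmetry the moving variable can be placed at index 1, where \<open>BC_theta\<close>
  states the quasi-periodicity.\<close>

lemma TM_of_mset:
  assumes P: "BC_theta p m n P"
  shows "TM m n (of_mset n P)"
  unfolding TM_def
proof (intro allI impI)
  fix M :: "complex multiset" assume M: "Suc (size M) = n" "0 \<notin># M"
  have sym: "P (x \<circ> \<pi>) = P x" if "x \<in> torus n" "\<pi> permutes {1..n}" for x \<pi>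
    using P that by (auto simp: BC_theta_def)
  obtain ys where ys: "mset ys = M" using ex_mset by blast
  have len: "length ys = n - 1" using M(1) ys by auto
  have n1: "1 \<in> {1..n}" using M(1) by auto
  \<comment> \<open>The entry 1 at the first index is a nonzero placeholder, overwritten by
    \<open>z\<close> below.\<close>
  define x0 where "x0 = (\<lambda>i\<in>{1..n}. (1 # ys) ! (i - 1))"
  have x0: "x0 \<in> torus n"
  proof -
    have "(1 # ys) ! (i - 1) \<noteq> 0" if "i \<in> {1..n}" for i
    proof -
      have "(1 # ys) ! (i - 1) \<in> set (1 # ys)" using that len by (intro nth_mem) auto
      moreover have "0 \<notin> set (1 # ys)" using M(2) ys by auto
      ultimately show ?thesis by metis
    qed
    then show ?thesis unfolding torus_def x0_def by auto
  qed
  have img: "image_mset (x0(1 := z)) (mset_set {1..n}) = add_mset z M" for z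
  proof -
    have "{1..n} = insert 1 {2..n}" using n1 by auto
    then have "mset_set {1..n} = add_mset 1 (mset_set {2..n})" by simp
    moreover have "image_mset (x0(1 := z)) (mset_set {2..n}) = image_mset (\<lambda>i. ys ! (i - 2)) (mset_set {2..n})"
    proof (rule image_mset_cong)
      fix i assume "i \<in># mset_set {2..n}"
      then have "2 \<le> i" "i \<le> n" by auto
      moreover from this have "i - 1 = Suc (i - 2)" by simp
      ultimately show "(x0(1 := z)) i = ys ! (i - 2)" by (simp add: x0_def)
    qed
    moreover have "image_mset (\<lambda>i. ys ! (i - 2)) (mset_set {2..n}) = M"
    proof -
      have "image_mset (\<lambda>i. i - 2) (mset_set {2..n}) = mset_set {..<n - 1}"
      proof (subst image_mset_mset_set)
        show "inj_on (\<lambda>i. i - 2) {2..n}" by (auto simp: inj_on_def)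
        have "bij_betw (\<lambda>i. i - 2) {2..n} {..<n - 1}"
          by (rule bij_betw_byWitness[of _ "\<lambda>j. j + 2"]) auto
        then show "mset_set ((\<lambda>i. i - 2) ` {2..n}) = mset_set {..<n - 1}" by (simp add: bij_betw_def)
      qed
      then have "image_mset (\<lambda>i. ys ! (i - 2)) (mset_set {2..n}) = image_mset ((!) ys) (mset_set {..<n - 1})"
        by (metis (no_types, lifting) image_mset.compositionality comp_def image_mset_cong)
      also have "\<dots> = mset (map ((!) ys) [0..<length ys])"
        unfolding len mset_map mset_upt by (simp add: lessThan_atLeast0)
      also have "\<dots> = M" by (simp only: map_nth ys)
      finally show ?thesis .
    qed
    ultimately show ?thesis by simp
  qed
  have eq: "of_mset n P (add_mset z M) = P (x0(1 := z))" if "z \<noteq> 0" for z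
    using of_mset_eq[of n P, OF sym torus_upd[OF x0 n1 that]] unfolding img by simp
  have "(\<lambda>z. P (x0(1 := z))) holomorphic_on - {0}"
    using P x0 n1 unfolding BC_theta_def holomorphic_on_torus_def by blast
  then have "(\<lambda>z. of_mset n P (add_mset z M)) holomorphic_on - {0}"
    by (rule holomorphic_transform) (simp add: eq)
  moreover have "of_mset n P (add_mset (1 / z) M) = of_mset n P (add_mset z M)" if z: "z \<noteq> 0" for z
  proof -
    have "P ((x0(1 := z))(1 := 1 / (x0(1 := z)) 1)) = P (x0(1 := z))"
      using P torus_upd[OF x0 n1 z] n1 unfolding BC_theta_def by blast
    then show ?thesis using z by (simp add: eq)
  qed
  moreover have "of_mset n P (add_mset (p * z) M) = (p * z\<^sup>2) powi (- int m) * of_mset n P (add_mset z M)"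
    if z: "z \<noteq> 0" for z
  proof -
    have "n \<ge> 1" using M(1) by simp
    then have "P ((x0(1 := z))(1 := p * (x0(1 := z)) 1)) = (p * ((x0(1 := z)) 1)\<^sup>2) powi (- int m) * P (x0(1 := z))"
      using P torus_upd[OF x0 n1 z] unfolding BC_theta_def by blast
    then show ?thesis using z by (simp add: eq)
  qed
  ultimately show "(\<lambda>z. of_mset n P (add_mset z M)) \<in> V m" by (simp add: V_def)
qed

section \<open>Translation of the defining points into sequences\<close>

lemma image_mset_pt_up:
  assumes "grid good B"
  shows "image_mset (\<lambda>i. B (\<kappa> (i - 1)) (i - 1)) (mset_set {1..l}) = mset_set (pt B \<kappa> l)"
proof -
  have "inj_on (\<lambda>i. B (\<kappa> (i - 1)) (i - 1)) {1..l}"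
    by (auto simp: inj_on_def grid_inj[OF assms])
  from image_mset_mset_set[OF this]
  have "image_mset (\<lambda>i. B (\<kappa> (i - 1)) (i - 1)) (mset_set {1..l}) = mset_set ((\<lambda>i. B (\<kappa> (i - 1)) (i - 1)) ` {1..l})" .
  also have "(\<lambda>i. B (\<kappa> (i - 1)) (i - 1)) ` {1..l} = (\<lambda>j. B (\<kappa> j) j) ` (\<lambda>i. i - 1) ` {1..l}"
    by (simp only: image_image)
  also have "(\<lambda>i. i - 1) ` {1..l} = {..<l}" by (force simp: image_iff intro: bexI[of _ "Suc _"])
  finally show ?thesis by (simp add: pt_def)
qed

text \<open>On the a-grid coordinate i carries t^(n-i), so place \<open>j\<close> of the increasing
  sequence is coordinate n - j, and the coordinates after \<open>l\<close> are the first n - l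
  places.\<close>

lemma image_mset_pt_down:
  assumes "grid good A" "l \<le> n"
  shows "image_mset (\<lambda>i. A (\<kappa> (n - i)) (n - i)) (mset_set {Suc l..n}) = mset_set (pt A \<kappa> (n - l))"
proof -
  have "inj_on (\<lambda>i. A (\<kappa> (n - i)) (n - i)) {Suc l..n}"
    by (auto simp: inj_on_def grid_inj[OF assms(1)])
  from image_mset_mset_set[OF this]
  have "image_mset (\<lambda>i. A (\<kappa> (n - i)) (n - i)) (mset_set {Suc l..n})
    = mset_set ((\<lambda>i. A (\<kappa> (n - i)) (n - i)) ` {Suc l..n})" .
  also have "(\<lambda>i. A (\<kappa> (n - i)) (n - i)) ` {Suc l..n} = (\<lambda>j. A (\<kappa> j) j) ` (\<lambda>i. n - i) ` {Suc l..n}"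
    by (simp only: image_image)
  also have "(\<lambda>i. n - i) ` {Suc l..n} = {..<n - l}"
  proof -
    have "bij_betw (\<lambda>i. n - i) {Suc l..n} {..<n - l}"
      by (rule bij_betw_byWitness[of _ "\<lambda>j. n - j"]) auto
    then show ?thesis by (simp add: bij_betw_def)
  qed
  finally show ?thesis by (simp add: pt_def)
qed

end

lemma image_mset_split:
  assumes "l \<le> (n :: nat)"
  shows "image_mset (\<lambda>i\<in>{1..n}. if i \<le> l then g i else h i) (mset_set {1..n})
    = image_mset g (mset_set {1..l}) + image_mset h (mset_set {Suc l..n})"
proof -
  have "{1..n} = {1..l} \<union> {Suc l..n}" "{1..l} \<inter> {Suc l..n} = {}" using assms by auto
  then have "mset_set {1..n} = mset_set {1..l} + mset_set {Suc l..n}"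
    by (metis finite_atLeastAtMost mset_set_Union)
  then show ?thesis using assms by (auto intro!: image_mset_cong arg_cong2[where f = "(+)"])
qed

lemma antimono_chain:
  assumes "\<And>i. k \<le> i \<Longrightarrow> i < n \<Longrightarrow> mu (Suc i) \<le> (mu i :: nat)" "k \<le> i" "i \<le> j" "j \<le> n"
  shows "mu j \<le> mu i"
  using assms(3,4)
proof (induction j rule: dec_induct)
  case (step j)
  then show ?case using assms(1)[of j] assms(2) by simp
qed simp

theorem corollary3p2:
  fixes p a b q t :: complex and m n :: nat and lam :: "nat \<Rightarrow> nat"
    and P :: "(nat \<Rightarrow> complex) \<Rightarrow> complex"
  assumes "0 < norm p" and "norm p < 1"
    and "generic_params p [a, b, q, t]"
    and "lam \<in> partitions_in m n"
    and "is_interp_theta p m n lam a b q t P"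
  shows "(\<forall>(l::nat) (mu :: nat \<Rightarrow> nat) (x :: nat \<Rightarrow> complex).
            1 \<le> l \<longrightarrow> l < n \<longrightarrow>
            (\<forall>i. l + 1 \<le> i \<and> i < n \<longrightarrow> mu (i + 1) \<le> mu i) \<longrightarrow>
            mu (l + 1) < lam (l + 1) \<longrightarrow>
            (\<forall>i\<in>{1..l}. x i \<noteq> 0) \<longrightarrow>
            P (\<lambda>i\<in>{1..n}. if i \<le> l then x i else a * q ^ mu i * t ^ (n - i)) = 0) \<and>
         (\<forall>(l::nat) (mu :: nat \<Rightarrow> nat) (x :: nat \<Rightarrow> complex).
            1 \<le> l \<longrightarrow> l \<le> n \<longrightarrow>
            mu 1 \<le> m \<longrightarrow>
            (\<forall>i. 1 \<le> i \<and> i < l \<longrightarrow> mu (i + 1) \<le> mu i) \<longrightarrow>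
            lam l < mu l \<longrightarrow>
            (\<forall>i\<in>{l+1..n}. x i \<noteq> 0) \<longrightarrow>
            P (\<lambda>i\<in>{1..n}. if i \<le> l then b * q ^ (m - mu i) * t ^ (i - 1) else x i) = 0)"
proof -
  interpret nome p using assms(1,2) by unfold_locales
  have free: "free_params a b q t" using assms(3) by (rule generic_params_free)
  note nz = free_params_nz[OF free]
  define A where "A = (qt_grid a q t)"
  define B where "B = (qt_grid b q t)"
  have A: "grid good A" and B: "grid good B" and AB: "indep A B"
    unfolding A_def B_def using grid_free free free_params_swap indep_free by blast+
  have A0: "A k j \<noteq> 0" and B0: "B k j \<noteq> 0" for k j using nz by (simp_all add: A_def B_def)
  have BC: "BC_theta p m n P"
    and van: "\<And>mu. mu \<in> partitions_in m n \<Longrightarrow> mu \<noteq> lam \<Longrightarrow> P (vanishing_point m n lam mu a b q t) = 0"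
    using assms(5) by (auto simp: is_interp_theta_def)
  define F where "F = of_mset n P"
  have TM: "TM m n F" unfolding F_def using BC by (rule TM_of_mset)
  have P_eq: "P x = F (image_mset x (mset_set {1..n}))" if "x \<in> torus n" for x
    unfolding F_def using BC that by (subst of_mset_eq) (auto simp: BC_theta_def)
  have lam_le: "lam i \<le> m" if "i \<in> {1..n}" for i using assms(4) that by (auto simp: partitions_in_def)
  have lam_mono: "lam j \<le> lam i" if "1 \<le> i" "i \<le> j" "j \<le> n" for i j
    using assms(4) that by (auto simp: partitions_in_def)
  define \<alpha> where "\<alpha> = (\<lambda>j. lam (n - j))"
  have \<alpha>: "seq m n \<alpha>"
    by (rule seqI) (auto simp: \<alpha>_def intro!: lam_le lam_mono)
  have point: "P (\<lambda>i\<in>{1..n}. if i \<le> l then B (\<rho> (i - 1)) (i - 1) else A (\<kappa> (n - i)) (n - i))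
      = F (mset_set (pt A \<kappa> (n - l) \<union> pt B \<rho> l))" if l: "l \<le> n" for l \<kappa> \<rho>
  proof -
    have "pt A \<kappa> (n - l) \<inter> pt B \<rho> l = {}"
    proof (rule ccontr)
      assume "\<not> ?thesis"
      then obtain i j where "A (\<kappa> i) i = B (\<rho> j) j" by (auto simp: pt_def)
      then have "eqv (A (\<kappa> i) i) (B (\<rho> j) j)" using eqv_refl[OF A0] by metis
      then show False using AB by (simp add: indep_def)
    qed
    then have "mset_set (pt A \<kappa> (n - l) \<union> pt B \<rho> l) = mset_set (pt B \<rho> l) + mset_set (pt A \<kappa> (n - l))"
      by (simp add: mset_set_Union)
    moreover have "(\<lambda>i\<in>{1..n}. if i \<le> l then B (\<rho> (i - 1)) (i - 1) else A (\<kappa> (n - i)) (n - i)) \<in> torus n"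
      using A0 B0 by (auto simp: torus_def)
    ultimately show ?thesis
      using P_eq image_mset_split[OF l, of "\<lambda>i. B (\<rho> (i - 1)) (i - 1)" "\<lambda>i. A (\<kappa> (n - i)) (n - i)"]
        image_mset_pt_up[OF B, of \<rho> l] image_mset_pt_down[OF A l, of \<kappa>] by simp
  qed
  have zeros: "interp_zeros m n \<alpha> A B (\<lambda>S. F (mset_set S))"
    unfolding interp_zeros_def
  proof (intro allI impI)
    fix \<kappa> i assume \<kappa>: "seq m n \<kappa>" and i: "i < n" and eq: "\<forall>j<i. \<kappa> j = \<alpha> j"
    define mu where "mu = (\<lambda>k. if k \<in> {1..n} then \<kappa> (n - k) else 0)"
    have mu: "mu \<in> partitions_in m n"
      unfolding partitions_in_def mu_def using \<kappa> by (auto intro!: seq_mono[OF \<kappa>] seq_le[OF \<kappa>])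
    have diff: "mu k \<noteq> lam k \<longleftrightarrow> \<kappa> (n - k) \<noteq> \<alpha> (n - k)" if "k \<in> {1..n}" for k
      using that by (simp add: mu_def \<alpha>_def)
    \<comment> \<open>Reversing the order turns the first differing place \<open>i\<close> into the
      last differing index n - i.\<close>
    have last: "last_diff n lam mu = n - i" if ne: "\<kappa> i \<noteq> \<alpha> i"
      unfolding last_diff_def
    proof (rule Max_eqI)
      show "k \<le> n - i" if "k \<in> {k \<in> {1..n}. mu k \<noteq> lam k}" for k
        using that eq diff[of k] by (cases "n - k < i") auto
      show "n - i \<in> {k \<in> {1..n}. mu k \<noteq> lam k}" using diff[of "n - i"] i ne by simp
    qed simp
    have mui: "mu (n - i) = \<kappa> i" "lam (n - i) = \<alpha> i" using i by (simp_all add: mu_def \<alpha>_def)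
    have neq: "mu \<noteq> lam" if "\<kappa> i \<noteq> \<alpha> i" using mui that by auto
    show "(\<kappa> i < \<alpha> i \<longrightarrow> (\<forall>r\<le>n. (\<forall>j<n. (\<kappa> j = m) = (r \<le> j)) \<longrightarrow>
            F (mset_set (pt A \<kappa> r \<union> pt B (\<lambda>_. 0) (n - r))) = 0)) \<and>
        (\<alpha> i < \<kappa> i \<longrightarrow> F (mset_set (pt A \<kappa> i \<union> pt B (compl m n \<kappa>) (n - i))) = 0)"
    proof (intro conjI impI allI)
      fix r assume lt: "\<kappa> i < \<alpha> i" and r: "r \<le> n" "\<forall>j<n. (\<kappa> j = m) = (r \<le> j)"
      \<comment> \<open>The full parts are the first n - r ones, so the b-coordinates all carry q^0,
        in accordance with the constant sequence 0.\<close>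
      have full: "mu k = m \<longleftrightarrow> k \<le> n - r" if "k \<in> {1..n}" for k
        using that r(1) r(2)[rule_format, of "n - k"] by (auto simp: mu_def)
      have "last_full m n mu = n - r"
        unfolding last_full_def
      proof (rule Max_eqI)
        show "k \<le> n - r" if "k \<in> insert 0 {k \<in> {1..n}. mu k = m}" for k using that full by auto
        show "n - r \<in> insert 0 {k \<in> {1..n}. mu k = m}"
          using full[of "n - r"] by (cases "n - r = 0") auto
      qed simp
      then have split: "split_index m n lam mu = n - r"
        using last lt mui by (simp add: split_index_def)
      have "vanishing_point m n lam mu a b q t =
          (\<lambda>k\<in>{1..n}. if k \<le> n - r then B ((\<lambda>_. 0) (k - 1)) (k - 1) else A (\<kappa> (n - k)) (n - k))"
        unfolding vanishing_point_def split
      proof (rule restrict_ext)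
        fix k assume k: "k \<in> {1..n}"
        show "(if k \<le> n - r then b * q ^ (m - mu k) * t ^ (k - 1) else a * q ^ mu k * t ^ (n - k)) =
          (if k \<le> n - r then B ((\<lambda>_. 0) (k - 1)) (k - 1) else A (\<kappa> (n - k)) (n - k))"
          using full[OF k] k by (auto simp: A_def B_def mu_def)
      qed
      then show "F (mset_set (pt A \<kappa> r \<union> pt B (\<lambda>_. 0) (n - r))) = 0"
        using van[OF mu neq] lt point[of "n - r" "\<lambda>_. 0" \<kappa>] r(1) by simp
    next
      assume gt: "\<alpha> i < \<kappa> i"
      have split: "split_index m n lam mu = n - i"
        using last gt mui by (simp add: split_index_def)
      have "vanishing_point m n lam mu a b q t =
          (\<lambda>k\<in>{1..n}. if k \<le> n - i then B (compl m n \<kappa> (k - 1)) (k - 1) else A (\<kappa> (n - k)) (n - k))"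
        unfolding vanishing_point_def split
      proof (rule restrict_ext)
        fix k assume k: "k \<in> {1..n}"
        then have "n - 1 - (k - 1) = n - k" by auto
        then show "(if k \<le> n - i then b * q ^ (m - mu k) * t ^ (k - 1) else a * q ^ mu k * t ^ (n - k)) =
          (if k \<le> n - i then B (compl m n \<kappa> (k - 1)) (k - 1) else A (\<kappa> (n - k)) (n - k))"
          using k by (simp add: A_def B_def mu_def compl_def)
      qed
      then show "F (mset_set (pt A \<kappa> i \<union> pt B (compl m n \<kappa>) (n - i))) = 0"
        using van[OF mu neq] gt point[of "n - i" "compl m n \<kappa>" \<kappa>] i by simp
    qed
  qed
  have belowB: "vanish_below m n (compl m n \<alpha>) B (\<lambda>S. F (mset_set S))"
    and lex: "vanish_lex m n \<alpha> A (\<lambda>S. F (mset_set S))"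
    using interp_zeros_imp[OF TM_T[OF TM order_refl] order_refl A B AB \<alpha> zeros] by auto
  have belowA: "vanish_below m n \<alpha> A (\<lambda>S. F (mset_set S))"
    using vanish_lex_imp_below[OF TM free \<alpha>] belowB lex unfolding A_def B_def by blast
  show ?thesis
  proof (intro conjI allI impI)
    fix l :: nat and mu :: "nat \<Rightarrow> nat" and x :: "nat \<Rightarrow> complex"
    assume l: "1 \<le> l" "l < n" and mono: "\<forall>i. l + 1 \<le> i \<and> i < n \<longrightarrow> mu (i + 1) \<le> mu i"
      and lt: "mu (l + 1) < lam (l + 1)" and x: "\<forall>i\<in>{1..l}. x i \<noteq> 0"
    \<comment> \<open>Only the places 0 to n - l - 1 are used; the last of them, \<open>l'\<close>,
      carries \<open>mu (l + 1)\<close>.\<close>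
    define \<kappa> where "\<kappa> = (\<lambda>j. mu (n - j))"
    obtain l' where l': "n - l = Suc l'" using l(2) by (metis Suc_diff_Suc)
    have chain: "mu j \<le> mu i" if "l + 1 \<le> i" "i \<le> j" "j \<le> n" for i j
      by (rule antimono_chain[of "l + 1" n mu]) (use mono that in auto)
    have top: "\<kappa> l' = mu (l + 1)" "\<alpha> l' = lam (l + 1)"
    proof -
      have "n - l' = l + 1" using l' l(2) by simp
      then show "\<kappa> l' = mu (l + 1)" "\<alpha> l' = lam (l + 1)" by (simp_all add: \<kappa>_def \<alpha>_def)
    qed
    have \<kappa>: "seq m (Suc l') \<kappa>"
    proof (rule seqI)
      show mono': "\<kappa> i \<le> \<kappa> j" if "i \<le> j" "j < Suc l'" for i j
        unfolding \<kappa>_def using that l' by (intro chain) auto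
      \<comment> \<open>The bound comes from the largest given part,
        \<open>mu (l + 1) < lam (l + 1) \<le> m\<close>.\<close>
      show "\<kappa> j \<le> m" if "j < Suc l'" for j
        using mono'[of j l'] that top lt lam_le[of "l + 1"] l(2) by simp
    qed
    define pnt where "pnt = (\<lambda>i\<in>{1..n}. if i \<le> l then x i else a * q ^ mu i * t ^ (n - i))"
    have pnt: "pnt = (\<lambda>i\<in>{1..n}. if i \<le> l then x i else A (\<kappa> (n - i)) (n - i))"
      unfolding pnt_def by (rule restrict_ext) (auto simp: A_def \<kappa>_def)
    have "pnt \<in> torus n" unfolding pnt using A0 x by (auto simp: torus_def)
    then have "P pnt = F (image_mset pnt (mset_set {1..n}))" by (rule P_eq)
    also have "image_mset pnt (mset_set {1..n}) = mset_set (pt A \<kappa> (Suc l')) + image_mset x (mset_set {1..l})"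
      using image_mset_split[of l n x "\<lambda>i. A (\<kappa> (n - i)) (n - i)"] image_mset_pt_down[OF A, of l n \<kappa>] l(2) l'
      unfolding pnt by (simp add: add.commute)
    also have "F (mset_set (pt A \<kappa> (Suc l')) + image_mset x (mset_set {1..l})) = 0"
      by (rule slice_zero[OF TM A seq_le[OF \<alpha>] belowA _ \<kappa>]) (use l' l x top lt in auto)
    finally show "P (\<lambda>i\<in>{1..n}. if i \<le> l then x i else a * q ^ mu i * t ^ (n - i)) = 0"
      unfolding pnt_def .
  next
    fix l :: nat and mu :: "nat \<Rightarrow> nat" and x :: "nat \<Rightarrow> complex"
    assume l: "1 \<le> l" "l \<le> n" and mu1: "mu 1 \<le> m"
      and mono: "\<forall>i. 1 \<le> i \<and> i < l \<longrightarrow> mu (i + 1) \<le> mu i"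
      and gt: "lam l < mu l" and x: "\<forall>i\<in>{l+1..n}. x i \<noteq> 0"
    define \<kappa> where "\<kappa> = (\<lambda>j. m - mu (Suc j))"
    obtain l' where l': "l = Suc l'" using l(1) by (cases l) auto
    have chain: "mu j \<le> mu i" if "1 \<le> i" "i \<le> j" "j \<le> l" for i j
      by (rule antimono_chain[of 1 l mu]) (use mono that in auto)
    have \<kappa>: "seq m (Suc l') \<kappa>"
      by (rule seqI) (auto simp: \<kappa>_def l' intro!: diff_le_mono2 chain)
    \<comment> \<open>This bound turns \<open>lam l < mu l\<close> into a strict inequality of
      complements, despite truncated subtraction.\<close>
    have "mu l \<le> m" using chain[of 1 l] l mu1 by simp
    moreover have "n - (n - 1 - l') = l" using l l' by simp
    ultimately have top: "\<kappa> l' < compl m n \<alpha> l'"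
      using gt by (simp add: \<kappa>_def compl_def \<alpha>_def l')
    define pnt where "pnt = (\<lambda>i\<in>{1..n}. if i \<le> l then b * q ^ (m - mu i) * t ^ (i - 1) else x i)"
    have pnt: "pnt = (\<lambda>i\<in>{1..n}. if i \<le> l then B (\<kappa> (i - 1)) (i - 1) else x i)"
      unfolding pnt_def by (rule restrict_ext) (auto simp: B_def \<kappa>_def)
    have "pnt \<in> torus n" unfolding pnt using B0 x by (auto simp: torus_def)
    then have "P pnt = F (image_mset pnt (mset_set {1..n}))" by (rule P_eq)
    also have "image_mset pnt (mset_set {1..n}) = mset_set (pt B \<kappa> (Suc l')) + image_mset x (mset_set {Suc l..n})"
      using image_mset_split[of l n "\<lambda>i. B (\<kappa> (i - 1)) (i - 1)" x] image_mset_pt_up[OF B, of \<kappa> l] l(2)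
      unfolding pnt l' by simp
    also have "F (mset_set (pt B \<kappa> (Suc l')) + image_mset x (mset_set {Suc l..n})) = 0"
      by (rule slice_zero[OF TM B compl_le belowB _ \<kappa> top]) (use l' l x in auto)
    finally show "P (\<lambda>i\<in>{1..n}. if i \<le> l then b * q ^ (m - mu i) * t ^ (i - 1) else x i) = 0"
      unfolding pnt_def .
  qed
qed

end
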